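(* Let $\mathrm{PL}(S^1)$ be the group of piecewise linear homeomorphisms of the circle. Then: (1) the group $F_2\times\mathbb{Z}$ does not embed into $\mathrm{PL}(S^1)$ (there is no injective homomorphism $F_2\times\mathbb{Z}\to \mathrm{PL}(S^1)$), where $F_2$ is the free group of rank two; (2) the group $\mathbb{Z}^2*\mathbb{Z}$ does not embed into $\mathrm{PL}(S^1)$.
   Context: $S^1=\mathbb{R}/\mathbb{Z}$. A homeomorphism $f$ of $S^1$ (possibly orientation reversing) is piecewise linear if, away from a finite set of points, $f$ is locally given by an affine map $x\mapsto \alpha x+\beta$ with constants $\alpha\neq 0$ and $\beta$. $\mathrm{PL}(S^1)$ is the group of all such homeomorphisms under composition. *)

theory Defs
  imports "HOL-Analysis.Analysis" "HOL-Algebra.Elementary_Groups"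
begin

section \<open>The circle and its piecewise linear homeomorphisms\<close>

quotient_type circle = real / "\<lambda>x y :: real. x - y \<in> \<int>"
  morphisms rep_circle circle_of
proof (rule equivpI)
  show "reflp (\<lambda>x y :: real. x - y \<in> \<int>)"
    by (simp add: reflp_def)
  show "symp (\<lambda>x y :: real. x - y \<in> \<int>)"
    by (metis (mono_tags, lifting) Ints_minus minus_diff_eq sympI)
  show "transp (\<lambda>x y :: real. x - y \<in> \<int>)"
  proof (rule transpI)
    fix x y z :: real
    assume "x - y \<in> \<int>" "y - z \<in> \<int>"
    then have "(x - y) + (y - z) \<in> \<int>" by (rule Ints_add)
    then show "x - z \<in> \<int>" by simp
  qed
qed

instantiation circle :: topological_space
begin

definition open_circle :: "circle set \<Rightarrow> bool" where
  "open_circle U \<longleftrightarrow> open (circle_of -` U)"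

instance
  by standard (auto simp: open_circle_def vimage_Union)

end

text \<open>
  Near the point \<open>p\<close> the map is \<open>t \<mapsto> \<alpha> t + \<beta>\<close> in the coordinate of \<open>\<real>\<close>; which representative
  \<open>x\<close> of \<open>p\<close> is used does not matter, since \<open>\<beta>\<close> may be changed accordingly.
\<close>

definition locally_affine_at :: "(circle \<Rightarrow> circle) \<Rightarrow> circle \<Rightarrow> bool" where
  "locally_affine_at f p \<longleftrightarrow>
     (\<exists>\<alpha> \<beta> x. \<alpha> \<noteq> 0 \<and> circle_of x = p \<and>
        (\<forall>\<^sub>F t in nhds x. f (circle_of t) = circle_of (\<alpha> * t + \<beta>)))"

definition PL_homeo :: "(circle \<Rightarrow> circle) \<Rightarrow> bool" where
  "PL_homeo f \<longleftrightarrow>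
     (\<exists>g. homeomorphism UNIV UNIV f g) \<and> (\<exists>A. finite A \<and> (\<forall>p. p \<notin> A \<longrightarrow> locally_affine_at f p))"

definition PL_circle :: "(circle \<Rightarrow> circle) monoid" where
  "PL_circle = \<lparr>carrier = {f. PL_homeo f}, mult = (\<circ>), one = id\<rparr>"

lemma circle_of_eq_iff: "circle_of x = circle_of y \<longleftrightarrow> x - y \<in> \<int>"
  by (simp add: circle.abs_eq_iff)

lemma circle_of_surj: "\<exists>x. circle_of x = p"
  by (metis Quotient3_abs_rep Quotient3_circle)

lemma locally_affine_at_id: "locally_affine_at id p"
proof -
  obtain x where "circle_of x = p" using circle_of_surj by blast
  then show ?thesis unfolding locally_affine_at_def
    by (intro exI[of _ 1] exI[of _ 0] exI[of _ x]) simp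
qed

lemma locally_affine_at_comp:
  assumes "locally_affine_at f p" "locally_affine_at g (f p)"
  shows "locally_affine_at (g \<circ> f) p"
proof -
  obtain a b x where f: "a \<noteq> 0" "circle_of x = p"
    "\<forall>\<^sub>F t in nhds x. f (circle_of t) = circle_of (a * t + b)"
    using assms(1) unfolding locally_affine_at_def by blast
  obtain c d y where g: "c \<noteq> 0" "circle_of y = f p"
    "\<forall>\<^sub>F t in nhds y. g (circle_of t) = circle_of (c * t + d)"
    using assms(2) unfolding locally_affine_at_def by blast
  define n where "n = y - (a * x + b)"
  have "f p = circle_of (a * x + b)"
    using eventually_nhds_x_imp_x[OF f(3)] f(2) by simp
  then have n: "n \<in> \<int>"
    using g(2) by (simp add: n_def circle_of_eq_iff[symmetric])
  have "((\<lambda>t. a * t + b + n) \<longlongrightarrow> a * x + b + n) (nhds x)"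
    by (intro tendsto_intros filterlim_ident)
  then have "((\<lambda>t. a * t + b + n) \<longlongrightarrow> y) (nhds x)"
    by (simp add: n_def)
  then have "\<forall>\<^sub>F t in nhds x. g (circle_of (a * t + b + n)) = circle_of (c * (a * t + b + n) + d)"
    using g(3) by (rule eventually_compose_filterlim[rotated])
  with f(3) have "\<forall>\<^sub>F t in nhds x. (g \<circ> f) (circle_of t) = circle_of ((c * a) * t + (c * (b + n) + d))"
  proof eventually_elim
    case (elim t)
    have "circle_of (a * t + b) = circle_of (a * t + b + n)"
      using n by (simp add: circle_of_eq_iff)
    with elim show ?case by (simp add: algebra_simps)
  qed
  then show ?thesis unfolding locally_affine_at_def
    using f(1,2) g(1) by (intro exI[of _ "c * a"] exI[of _ "c * (b + n) + d"] exI[of _ x]) auto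
qed

lemma locally_affine_at_inverse:
  assumes "locally_affine_at f p" "\<And>q. g (f q) = q"
  shows "locally_affine_at g (f p)"
proof -
  obtain a b x where f: "a \<noteq> 0" "circle_of x = p"
    "\<forall>\<^sub>F t in nhds x. f (circle_of t) = circle_of (a * t + b)"
    using assms(1) unfolding locally_affine_at_def by blast
  have fp: "f p = circle_of (a * x + b)"
    using eventually_nhds_x_imp_x[OF f(3)] f(2) by simp
  have "((\<lambda>s. (s - b) / a) \<longlongrightarrow> (a * x + b - b) / a) (nhds (a * x + b))"
    using f(1) by (intro tendsto_intros filterlim_ident) auto
  then have "((\<lambda>s. (s - b) / a) \<longlongrightarrow> x) (nhds (a * x + b))"
    using f(1) by simp
  then have "\<forall>\<^sub>F s in nhds (a * x + b).
      f (circle_of ((s - b) / a)) = circle_of (a * ((s - b) / a) + b)"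
    using f(3) by (rule eventually_compose_filterlim[rotated])
  then have "\<forall>\<^sub>F s in nhds (a * x + b). g (circle_of s) = circle_of ((1 / a) * s + (- b / a))"
  proof eventually_elim
    case (elim s)
    have "a * ((s - b) / a) + b = s" "(s - b) / a = (1 / a) * s + (- b / a)"
      using f(1) by (auto simp: field_simps)
    with elim show ?case by (metis assms(2))
  qed
  then show ?thesis unfolding locally_affine_at_def
    using f(1) fp by (intro exI[of _ "1 / a"] exI[of _ "- b / a"] exI[of _ "a * x + b"]) auto
qed

lemma PL_homeo_id: "PL_homeo id"
  unfolding PL_homeo_def
proof
  show "\<exists>g. homeomorphism UNIV UNIV id g"
    by (rule exI[of _ id]) (simp add: homeomorphism_def)
  show "\<exists>A. finite A \<and> (\<forall>p. p \<notin> A \<longrightarrow> locally_affine_at id p)"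
    using locally_affine_at_id by blast
qed

lemma PL_homeo_comp:
  assumes "PL_homeo f" "PL_homeo g"
  shows "PL_homeo (g \<circ> f)"
proof -
  obtain f' A where f: "homeomorphism UNIV UNIV f f'" "finite A"
    "\<And>p. p \<notin> A \<Longrightarrow> locally_affine_at f p"
    using assms(1) unfolding PL_homeo_def by blast
  obtain g' B where g: "homeomorphism UNIV UNIV g g'" "finite B"
    "\<And>p. p \<notin> B \<Longrightarrow> locally_affine_at g p"
    using assms(2) unfolding PL_homeo_def by blast
  have "homeomorphism UNIV UNIV (g \<circ> f) (f' \<circ> g')"
    using f(1) g(1) by (rule homeomorphism_compose)
  moreover have "finite (A \<union> f' ` B)" using f g by simp
  moreover have "locally_affine_at (g \<circ> f) p" if "p \<notin> A \<union> f' ` B" for p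
  proof (rule locally_affine_at_comp)
    show "locally_affine_at f p" using f(3) that by simp
    have "f' (f p) = p" using f(1) by (simp add: homeomorphism_def)
    then have "f p \<notin> B" using that by force
    then show "locally_affine_at g (f p)" using g(3) by simp
  qed
  ultimately show ?thesis unfolding PL_homeo_def by blast
qed

lemma PL_homeo_inverse:
  assumes "PL_homeo f"
  shows "\<exists>g. PL_homeo g \<and> g \<circ> f = id"
proof -
  obtain g A where f: "homeomorphism UNIV UNIV f g" "finite A"
    "\<And>p. p \<notin> A \<Longrightarrow> locally_affine_at f p"
    using assms unfolding PL_homeo_def by blast
  have gf: "g (f p) = p" "f (g p) = p" for p
    using f(1) by (auto simp: homeomorphism_def)
  have "homeomorphism UNIV UNIV g f" using f(1) by (simp add: homeomorphism_symD)
  moreover have "finite (f ` A)" using f(2) by simp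
  moreover have "locally_affine_at g p" if "p \<notin> f ` A" for p
  proof -
    have gp: "g p \<notin> A" using that gf(2)[of p] by (metis imageI)
    have "locally_affine_at g (f (g p))"
      by (rule locally_affine_at_inverse[OF f(3)[OF gp] gf(1)])
    then show ?thesis by (simp only: gf(2))
  qed
  ultimately have "PL_homeo g" unfolding PL_homeo_def by blast
  moreover have "g \<circ> f = id" using gf(1) by (simp add: fun_eq_iff)
  ultimately show ?thesis by blast
qed

lemma group_PL_circle: "group PL_circle"
proof (rule groupI)
  fix f assume "f \<in> carrier PL_circle"
  then show "\<exists>g\<in>carrier PL_circle. g \<otimes>\<^bsub>PL_circle\<^esub> f = \<one>\<^bsub>PL_circle\<^esub>"
    using PL_homeo_inverse[of f] by (simp add: PL_circle_def)
qed (simp_all add: PL_circle_def PL_homeo_id PL_homeo_comp comp_assoc)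

section \<open>Free groups\<close>

text \<open>
  Elements are reduced words. The letter \<open>(s, True)\<close> stands for the generator \<open>s\<close> and
  \<open>(s, False)\<close> for its inverse. A product \<open>u v\<close> is computed by multiplying the letters of \<open>u\<close>
  onto \<open>v\<close> from the left, last letter first, reducing at each step.
\<close>

definition inv_letter :: "'s \<times> bool \<Rightarrow> 's \<times> bool" where
  "inv_letter x = (fst x, \<not> snd x)"

definition fg_reduced :: "('s \<times> bool) list \<Rightarrow> bool" where
  "fg_reduced w \<longleftrightarrow> successively (\<lambda>x y. y \<noteq> inv_letter x) w"

fun fg_cons :: "'s \<times> bool \<Rightarrow> ('s \<times> bool) list \<Rightarrow> ('s \<times> bool) list" where
  "fg_cons x [] = [x]"
| "fg_cons x (y # w) = (if y = inv_letter x then w else x # y # w)"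

definition free_group :: "'s set \<Rightarrow> ('s \<times> bool) list monoid" where
  "free_group S =
     \<lparr>carrier = {w. fg_reduced w \<and> fst ` set w \<subseteq> S},
      mult = (\<lambda>u v. foldr fg_cons u v),
      one = []\<rparr>"

lemma inv_letter_inv_letter [simp]: "inv_letter (inv_letter x) = x"
  by (simp add: inv_letter_def)

lemma fst_inv_letter [simp]: "fst (inv_letter x) = fst x"
  by (simp add: inv_letter_def)

lemma fg_reduced_Cons:
  "fg_reduced (x # w) \<longleftrightarrow> fg_reduced w \<and> (w = [] \<or> hd w \<noteq> inv_letter x)"
  by (cases w) (auto simp: fg_reduced_def)

lemma fg_cons_reduced: "fg_reduced w \<Longrightarrow> fg_reduced (fg_cons x w)"
  by (cases w) (auto simp: fg_reduced_def successively_Cons)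

lemma fg_cons_support: "fst x \<in> S \<Longrightarrow> fst ` set w \<subseteq> S \<Longrightarrow> fst ` set (fg_cons x w) \<subseteq> S"
  by (cases w) auto

lemma fg_cons_cancel:
  assumes "fg_reduced w"
  shows "fg_cons x (fg_cons (inv_letter x) w) = w"
proof (cases w)
  case (Cons y v)
  then show ?thesis using assms by (cases v) (auto simp: fg_reduced_Cons)
qed simp

lemma foldr_fg_cons_reduced: "fg_reduced v \<Longrightarrow> fg_reduced (foldr fg_cons u v)"
  by (induction u) (auto simp: fg_cons_reduced)

lemma foldr_fg_cons_support:
  "fst ` set u \<subseteq> S \<Longrightarrow> fst ` set v \<subseteq> S \<Longrightarrow> fst ` set (foldr fg_cons u v) \<subseteq> S"
proof (induction u)
  case (Cons x u)
  then show ?case using fg_cons_support[of x S "foldr fg_cons u v"] by simp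
qed simp

lemma foldr_fg_cons_fg_cons:
  assumes "fg_reduced w"
  shows "foldr fg_cons (fg_cons x v) w = fg_cons x (foldr fg_cons v w)"
proof (cases v)
  case (Cons y v')
  then show ?thesis using fg_cons_cancel[OF foldr_fg_cons_reduced[OF assms], of x v'] by auto
qed simp

lemma foldr_fg_cons_assoc:
  "fg_reduced w \<Longrightarrow>
     foldr fg_cons (foldr fg_cons u v) w = foldr fg_cons u (foldr fg_cons v w)"
  by (induction u) (auto simp: foldr_fg_cons_fg_cons)

lemma foldr_fg_cons_Nil: "fg_reduced w \<Longrightarrow> foldr fg_cons w [] = w"
proof (induction w)
  case (Cons x w)
  then show ?case by (cases w) (auto simp: fg_reduced_Cons)
qed simp

lemma foldr_fg_cons_inverse:
  "fg_reduced v \<Longrightarrow> foldr fg_cons (rev (map inv_letter u)) (foldr fg_cons u v) = v"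
proof (induction u arbitrary: v)
  case (Cons x u)
  have "fg_reduced (foldr fg_cons u v)" using Cons.prems by (rule foldr_fg_cons_reduced)
  then have "fg_cons (inv_letter x) (fg_cons x (foldr fg_cons u v)) = foldr fg_cons u v"
    using fg_cons_cancel[of _ "inv_letter x"] by simp
  then show ?case using Cons by simp
qed simp

lemma group_free_group: "group (free_group S)"
proof (rule groupI)
  fix u assume u: "u \<in> carrier (free_group S)"
  define v where "v = foldr fg_cons (rev (map inv_letter u)) []"
  have r: "fg_reduced []" by (simp add: fg_reduced_def)
  have "v \<in> carrier (free_group S)"
    using u foldr_fg_cons_reduced[OF r] foldr_fg_cons_support[of "rev (map inv_letter u)" S "[]"]
    by (auto simp: v_def free_group_def image_image)
  moreover have "foldr fg_cons v u = []"
    using u foldr_fg_cons_assoc[of u "rev (map inv_letter u)" "[]"]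
      foldr_fg_cons_inverse[OF r, of u]
    by (simp add: v_def free_group_def foldr_fg_cons_Nil)
  ultimately show "\<exists>v\<in>carrier (free_group S). v \<otimes>\<^bsub>free_group S\<^esub> u = \<one>\<^bsub>free_group S\<^esub>"
    by (auto simp: free_group_def)
next
  fix u v assume "u \<in> carrier (free_group S)" "v \<in> carrier (free_group S)"
  then show "u \<otimes>\<^bsub>free_group S\<^esub> v \<in> carrier (free_group S)"
    using foldr_fg_cons_reduced[of v u] foldr_fg_cons_support[of u S v]
    by (simp add: free_group_def)
qed (auto simp: free_group_def foldr_fg_cons_assoc fg_reduced_def)

section \<open>Free products\<close>

text \<open>
  Elements are words in the nontrivial elements of the two factors, with neighbouring letters
  taken from different factors; products are computed letter by letter as for free groups.
\<close>

definition fp_letter :: "('a, 'c) monoid_scheme \<Rightarrow> ('b, 'd) monoid_scheme \<Rightarrow> 'a + 'b \<Rightarrow> bool" where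
  "fp_letter G H x = (case x of
      Inl g \<Rightarrow> g \<in> carrier G - {\<one>\<^bsub>G\<^esub>}
    | Inr h \<Rightarrow> h \<in> carrier H - {\<one>\<^bsub>H\<^esub>})"

definition fp_reduced :: "('a, 'c) monoid_scheme \<Rightarrow> ('b, 'd) monoid_scheme \<Rightarrow> ('a + 'b) list \<Rightarrow> bool" where
  "fp_reduced G H w \<longleftrightarrow> list_all (fp_letter G H) w \<and> successively (\<lambda>x y. isl x \<noteq> isl y) w"

fun fp_cons :: "('a, 'c) monoid_scheme \<Rightarrow> ('b, 'd) monoid_scheme \<Rightarrow>
    'a + 'b \<Rightarrow> ('a + 'b) list \<Rightarrow> ('a + 'b) list" where
  "fp_cons G H (Inl g) (Inl g' # w) =
     (if g \<otimes>\<^bsub>G\<^esub> g' = \<one>\<^bsub>G\<^esub> then w else Inl (g \<otimes>\<^bsub>G\<^esub> g') # w)"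
| "fp_cons G H (Inr h) (Inr h' # w) =
     (if h \<otimes>\<^bsub>H\<^esub> h' = \<one>\<^bsub>H\<^esub> then w else Inr (h \<otimes>\<^bsub>H\<^esub> h') # w)"
| "fp_cons G H x w = x # w"

definition free_product ::
    "('a, 'c) monoid_scheme \<Rightarrow> ('b, 'd) monoid_scheme \<Rightarrow> ('a + 'b) list monoid" where
  "free_product G H =
     \<lparr>carrier = {w. fp_reduced G H w},
      mult = (\<lambda>u v. foldr (fp_cons G H) u v),
      one = []\<rparr>"

lemma fp_reduced_Nil [simp]: "fp_reduced G H []"
  by (simp add: fp_reduced_def)

lemma fp_reduced_Cons:
  "fp_reduced G H (x # w) \<longleftrightarrow>
     fp_letter G H x \<and> fp_reduced G H w \<and> (w = [] \<or> isl x \<noteq> isl (hd w))"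
  by (auto simp: fp_reduced_def successively_Cons)

lemma fp_letter_simps [simp]:
  "fp_letter G H (Inl g) \<longleftrightarrow> g \<in> carrier G \<and> g \<noteq> \<one>\<^bsub>G\<^esub>"
  "fp_letter G H (Inr h) \<longleftrightarrow> h \<in> carrier H \<and> h \<noteq> \<one>\<^bsub>H\<^esub>"
  by (auto simp: fp_letter_def)

fun fp_inv_letter :: "('a, 'c) monoid_scheme \<Rightarrow> ('b, 'd) monoid_scheme \<Rightarrow> 'a + 'b \<Rightarrow> 'a + 'b" where
  "fp_inv_letter G H (Inl g) = Inl (inv\<^bsub>G\<^esub> g)"
| "fp_inv_letter G H (Inr h) = Inr (inv\<^bsub>H\<^esub> h)"

context
  fixes G :: "('a, 'c) monoid_scheme" and H :: "('b, 'd) monoid_scheme"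
  assumes G: "group G" and H: "group H"
begin

interpretation G: group G by (rule G)
interpretation H: group H by (rule H)

lemma fp_cons_reduced:
  assumes "fp_letter G H x" "fp_reduced G H w"
  shows "fp_reduced G H (fp_cons G H x w)"
proof (cases w)
  case Nil
  then show ?thesis using assms by (simp add: fp_reduced_Cons)
next
  case (Cons y v)
  then show ?thesis using assms by (cases x; cases y) (auto simp: fp_reduced_Cons)
qed

lemma foldr_fp_cons_reduced:
  "list_all (fp_letter G H) u \<Longrightarrow> fp_reduced G H v \<Longrightarrow> fp_reduced G H (foldr (fp_cons G H) u v)"
  by (induction u) (auto simp: fp_cons_reduced)

lemma fp_cons_Inl_Inl:
  assumes g: "g \<in> carrier G" "g \<noteq> \<one>\<^bsub>G\<^esub>" "g' \<in> carrier G" "g' \<noteq> \<one>\<^bsub>G\<^esub>" and w: "fp_reduced G H w"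
  shows "fp_cons G H (Inl g) (fp_cons G H (Inl g') w) =
           (if g \<otimes>\<^bsub>G\<^esub> g' = \<one>\<^bsub>G\<^esub> then w else fp_cons G H (Inl (g \<otimes>\<^bsub>G\<^esub> g')) w)"
proof (cases "\<exists>k v. w = Inl k # v")
  case True
  then obtain k v where kv: "w = Inl k # v" by blast
  have k: "k \<in> carrier G" "k \<noteq> \<one>\<^bsub>G\<^esub>" and v: "v = [] \<or> (\<exists>h v'. v = Inr h # v')"
    using w kv by (cases v; cases "hd v"; auto simp: fp_reduced_Cons)+
  have cons_v: "fp_cons G H (Inl g) v = Inl g # v" using v by auto
  have assoc: "g \<otimes>\<^bsub>G\<^esub> (g' \<otimes>\<^bsub>G\<^esub> k) = (g \<otimes>\<^bsub>G\<^esub> g') \<otimes>\<^bsub>G\<^esub> k"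
    using g k by (simp add: G.m_assoc)
  show ?thesis
  proof (cases "g' \<otimes>\<^bsub>G\<^esub> k = \<one>\<^bsub>G\<^esub>")
    case True
    then have "(g \<otimes>\<^bsub>G\<^esub> g') \<otimes>\<^bsub>G\<^esub> k = g" using assoc g by simp
    moreover have "k = g" if "g \<otimes>\<^bsub>G\<^esub> g' = \<one>\<^bsub>G\<^esub>" using calculation that k by simp
    ultimately show ?thesis using True kv cons_v g by (auto split del: if_split split: if_split)
  next
    case False
    then show ?thesis using kv assoc k by auto
  qed
next
  case False
  then have "w = [] \<or> (\<exists>h v. w = Inr h # v)"
    by (cases w; cases "hd w") auto
  then show ?thesis by auto
qed

lemma fp_cons_Inr_Inr:
  assumes g: "g \<in> carrier H" "g \<noteq> \<one>\<^bsub>H\<^esub>" "g' \<in> carrier H" "g' \<noteq> \<one>\<^bsub>H\<^esub>" and w: "fp_reduced G H w"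
  shows "fp_cons G H (Inr g) (fp_cons G H (Inr g') w) =
           (if g \<otimes>\<^bsub>H\<^esub> g' = \<one>\<^bsub>H\<^esub> then w else fp_cons G H (Inr (g \<otimes>\<^bsub>H\<^esub> g')) w)"
proof (cases "\<exists>k v. w = Inr k # v")
  case True
  then obtain k v where kv: "w = Inr k # v" by blast
  have k: "k \<in> carrier H" "k \<noteq> \<one>\<^bsub>H\<^esub>" and v: "v = [] \<or> (\<exists>h v'. v = Inl h # v')"
    using w kv by (cases v; cases "hd v"; auto simp: fp_reduced_Cons)+
  have cons_v: "fp_cons G H (Inr g) v = Inr g # v" using v by auto
  have assoc: "g \<otimes>\<^bsub>H\<^esub> (g' \<otimes>\<^bsub>H\<^esub> k) = (g \<otimes>\<^bsub>H\<^esub> g') \<otimes>\<^bsub>H\<^esub> k"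
    using g k by (simp add: H.m_assoc)
  show ?thesis
  proof (cases "g' \<otimes>\<^bsub>H\<^esub> k = \<one>\<^bsub>H\<^esub>")
    case True
    then have "(g \<otimes>\<^bsub>H\<^esub> g') \<otimes>\<^bsub>H\<^esub> k = g" using assoc g by simp
    moreover have "k = g" if "g \<otimes>\<^bsub>H\<^esub> g' = \<one>\<^bsub>H\<^esub>" using calculation that k by simp
    ultimately show ?thesis using True kv cons_v g by (auto split del: if_split split: if_split)
  next
    case False
    then show ?thesis using kv assoc k by auto
  qed
next
  case False
  then have "w = [] \<or> (\<exists>h v. w = Inl h # v)"
    by (cases w; cases "hd w") auto
  then show ?thesis by auto
qed

lemma foldr_fp_cons_fp_cons:
  assumes "fp_letter G H x" "fp_reduced G H v" "fp_reduced G H w"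
  shows "foldr (fp_cons G H) (fp_cons G H x v) w = fp_cons G H x (foldr (fp_cons G H) v w)"
proof (cases v)
  case (Cons y v')
  have "fp_reduced G H (foldr (fp_cons G H) v' w)"
    using assms Cons by (intro foldr_fp_cons_reduced) (auto simp: fp_reduced_def)
  then show ?thesis using assms Cons
    by (cases x; cases y) (auto simp: fp_reduced_Cons fp_cons_Inl_Inl fp_cons_Inr_Inr)
qed simp

lemma foldr_fp_cons_assoc:
  assumes "list_all (fp_letter G H) u" "fp_reduced G H v" "fp_reduced G H w"
  shows "foldr (fp_cons G H) (foldr (fp_cons G H) u v) w =
           foldr (fp_cons G H) u (foldr (fp_cons G H) v w)"
  using assms by (induction u) (auto simp: foldr_fp_cons_fp_cons foldr_fp_cons_reduced)

lemma fp_letter_inv: "fp_letter G H x \<Longrightarrow> fp_letter G H (fp_inv_letter G H x)"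
  by (cases x) auto

lemma foldr_fp_cons_inverse:
  "list_all (fp_letter G H) u \<Longrightarrow> fp_reduced G H v \<Longrightarrow>
     foldr (fp_cons G H) (rev (map (fp_inv_letter G H) u)) (foldr (fp_cons G H) u v) = v"
proof (induction u arbitrary: v)
  case (Cons x u)
  have "fp_reduced G H (foldr (fp_cons G H) u v)" using Cons.prems by (simp add: foldr_fp_cons_reduced)
  then have "fp_cons G H (fp_inv_letter G H x) (fp_cons G H x (foldr (fp_cons G H) u v)) =
      foldr (fp_cons G H) u v"
    using Cons.prems by (cases x) (auto simp: fp_cons_Inl_Inl fp_cons_Inr_Inr)
  then show ?case using Cons by simp
qed simp

lemma foldr_fp_cons_Nil: "fp_reduced G H w \<Longrightarrow> foldr (fp_cons G H) w [] = w"
proof (induction w)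
  case (Cons x w)
  show ?case
  proof (cases w)
    case (Cons y v)
    then show ?thesis using Cons.IH Cons.prems
      by (cases x; cases y) (auto simp: fp_reduced_Cons)
  qed simp
qed simp

lemma group_free_product: "group (free_product G H)"
proof (rule groupI)
  fix u assume "u \<in> carrier (free_product G H)"
  then have u: "fp_reduced G H u" "list_all (fp_letter G H) u"
    by (auto simp: free_product_def fp_reduced_def)
  define u' where "u' = rev (map (fp_inv_letter G H) u)"
  define v where "v = foldr (fp_cons G H) u' []"
  have u': "list_all (fp_letter G H) u'"
    using u(2) fp_letter_inv by (auto simp: u'_def list_all_iff)
  have "fp_reduced G H v"
    using u' by (simp add: v_def foldr_fp_cons_reduced)
  moreover have "foldr (fp_cons G H) v u = []"
    using foldr_fp_cons_assoc[OF u' _ u(1), of "[]"] foldr_fp_cons_inverse[OF u(2), of "[]"] u(1)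
    by (simp add: v_def u'_def foldr_fp_cons_Nil)
  ultimately show "\<exists>v\<in>carrier (free_product G H).
      v \<otimes>\<^bsub>free_product G H\<^esub> u = \<one>\<^bsub>free_product G H\<^esub>"
    by (auto simp: free_product_def)
next
  fix u v w
  assume "u \<in> carrier (free_product G H)" "v \<in> carrier (free_product G H)"
    "w \<in> carrier (free_product G H)"
  then show "u \<otimes>\<^bsub>free_product G H\<^esub> v \<otimes>\<^bsub>free_product G H\<^esub> w =
      u \<otimes>\<^bsub>free_product G H\<^esub> (v \<otimes>\<^bsub>free_product G H\<^esub> w)"
    using foldr_fp_cons_assoc[of u v w] by (simp add: free_product_def fp_reduced_def)
next
  fix u v
  assume "u \<in> carrier (free_product G H)" "v \<in> carrier (free_product G H)"
  then show "u \<otimes>\<^bsub>free_product G H\<^esub> v \<in> carrier (free_product G H)"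
    using foldr_fp_cons_reduced[of u v] by (simp add: free_product_def fp_reduced_def)
qed (auto simp: free_product_def)

end

end

theory Submission
  imports Defs "HOL-Computational_Algebra.Polynomial_Factorial"
begin

text \<open>
  Call a group \<^emph>\<open>conjugation rigid\<close> if an element \<open>g\<close> that commutes with a conjugate \<open>h g h\<inverse>\<close>
  already commutes with \<open>h\<close>. Free groups and \<open>\<int>\<^sup>2 * \<int>\<close> have this property, because they act
  faithfully by \<open>2 \<times> 2\<close> matrices over \<open>\<int>[X]\<close> that have determinant one and are trivial modulo \<open>X\<close>
  (\<open>free_group_conj_rigid\<close>, \<open>free_product_conj_rigid\<close>). Everything about these two groups enters
  through rigidity and through a few explicit words. Squares of piecewise linear homeomorphisms
  preserve orientation, so the dynamics concerns increasing lifts to the line.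

  The engine is a version of the theorem of Brin and Squier (\<open>common_fixed_point_commute\<close>): two
  elements \<open>u\<close>, \<open>v\<close> of a rigid group of such maps that share a fixed point commute. On the line,
  the commutator of \<open>u\<close> and \<open>v\<close> is the identity near every common fixed point. Among the nontrivial
  elements with this property choose one, \<open>g\<close>, that is nontrivial in as few gaps between common fixed
  points as possible. Some \<open>h\<close> moves the support of \<open>g\<close> in one gap off itself, so the commutator of
  \<open>g\<close> and \<open>h g h\<inverse>\<close> lives in fewer gaps, hence is trivial. Rigidity then makes \<open>g\<close> and \<open>h\<close> commute,
  and \<open>h\<close> must preserve the support that it displaces.

  The second tool (\<open>commuting_periodic_point\<close>) is that a nontrivial map with a fixed point has a
  finite nonempty set of boundary points of its fixed point set, and every map that commutes with it
  permutes this set.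

  Suppose \<open>F\<^sub>2 \<times> \<int>\<close> embeds. If a power of the central generator has a fixed point, then powers of the
  two free generators share a fixed point, so they commute, which is absurd. Otherwise the second
  tool shows that the orientation-preserving part of \<open>F\<^sub>2\<close> acts freely on the circle, and by Hoelder's
  argument a group acting freely on the line is abelian.

  Suppose \<open>\<int>\<^sup>2 * \<int>\<close> embeds, and let \<open>t\<close> generate the factor \<open>\<int>\<close>. If some nontrivial element of \<open>\<int>\<^sup>2\<close> has
  a fixed point, then a subgroup of finite index fixes a point \<open>p\<close>. Such a group cannot act freely
  on an interval, so \<open>t p\<close> has a nontrivial stabiliser; for \<open>k\<close> in it, \<open>k\<close> and \<open>t\<inverse> k t\<close> both fix
  \<open>p\<close>, so they commute, and by rigidity \<open>k\<close> commutes with \<open>t\<close>. If \<open>\<int>\<^sup>2\<close> acts freely, then, since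
  \<open>\<int>\<^sup>2\<close> has one end, there is one finite set \<open>D\<close> such that every element of \<open>\<int>\<^sup>2\<close> is affine near a
  point unless it takes the point from or into \<open>D\<close> (\<open>finitely_many_breaks\<close>). This makes the action
  recurrent: some \<open>\<sigma>\<close> in \<open>\<int>\<^sup>2\<close> is affine and close to the identity near two given points \<open>y\<close> and
  \<open>t\<inverse> y\<close>. Hence \<open>\<sigma>\<close> and \<open>\<tau> = t \<sigma> t\<inverse>\<close> are both affine near \<open>y\<close>, their commutator \<open>u\<close> is a translation
  there, and the commutator of \<open>u\<close> with \<open>\<sigma> u \<sigma>\<inverse>\<close> is the identity near \<open>y\<close>. The two tools show that this
  last commutator is trivial, and rigidity unwinds it: \<open>\<sigma>\<close> commutes with \<open>\<tau>\<close>, and then with \<open>t\<close>.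
  In the free product no nontrivial element of \<open>\<int>\<^sup>2\<close> commutes with \<open>t\<close>.
\<close>

section \<open>Increasing piecewise linear maps of the line\<close>

definition side :: "bool \<Rightarrow> real \<Rightarrow> real filter" where
  "side b z = (if b then at_right z else at_left z)"

text \<open>
  The increasing lifts of piecewise linear circle maps. Piecewise linearity is expressed by one-sided
  affine germs at every point; by compactness of a period this bounds the number of breaks, and
  one-sided germs are what can be composed at a fixed point.
\<close>

definition plmap :: "(real \<Rightarrow> real) \<Rightarrow> bool" where
  "plmap F \<longleftrightarrow> strict_mono F \<and> continuous_on UNIV F \<and> (\<forall>x. F (x + 1) = F x + 1) \<and>
     (\<forall>b z. \<exists>a. \<forall>\<^sub>F t in side b z. F t = F z + a * (t - z))"

lemma plmap_less_iff: "plmap F \<Longrightarrow> F x < F y \<longleftrightarrow> x < y"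
  by (simp add: plmap_def strict_mono_less)

lemma plmap_le_iff: "plmap F \<Longrightarrow> F x \<le> F y \<longleftrightarrow> x \<le> y"
  by (simp add: plmap_def strict_mono_less_eq)

lemma plmap_eq_iff: "plmap F \<Longrightarrow> F x = F y \<longleftrightarrow> x = y"
  by (simp add: plmap_def strict_mono_eq)

lemma plmap_isCont: "plmap F \<Longrightarrow> isCont F x"
  by (simp add: plmap_def continuous_on_eq_continuous_at)

lemma plmap_tendsto: "plmap F \<Longrightarrow> (f \<longlongrightarrow> l) G \<Longrightarrow> ((\<lambda>i. F (f i)) \<longlongrightarrow> F l) G"
  using plmap_isCont isCont_tendsto_compose by blast

lemma plmap_add_nat: "plmap F \<Longrightarrow> F (x + real n) = F x + real n"
proof (induction n)
  case (Suc n)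
  have "F (x + real n + 1) = F (x + real n) + 1" using Suc.prems by (simp only: plmap_def)
  then show ?case using Suc by (simp add: algebra_simps)
qed simp

lemma plmap_add_int: "plmap F \<Longrightarrow> F (x + of_int k) = F x + of_int k"
proof (cases "k \<ge> 0")
  case True
  assume "plmap F"
  then show ?thesis using plmap_add_nat[of F x "nat k"] True by simp
next
  case False
  assume "plmap F"
  then show ?thesis using plmap_add_nat[of F "x + of_int k" "nat (- k)"] False by simp
qed

lemma plmap_surj:
  assumes "plmap F"
  shows "\<exists>x. F x = y"
proof -
  define n where "n = \<lceil>y - F 0\<rceil>"
  have "F (of_int n) = F 0 + of_int n" "F (of_int (n - 1)) = F 0 + of_int (n - 1)"
    using plmap_add_int[OF assms, of 0 n] plmap_add_int[OF assms, of 0 "n - 1"] by simp_all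
  moreover have "of_int n \<ge> y - F 0" "of_int (n - 1) \<le> y - F 0"
    unfolding n_def by linarith+
  ultimately have "F (of_int (n - 1)) \<le> y" "y \<le> F (of_int n)" by linarith+
  then show ?thesis
    using IVT'[of F "of_int (n - 1)" y "of_int n"] continuous_on_subset[of UNIV F] assms
    by (auto simp: plmap_def)
qed

lemma plmap_bij: "plmap F \<Longrightarrow> bij F"
  using plmap_surj[of F] plmap_eq_iff[of F] by (metis bijI injI surjI surj_def)

lemma plmap_inv_right [simp]: "plmap F \<Longrightarrow> F (inv_into UNIV F x) = x"
  by (simp add: bij_is_surj plmap_bij surj_f_inv_f)

lemma plmap_inv_left [simp]: "plmap F \<Longrightarrow> inv_into UNIV F (F x) = x"
  by (simp add: bij_is_inj plmap_bij)

lemma plmap_shift: "plmap (\<lambda>x. x + c)"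
  unfolding plmap_def
proof (intro conjI allI)
  show "strict_mono (\<lambda>x. x + c)" by (simp add: strict_mono_def)
  show "continuous_on UNIV (\<lambda>x. x + c)" by (intro continuous_intros)
  show "x + 1 + c = x + c + 1" for x by simp
  show "\<exists>a. \<forall>\<^sub>F t in side b z. t + c = z + c + a * (t - z)" for b z
    by (rule exI[of _ 1]) simp
qed

lemma plmap_id: "plmap (\<lambda>x. x)"
  using plmap_shift[of 0] by simp

lemma eventually_side: "\<forall>\<^sub>F t in side b z. if b then z < t else t < z"
  by (simp add: side_def eventually_at_filter)

lemma side_neq_bot: "side b z \<noteq> bot"
  by (simp add: side_def)

lemma eventually_at_sides: "eventually P (at z) \<longleftrightarrow> (\<forall>b. eventually P (side b z))"
  unfolding eventually_at_split side_def by (metis (full_types))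

lemma filterlim_side:
  assumes cont: "isCont F z" and mono: "\<And>x y. F x < F y \<longleftrightarrow> x < y"
  shows "filterlim F (side b (F z)) (side b z)"
proof -
  have "(F \<longlongrightarrow> F z) (side b z)"
    using cont unfolding isCont_def side_def by (simp add: filterlim_at_split)
  moreover have "\<forall>\<^sub>F t in side b z. F t \<in> (if b then {F z<..} else {..<F z}) \<and> F t \<noteq> F z"
    using eventually_side[of b z]
  proof eventually_elim
    case (elim t)
    then have "if b then F z < F t else F t < F z" by (simp add: mono)
    then show ?case by (simp split: if_splits)
  qed
  ultimately show ?thesis
    by (cases b) (simp_all add: side_def filterlim_at)
qed

lemma plmap_side: "plmap F \<Longrightarrow> filterlim F (side b (F z)) (side b z)"
  by (rule filterlim_side[OF plmap_isCont plmap_less_iff])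

lemma plmap_germ:
  assumes "plmap F"
  obtains a where "a > 0" "\<forall>\<^sub>F t in side b z. F t = F z + a * (t - z)"
proof -
  obtain a where a: "\<forall>\<^sub>F t in side b z. F t = F z + a * (t - z)"
    using assms unfolding plmap_def by blast
  have "\<forall>\<^sub>F t in side b z. a > 0"
    using a eventually_side[of b z]
  proof eventually_elim
    case (elim t)
    have "if b then F z < F t else F t < F z"
      using elim(2) by (simp add: plmap_less_iff[OF assms])
    moreover have "a * (t - z) = F t - F z" using elim(1) by simp
    ultimately have "if b then a * (t - z) > 0 else a * (t - z) < 0" by simp
    then show ?case using elim(2) by (auto simp: zero_less_mult_iff mult_less_0_iff split: if_splits)
  qed
  then have "a > 0" using side_neq_bot by (simp add: eventually_const_iff)
  with a that show ?thesis by blast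
qed

lemma plmap_comp:
  assumes F: "plmap F" and G: "plmap G"
  shows "plmap (F \<circ> G)"
proof -
  have "\<exists>a. \<forall>\<^sub>F t in side b z. (F \<circ> G) t = (F \<circ> G) z + a * (t - z)" for b z
  proof -
    obtain a where a: "\<forall>\<^sub>F t in side b (G z). F t = F (G z) + a * (t - G z)"
      using F unfolding plmap_def by blast
    obtain c where c: "\<forall>\<^sub>F t in side b z. G t = G z + c * (t - z)"
      using G unfolding plmap_def by blast
    have "\<forall>\<^sub>F t in side b z. F (G t) = F (G z) + a * (G t - G z)"
      using eventually_compose_filterlim[OF a plmap_side[OF G]] .
    with c have "\<forall>\<^sub>F t in side b z. (F \<circ> G) t = (F \<circ> G) z + (a * c) * (t - z)"
      by eventually_elim simp
    then show ?thesis by blast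
  qed
  moreover have "strict_mono (F \<circ> G)" using F G by (simp add: plmap_def strict_mono_def)
  moreover have "continuous_on UNIV (F \<circ> G)"
    using F G unfolding plmap_def by (metis continuous_on_compose continuous_on_subset subset_UNIV)
  ultimately show ?thesis using F G by (simp add: plmap_def)
qed

lemma plmap_inv:
  assumes F: "plmap F"
  shows "plmap (inv_into UNIV F)" (is "plmap ?G")
proof -
  have less: "?G x < ?G y \<longleftrightarrow> x < y" for x y
    using plmap_less_iff[OF F, of "?G x" "?G y"] F by simp
  have mono: "strict_mono ?G" by (simp add: strict_mono_def less)
  have per: "?G (x + 1) = ?G x + 1" for x
  proof -
    have "F (?G x + 1) = x + 1" using F by (simp add: plmap_def)
    then show ?thesis using F plmap_inv_left by metis
  qed
  have cont: "isCont ?G x" for x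
  proof -
    have "isCont ?G (F (?G x))"
      by (rule isCont_inverse_function[where f = F and d = 1]) (simp_all add: F plmap_isCont)
    then show ?thesis using F by simp
  qed
  have "\<exists>a. \<forall>\<^sub>F t in side b z. ?G t = ?G z + a * (t - z)" for b z
  proof -
    obtain a where a: "a > 0" "\<forall>\<^sub>F t in side b (?G z). F t = F (?G z) + a * (t - ?G z)"
      using plmap_germ[OF F] by blast
    have "\<forall>\<^sub>F t in side b z. F (?G t) = F (?G z) + a * (?G t - ?G z)"
      using eventually_compose_filterlim[OF a(2) filterlim_side[OF cont less]] .
    then have "\<forall>\<^sub>F t in side b z. ?G t = ?G z + (1 / a) * (t - z)"
      by eventually_elim (use F a(1) in \<open>simp add: field_simps\<close>)
    then show ?thesis by blast
  qed
  then show ?thesis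
    using mono per cont by (simp add: plmap_def continuous_at_imp_continuous_on)
qed

lemma closed_fixed_points: "plmap F \<Longrightarrow> closed {x. F x = x}"
  unfolding plmap_def by (intro closed_Collect_eq) (auto intro: continuous_on_id)

text \<open>
  On either side of \<open>z\<close> the map is affine on a short interval, and an affine map fixes no point, one
  point, or all points of an interval; in each case at most one boundary point of the fixed point set
  lies inside.
\<close>

lemma locally_finite_fixed_point_frontier:
  assumes F: "plmap F"
  shows "\<exists>e>0. finite (frontier {x. F x = x} \<inter> {z - e<..<z + e})"
proof -
  obtain a where a: "\<forall>\<^sub>F t in at_right z. F t = F z + a * (t - z)"
    using plmap_germ[OF F, where b = True and z = z] by (auto simp: side_def)
  obtain b where b: "\<forall>\<^sub>F t in at_left z. F t = F z + b * (t - z)"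
    using plmap_germ[OF F, where b = False and z = z] by (auto simp: side_def)
  obtain p where p: "p > z" "\<And>t. z < t \<Longrightarrow> t < p \<Longrightarrow> F t = F z + a * (t - z)"
    using a by (auto simp: eventually_at_right_field)
  obtain q where q: "q < z" "\<And>t. q < t \<Longrightarrow> t < z \<Longrightarrow> F t = F z + b * (t - z)"
    using b by (auto simp: eventually_at_left_field)
  have frontier_affine: "finite (frontier {x. F x = x} \<inter> {l<..<r})"
    if aff: "\<And>t. l < t \<Longrightarrow> t < r \<Longrightarrow> F t = F z + c * (t - z)" for l r c
  proof -
    have "x = y" if x: "x \<in> frontier {x. F x = x} \<inter> {l<..<r}"
      and y: "y \<in> frontier {x. F x = x} \<inter> {l<..<r}" for x y
    proof (rule ccontr)
      assume ne: "x \<noteq> y"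
      have fr: "frontier {x. F x = x} \<subseteq> {x. F x = x}"
        using closed_fixed_points[OF F] frontier_subset_closed by blast
      then have fx: "F x = x" "F y = y" using x y by auto
      then have "x = F z + c * (x - z)" "y = F z + c * (y - z)" using aff x y by auto
      then have "(c - 1) * (x - y) = 0" by (simp add: algebra_simps)
      then have c: "c = 1" using ne by simp
      have "F t = t" if "t \<in> {l<..<r}" for t
        using aff[of t] aff[of x] that x fx(1) c by auto
      then have "{l<..<r} \<subseteq> interior {x. F x = x}"
        by (intro interior_maximal) auto
      then show False using x by (auto simp: frontier_def)
    qed
    then have "frontier {x. F x = x} \<inter> {l<..<r} \<subseteq> {SOME y. y \<in> frontier {x. F x = x} \<inter> {l<..<r}}"
      by (metis (no_types, lifting) insertI1 someI subsetI)
    then show ?thesis by (rule finite_subset) simp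
  qed
  define e where "e = min (p - z) (z - q)"
  have "frontier {x. F x = x} \<inter> {z - e<..<z + e} \<subseteq>
      {z} \<union> (frontier {x. F x = x} \<inter> {z<..<p}) \<union> (frontier {x. F x = x} \<inter> {q<..<z})"
    by (auto simp: e_def)
  moreover have "finite ({z} \<union> (frontier {x. F x = x} \<inter> {z<..<p}) \<union> (frontier {x. F x = x} \<inter> {q<..<z}))"
    using frontier_affine[of z p a] frontier_affine[of q z b] p q by simp
  ultimately have "finite (frontier {x. F x = x} \<inter> {z - e<..<z + e})"
    by (rule finite_subset)
  moreover have "e > 0" using p q by (simp add: e_def)
  ultimately show ?thesis by blast
qed

lemma finite_frontier_fixed_points:
  assumes F: "plmap F"
  shows "finite (frontier {x. F x = x} \<inter> {a..b})"
proof -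
  have "\<exists>e. \<forall>z. e z > 0 \<and> finite (frontier {x. F x = x} \<inter> {z - e z<..<z + e z})"
    using locally_finite_fixed_point_frontier[OF F] by meson
  then obtain e where e: "\<And>z. e z > 0" "\<And>z. finite (frontier {x. F x = x} \<inter> {z - e z<..<z + e z})"
    by blast
  have "{a..b} \<subseteq> (\<Union>z\<in>{a..b}. {z - e z<..<z + e z})" using e(1) by fastforce
  then obtain Z where Z: "Z \<subseteq> {a..b}" "finite Z" "{a..b} \<subseteq> (\<Union>z\<in>Z. {z - e z<..<z + e z})"
    by (rule compactE_image[OF compact_Icc, rotated]) auto
  then have "frontier {x. F x = x} \<inter> {a..b} \<subseteq> (\<Union>z\<in>Z. frontier {x. F x = x} \<inter> {z - e z<..<z + e z})"
    by auto
  moreover have "finite (\<Union>z\<in>Z. frontier {x. F x = x} \<inter> {z - e z<..<z + e z})" using Z(2) e(2) by (intro finite_UN_I) auto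
  ultimately show ?thesis by (rule finite_subset)
qed

text \<open>
  Slope and intercept are locally constant, hence constant on a connected set.
\<close>

lemma affine_on_interval:
  fixes F :: "real \<Rightarrow> real"
  assumes "\<And>x. x \<in> {p<..<q} \<Longrightarrow> \<exists>a b. \<forall>\<^sub>F t in nhds x. F t = a * t + b"
  obtains a b where "\<And>x. x \<in> {p<..<q} \<Longrightarrow> F x = a * x + b"
proof (cases "p < q")
  case False
  then show ?thesis using that by fastforce
next
  case True
  define H where "H = (\<lambda>x. (deriv F x, F x - deriv F x * x))"
  have key: "\<forall>\<^sub>F t in nhds x. H t = H x" if x: "x \<in> {p<..<q}" for x
  proof -
    obtain a b where ab: "\<forall>\<^sub>F t in nhds x. F t = a * t + b" using assms x by blast
    have H: "H t = (a, b)" if "\<forall>\<^sub>F s in nhds t. F s = a * s + b" for t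
    proof -
      have "((\<lambda>s. a * s + b) has_field_derivative a) (at t)" by (auto intro!: derivative_eq_intros)
      then have "(F has_field_derivative a) (at t)"
        using DERIV_cong_ev[OF refl that refl] by simp
      then have "deriv F t = a" by (rule DERIV_imp_deriv)
      then show ?thesis using eventually_nhds_x_imp_x[OF that] by (simp add: H_def)
    qed
    have "\<forall>\<^sub>F t in nhds x. \<forall>\<^sub>F s in nhds t. F s = a * s + b"
      using ab by (simp add: eventually_eventually)
    then have "\<forall>\<^sub>F t in nhds x. H t = (a, b)" by eventually_elim (rule H)
    moreover have "H x = (a, b)" using H ab by blast
    ultimately show ?thesis by simp
  qed
  have "\<exists>c. \<forall>x\<in>{p<..<q}. H x = c"
  proof -
    have "H constant_on {p<..<q}"
    proof (rule locally_constant_imp_constant)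
      show "connected {p<..<q}" by simp
      fix x assume x: "x \<in> {p<..<q}"
      obtain T where T: "open T" "x \<in> T" "\<forall>t\<in>T. H t = H x"
        using key[OF x] unfolding eventually_nhds by blast
      then show "\<exists>T. openin (top_of_set {p<..<q}) T \<and> x \<in> T \<and> (\<forall>y\<in>T. H y = H x)"
        using x openin_open_Int[OF T(1), of "{p<..<q}"] by (metis IntD2 IntI)
    qed
    then show ?thesis by (auto simp: constant_on_def)
  qed
  then obtain c where c: "\<And>x. x \<in> {p<..<q} \<Longrightarrow> H x = c" by blast
  have "F x = fst c * x + snd c" if "x \<in> {p<..<q}" for x
    using c[OF that] by (auto simp: H_def)
  then show ?thesis using that by blast
qed

lemma zero_between:
  fixes D :: "real \<Rightarrow> real"
  assumes cont: "continuous_on UNIV D" and "D x \<le> 0" "0 \<le> D y"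
  obtains w where "w \<in> closed_segment x y" "D w = 0"
proof (cases "x \<le> y")
  case True
  then show ?thesis
    using IVT'[of D x 0 y] that assms continuous_on_subset[OF cont]
    by (auto simp: closed_segment_eq_real_ivl)
next
  case False
  then show ?thesis
    using IVT2'[of D x 0 y] that assms continuous_on_subset[OF cont]
    by (auto simp: closed_segment_eq_real_ivl)
qed

lemma complementary_gap:
  fixes C :: "real set"
  assumes C: "closed C" "a \<in> C" "a \<le> y" "b \<in> C" "y \<le> b" "y \<notin> C"
  obtains c d where "c \<in> C" "d \<in> C" "a \<le> c" "c < y" "y < d" "d \<le> b" "\<And>z. c < z \<Longrightarrow> z < d \<Longrightarrow> z \<notin> C"
proof -
  define c where "c = Sup (C \<inter> {..y})"
  define d where "d = Inf (C \<inter> {y..})"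
  have "c \<in> C \<inter> {..y}"
    unfolding c_def using C by (intro closed_contains_Sup) (auto intro!: bdd_aboveI[of _ y])
  moreover have "d \<in> C \<inter> {y..}"
    unfolding d_def using C by (intro closed_contains_Inf) (auto intro!: bdd_belowI[of _ y])
  ultimately have cd: "c \<in> C" "d \<in> C" "c < y" "y < d" using C(6) by (auto simp: order_le_less)
  have cub: "z \<le> c" if "z \<in> C" "z \<le> y" for z
    unfolding c_def using that by (intro cSup_upper) (auto intro!: bdd_aboveI[of _ y])
  have dlb: "d \<le> z" if "z \<in> C" "y \<le> z" for z
    unfolding d_def using that by (intro cInf_lower) (auto intro!: bdd_belowI[of _ y])
  have "z \<notin> C" if "c < z" "z < d" for z
    using cub[of z] dlb[of z] that by (meson linorder_le_cases not_le)
  then show ?thesis using that cd cub[OF C(2,3)] dlb[OF C(4,5)] by blast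
qed

text \<open>
  A bounded orbit would converge to a fixed point.
\<close>

lemma orbit_exceeds:
  assumes F: "plmap F" and up: "\<And>z. a \<le> z \<Longrightarrow> z \<le> b \<Longrightarrow> z < F z"
  shows "\<exists>n. b < (F ^^ n) a"
proof (rule ccontr)
  assume "\<not> (\<exists>n. b < (F ^^ n) a)"
  then have bd: "(F ^^ n) a \<le> b" for n by (simp add: not_less)
  define s where "s = (SUP n. (F ^^ n) a)"
  have ub: "(F ^^ n) a \<le> s" for n
    unfolding s_def by (rule cSUP_upper) (auto intro!: bdd_aboveI[of _ b] bd)
  have lub: "s \<le> x" if "\<And>n. (F ^^ n) a \<le> x" for x
    unfolding s_def by (rule cSUP_least) (use that in auto)
  have s: "a \<le> s" "s \<le> b" using ub[of 0] lub[OF bd] by simp_all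
  have "(F ^^ n) a \<le> inv_into UNIV F s" for n
  proof -
    have "F ((F ^^ n) a) \<le> F (inv_into UNIV F s)" using ub[of "Suc n"] plmap_inv_right[OF F, of s] by simp
    then show ?thesis using plmap_le_iff[OF F] by blast
  qed
  then have "s \<le> inv_into UNIV F s" by (rule lub)
  then have "F s \<le> F (inv_into UNIV F s)" using plmap_le_iff[OF F] by blast
  then show False using up[OF s] plmap_inv_right[OF F, of s] by simp
qed

section \<open>Lifts of circle maps\<close>

definition lifts :: "(real \<Rightarrow> real) \<Rightarrow> (circle \<Rightarrow> circle) \<Rightarrow> bool" where
  "lifts F f \<longleftrightarrow> plmap F \<and> (\<forall>x. circle_of (F x) = f (circle_of x))"

lemma lifts_plmap: "lifts F f \<Longrightarrow> plmap F"
  by (simp add: lifts_def)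

lemma lifts_circle_of: "lifts F f \<Longrightarrow> circle_of (F x) = f (circle_of x)"
  by (simp add: lifts_def)

lemma lifts_id: "lifts (\<lambda>x. x) id"
  by (simp add: lifts_def plmap_id)

lemma lifts_comp: "lifts F f \<Longrightarrow> lifts G g \<Longrightarrow> lifts (F \<circ> G) (f \<circ> g)"
  by (simp add: lifts_def plmap_comp)

lemma lifts_inv:
  assumes F: "lifts F f" and g: "g \<circ> f = id"
  shows "lifts (inv_into UNIV F) g"
  unfolding lifts_def
proof (intro conjI allI)
  show "plmap (inv_into UNIV F)" using F by (simp add: lifts_plmap plmap_inv)
  fix x
  have "g (f (circle_of (inv_into UNIV F x))) = circle_of (inv_into UNIV F x)"
    using g by (metis comp_apply id_apply)
  moreover have "f (circle_of (inv_into UNIV F x)) = circle_of x"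
    using F lifts_circle_of[OF F, of "inv_into UNIV F x"] by (simp add: lifts_plmap)
  ultimately show "circle_of (inv_into UNIV F x) = g (circle_of x)" by simp
qed

lemma circle_of_add_int [simp]: "circle_of (x + of_int k) = circle_of x"
  by (simp add: circle_of_eq_iff)

lemma circle_of_eq_obtain:
  assumes "circle_of x = circle_of y"
  obtains k :: int where "x = y + of_int k"
proof -
  obtain k :: int where "x - y = of_int k" using assms unfolding circle_of_eq_iff Ints_def by blast
  then show ?thesis using that[of k] by simp
qed

lemma lifts_shift: "lifts F f \<Longrightarrow> lifts (\<lambda>x. F x + of_int k) f"
  using plmap_comp[OF plmap_shift[of "of_int k"], of F] by (simp add: lifts_def comp_def)

lemma integer_valued_constant:
  fixes h :: "real \<Rightarrow> real"
  assumes "continuous_on UNIV h" "\<And>x. h x \<in> \<int>"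
  shows "h x = h y"
proof -
  have "h constant_on UNIV"
  proof (rule continuous_discrete_range_constant)
    fix x :: real
    have "1 \<le> norm (h y - h x)" if "h y \<noteq> h x" for y
      using Ints_nonzero_abs_ge1[of "h y - h x"] assms(2) that by simp
    then show "\<exists>e>0. \<forall>y. y \<in> UNIV \<and> h y \<noteq> h x \<longrightarrow> e \<le> norm (h y - h x)"
      by (intro exI[of _ 1]) simp
  qed (use assms in auto)
  then show ?thesis by (auto simp: constant_on_def)
qed

lemma lifts_unique:
  assumes "lifts F f" "lifts G f"
  obtains k :: int where "\<And>x. F x = G x + of_int k"
proof -
  have "F x - G x = F 0 - G 0" for x
  proof (rule integer_valued_constant[where h = "\<lambda>x. F x - G x"])
    show "continuous_on UNIV (\<lambda>x. F x - G x)"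
      using assms by (intro continuous_on_diff) (auto simp: lifts_def plmap_def)
    show "F x - G x \<in> \<int>" for x
      using assms by (simp add: lifts_def flip: circle_of_eq_iff)
  qed
  moreover have "F 0 - G 0 \<in> \<int>" using assms by (simp add: lifts_def flip: circle_of_eq_iff)
  then obtain k :: int where "F 0 - G 0 = of_int k" unfolding Ints_def by blast
  ultimately have "F x = G x + of_int k" for x by (metis add.commute diff_add_cancel)
  then show ?thesis using that by blast
qed

lemma lifts_fixing:
  assumes "lifts F f" "f (circle_of x) = circle_of x"
  obtains G where "lifts G f" "G x = x"
proof -
  obtain k :: int where "F x = x + of_int k"
    using assms lifts_circle_of circle_of_eq_obtain by metis
  then show ?thesis using that[OF lifts_shift[OF assms(1), of "- k"]] by simp
qed

lemma lifts_unique_fixing: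
  assumes "lifts F f" "lifts G f" "F x = G x"
  shows "F = G"
proof -
  obtain k :: int where "\<And>x. F x = G x + of_int k" using lifts_unique[OF assms(1,2)] by blast
  then show ?thesis using assms(3) by fastforce
qed

lemma lifts_determines_map:
  assumes "lifts F f" "lifts G g" "F = G"
  shows "f = g"
proof
  fix p
  obtain x where "p = circle_of x" using circle_of_surj by metis
  then show "f p = g p" using assms lifts_circle_of by metis
qed

lemma finite_circle_of_vimage:
  assumes "finite A"
  shows "finite ({t. circle_of t \<in> A} \<inter> {a..b})"
proof -
  have "finite ({t. circle_of t = p} \<inter> {a..b})" for p
  proof -
    obtain x where x: "p = circle_of x" using circle_of_surj by metis
    have "{t. circle_of t = p} \<inter> {a..b} \<subseteq> (\<lambda>k. x + of_int k) ` {\<lceil>a - x\<rceil>..\<lfloor>b - x\<rfloor>}"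
    proof
      fix t assume t: "t \<in> {t. circle_of t = p} \<inter> {a..b}"
      then obtain k :: int where k: "t = x + of_int k"
        using x circle_of_eq_obtain by blast
      then have "k \<in> {\<lceil>a - x\<rceil>..\<lfloor>b - x\<rfloor>}" using t by (auto simp: ceiling_le_iff le_floor_iff)
      then show "t \<in> (\<lambda>k. x + of_int k) ` {\<lceil>a - x\<rceil>..\<lfloor>b - x\<rfloor>}" using k by blast
    qed
    then show ?thesis by (rule finite_subset) simp
  qed
  moreover have "{t. circle_of t \<in> A} \<inter> {a..b} = (\<Union>p\<in>A. {t. circle_of t = p} \<inter> {a..b})" by auto
  moreover have "finite (\<Union>p\<in>A. {t. circle_of t = p} \<inter> {a..b})"
    using assms calculation(1) by (intro finite_UN_I) auto
  ultimately show ?thesis by (simp only:)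
qed

text \<open>
  The lift and the affine map have the same image in the circle, so near the point their difference is
  a continuous integer valued function.
\<close>

lemma locally_affine_lift:
  assumes cont: "continuous_on UNIV G" and G: "\<And>x. circle_of (G x) = g (circle_of x)"
    and aff: "locally_affine_at g (circle_of x)"
  shows "\<exists>a b. \<forall>\<^sub>F t in nhds x. G t = a * t + b"
proof -
  obtain a b y where y: "circle_of y = circle_of x"
    "\<forall>\<^sub>F t in nhds y. g (circle_of t) = circle_of (a * t + b)"
    using aff unfolding locally_affine_at_def by blast
  obtain n :: int where n: "y = x + of_int n" using y(1) by (rule circle_of_eq_obtain)
  define h where "h = (\<lambda>t. G t - (a * (t + of_int n) + b))"
  have "((\<lambda>t. t + of_int n) \<longlongrightarrow> y) (nhds x)"
    unfolding n by (intro tendsto_intros filterlim_ident)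
  then have "\<forall>\<^sub>F t in nhds x. g (circle_of (t + of_int n)) = circle_of (a * (t + of_int n) + b)"
    using y(2) by (rule eventually_compose_filterlim[rotated])
  then have int: "\<forall>\<^sub>F t in nhds x. h t \<in> \<int>"
    by eventually_elim (simp add: h_def G flip: circle_of_eq_iff)
  have "isCont h x"
    using cont unfolding h_def by (intro continuous_intros) (auto simp: continuous_on_eq_continuous_at)
  then have "(h \<longlongrightarrow> h x) (nhds x)"
    using isCont_def tendsto_nhds_iff by blast
  then have "\<forall>\<^sub>F t in nhds x. dist (h t) (h x) < 1" by (rule tendstoD) simp
  with int have "\<forall>\<^sub>F t in nhds x. h t = h x"
  proof eventually_elim
    case (elim t)
    have "h x \<in> \<int>" using eventually_nhds_x_imp_x[OF int] .
    then show ?case using elim Ints_nonzero_abs_ge1[of "h t - h x"] by (fastforce simp: dist_real_def)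
  qed
  then have "\<forall>\<^sub>F t in nhds x. G t = a * t + (h x + a * of_int n + b)"
    by eventually_elim (simp add: h_def algebra_simps)
  then show ?thesis by blast
qed

lemma lifts_locally_affine:
  assumes "lifts F f" "locally_affine_at f (circle_of x)"
  shows "\<exists>a b. \<forall>\<^sub>F t in nhds x. F t = a * t + b"
  using locally_affine_lift[of F f x] assms by (simp add: lifts_def plmap_def)

text \<open>
  The finitely many exceptional points lift to a set without accumulation points, so that on each side
  of \<open>z\<close> a short interval is free of them.
\<close>

lemma PL_lift_germs:
  assumes cont: "continuous_on UNIV G" and G: "\<And>x. circle_of (G x) = g (circle_of x)"
    and g: "PL_homeo g"
  shows "\<exists>a. \<forall>\<^sub>F t in side b z. G t = G z + a * (t - z)"
proof -
  obtain A where A: "finite A" "\<And>p. p \<notin> A \<Longrightarrow> locally_affine_at g p"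
    using g unfolding PL_homeo_def by blast
  have "finite ({t. circle_of t \<in> A} \<inter> {z - 1..z + 1})" using A(1) by (rule finite_circle_of_vimage)
  then obtain d where d: "d > 0" "\<And>t. t \<in> {t. circle_of t \<in> A} \<inter> {z - 1..z + 1} \<Longrightarrow> t \<noteq> z \<Longrightarrow> d \<le> dist z t"
    using finite_set_avoid[of _ z] by meson
  define e where "e = min d 1"
  have e: "e > 0" "e \<le> 1" "e \<le> d" using d by (auto simp: e_def)
  have aff: "\<exists>a b. \<forall>\<^sub>F s in nhds t. G s = a * s + b" if "t \<noteq> z" "\<bar>t - z\<bar> < e" for t
  proof -
    have "circle_of t \<notin> A" using d(2)[of t] that e by (auto simp: dist_real_def abs_if split: if_splits)
    then show ?thesis using locally_affine_lift[OF cont G A(2)] by blast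
  qed
  have lim: "(G \<longlongrightarrow> G z) (at z)" using cont by (simp add: continuous_on_eq_continuous_at isCont_def)
  define I where "I = (if b then {z<..<z + e} else {z - e<..<z})"
  obtain a c where ac: "\<And>t. t \<in> I \<Longrightarrow> G t = a * t + c"
  proof (cases b)
    case True
    then show ?thesis using that affine_on_interval[of z "z + e" G] aff by (auto simp: I_def)
  next
    case False
    then show ?thesis using that affine_on_interval[of "z - e" z G] aff by (auto simp: I_def)
  qed
  have ev: "\<forall>\<^sub>F t in side b z. t \<in> I"
    using eventually_at_right_real[of z "z + e"] eventually_at_left_real[of "z - e" z] e
    by (simp add: I_def side_def)
  have "((\<lambda>t. a * t + c) \<longlongrightarrow> G z) (side b z)"
  proof (rule Lim_transform_eventually)
    show "(G \<longlongrightarrow> G z) (side b z)" using lim by (simp add: side_def filterlim_at_split)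
    show "\<forall>\<^sub>F t in side b z. G t = a * t + c" using ev by eventually_elim (rule ac)
  qed
  moreover have "((\<lambda>t. a * t + c) \<longlongrightarrow> a * z + c) (side b z)"
    unfolding side_def by (auto intro!: tendsto_intros)
  ultimately have Gz: "G z = a * z + c" using tendsto_unique side_neq_bot by blast
  have "\<forall>\<^sub>F t in side b z. G t = G z + a * (t - z)"
    using ev by eventually_elim (simp add: ac Gz algebra_simps)
  then show ?thesis by blast
qed

section \<open>Existence of lifts\<close>

text \<open>
  Embedding the circle into the punctured plane turns lifting into taking complex logarithms.
\<close>

definition circle_exp :: "circle \<Rightarrow> complex" where
  "circle_exp p = exp (2 * of_real pi * \<i> * of_real (rep_circle p))"

lemma circle_exp_circle_of: "circle_exp (circle_of t) = exp (2 * of_real pi * \<i> * of_real t)"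
proof -
  have "circle_of (rep_circle (circle_of t)) = circle_of t"
    by (meson Quotient3_abs_rep Quotient3_circle)
  then obtain k :: int where "rep_circle (circle_of t) = t + of_int k" by (rule circle_of_eq_obtain)
  then show ?thesis unfolding circle_exp_def exp_eq by (intro exI[of _ k]) (simp add: algebra_simps)
qed

lemma circle_exp_eq_iff: "circle_exp (circle_of s) = circle_exp (circle_of t) \<longleftrightarrow> circle_of s = circle_of t"
proof
  assume "circle_exp (circle_of s) = circle_exp (circle_of t)"
  then obtain n :: int where
    "2 * of_real pi * \<i> * of_real s = 2 * of_real pi * \<i> * of_real t + (of_int (2 * n) * pi) * \<i>"
    unfolding circle_exp_circle_of exp_eq by blast
  then have "Im (2 * of_real pi * \<i> * of_real s) = Im (2 * of_real pi * \<i> * of_real t + (of_int (2 * n) * pi) * \<i>)"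
    by simp
  then have "2 * pi * s = 2 * pi * (t + of_int n)" by (simp add: algebra_simps)
  then have "s = t + of_int n" by simp
  then show "circle_of s = circle_of t" by simp
qed simp

lemma continuous_circle_exp: "continuous_on UNIV circle_exp"
unfolding continuous_on_open_vimage[OF open_UNIV]
proof (intro allI impI)
  fix B :: "complex set" assume "open B"
  have "circle_of -` circle_exp -` B = (\<lambda>t. exp (2 * of_real pi * \<i> * of_real t)) -` B"
    by (auto simp: circle_exp_circle_of)
  moreover have "open \<dots>"
    by (intro open_vimage \<open>open B\<close> continuous_intros)
  ultimately show "open (circle_exp -` B \<inter> UNIV)" by (simp add: open_circle_def)
qed

lemma continuous_circle_of: "continuous_on UNIV circle_of"
  unfolding continuous_on_open_vimage[OF open_UNIV] by (simp add: open_circle_def)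

text \<open>
  The degree \<open>k\<close> is determined by injectivity. For \<open>k = 0\<close> the lift would return to its initial
  value after one period, and a continuous function that does so takes some value twice; for
  \<open>\<bar>k\<bar> \<ge> 2\<close> it would pass through \<open>F 0 \<plusminus> 1\<close> before the period is over.
\<close>

lemma homeo_lift_exists:
  assumes f: "homeomorphism UNIV UNIV f g"
  obtains F and k :: int where "continuous_on UNIV F" "\<And>x. circle_of (F x) = f (circle_of x)"
    "inj F" "\<bar>k\<bar> = 1" "\<And>x. F (x + 1) = F x + of_int k"
proof -
  have contf: "continuous_on UNIV f" and injf: "\<And>p q. f p = f q \<Longrightarrow> p = q"
    using f unfolding homeomorphism_def by (auto, metis)
  have "continuous_on UNIV (\<lambda>t. circle_exp (f (circle_of t)))"
    by (intro continuous_on_compose2[OF continuous_circle_exp] continuous_on_compose2[OF contf]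
        continuous_circle_of) auto
  moreover have "contractible (UNIV :: real set)" by (simp add: convex_imp_contractible)
  moreover have "circle_exp p \<noteq> 0" for p by (simp add: circle_exp_def)
  ultimately obtain h where h: "continuous_on UNIV h" "\<And>t. circle_exp (f (circle_of t)) = exp (h t)"
    using continuous_logarithm_on_contractible[of UNIV "\<lambda>t. circle_exp (f (circle_of t))"] by auto
  define F where "F = (\<lambda>t. Im (h t) / (2 * pi))"
  have contF: "continuous_on UNIV F"
    unfolding F_def by (intro continuous_intros h(1)) simp
  have F: "circle_of (F t) = f (circle_of t)" for t
  proof -
    obtain y where y: "f (circle_of t) = circle_of y" using circle_of_surj by metis
    have "exp (h t) = exp (2 * of_real pi * \<i> * of_real y)"
      using h(2)[of t] by (simp add: y circle_exp_circle_of)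
    moreover from this have "norm (exp (h t)) = 1" by (simp add: norm_exp_eq_Re)
    then have "Re (h t) = 0" by (simp add: norm_exp_eq_Re)
    then have "h t = 2 * of_real pi * \<i> * of_real (F t)" by (simp add: complex_eq_iff F_def)
    ultimately have "circle_exp (circle_of (F t)) = circle_exp (circle_of y)"
      by (simp add: circle_exp_circle_of)
    then show ?thesis using y circle_exp_eq_iff by metis
  qed
  have "F (x + 1) - F x \<in> \<int>" for x
  proof -
    have "circle_of (F (x + 1)) = circle_of (F x)" using circle_of_add_int[of x 1] by (simp add: F)
    then show ?thesis by (simp add: circle_of_eq_iff)
  qed
  moreover have "continuous_on UNIV (\<lambda>x. F (x + 1) - F x)"
    by (intro continuous_on_diff contF continuous_on_compose2[OF contF]) (auto intro!: continuous_intros)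
  ultimately have const: "F (x + 1) - F x = F 1 - F 0" and int: "F 1 - F 0 \<in> \<int>" for x
    using integer_valued_constant[of "\<lambda>x. F (x + 1) - F x" x 0] by (auto, metis add_0)
  obtain k :: int where k: "F 1 - F 0 = of_int k" using int unfolding Ints_def by blast
  have step: "F (x + 1) = F x + of_int k" for x using const[of x] k by simp
  have stepn: "F (x + real n) = F x + of_int k * real n" for x n
  proof (induction n)
    case (Suc n)
    have "F (x + real n + 1) = F (x + real n) + of_int k" by (rule step)
    then show ?case using Suc by (simp add: algebra_simps)
  qed simp
  have int_diff: "x - y \<in> \<int>" if "F x - F y \<in> \<int>" for x y
    using that by (simp add: F flip: circle_of_eq_iff) (metis injf)
  have cont_on: "continuous_on S F" for S using contF continuous_on_subset by blast
  have small: "x = y" if "F x - F y \<in> \<int>" "\<bar>x - y\<bar> < 1" for x y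
    using int_diff[OF that(1)] Ints_nonzero_abs_ge1[of "x - y"] that(2) by fastforce
  have k0: "k \<noteq> 0"
  proof
    assume k0: "k = 0"
    then have F1: "F 1 = F 0" using k by simp
    have "inj_on F {0..1/2}"
      by (rule inj_onI) (use small in \<open>auto simp: abs_if\<close>)
    then have "F 0 < F (1/4) \<and> F (1/4) < F (1/2) \<or> F (1/2) < F (1/4) \<and> F (1/4) < F 0"
      by (intro continuous_inj_imp_mono cont_on) auto
    then obtain s where s: "1/2 \<le> s" "s \<le> 1" "F s = F (1/4)"
    proof
      assume "F 0 < F (1/4) \<and> F (1/4) < F (1/2)"
      then show ?thesis using that IVT2'[of F 1 "F (1/4)" "1/2"] F1 cont_on by force
    next
      assume "F (1/2) < F (1/4) \<and> F (1/4) < F 0"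
      then show ?thesis using that IVT'[of F "1/2" "F (1/4)" 1] F1 cont_on by force
    qed
    then have "s = 1/4" using small[of s "1/4"] by auto
    with s show False by simp
  qed
  have inj: "inj F"
  proof (rule injI)
    fix x y assume xy: "F x = F y"
    have *: "x = y" if xy: "F x = F y" "x \<ge> y" for x y
    proof -
      have "x - y \<in> \<int>" using int_diff[of x y] xy by simp
      then obtain n :: int where n: "x - y = of_int n" unfolding Ints_def by blast
      have "F (y + real (nat n)) = F y + of_int k * real (nat n)" by (rule stepn)
      moreover have "y + real (nat n) = x" using n xy(2) by simp
      ultimately show ?thesis using xy(1) k0 by auto
    qed
    show "x = y" using *[of x y] *[of y x] xy by linarith
  qed
  have k1: "\<bar>k\<bar> = 1"
  proof (rule ccontr)
    assume "\<bar>k\<bar> \<noteq> 1"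
    then consider "k \<ge> 2" | "k \<le> -2" using k0 by linarith
    then have "\<exists>s. 0 \<le> s \<and> s \<le> 1 \<and> (F s = F 0 + 1 \<or> F s = F 0 - 1)"
    proof cases
      case 1
      then have "F 0 + 1 \<le> F 1" using k by linarith
      then show ?thesis using IVT'[of F 0 "F 0 + 1" 1] cont_on by auto
    next
      case 2
      then have "F 1 \<le> F 0 - 1" using k by linarith
      then show ?thesis using IVT2'[of F 1 "F 0 - 1" 0] cont_on by auto
    qed
    then obtain s where s: "0 \<le> s" "s \<le> 1" "F s = F 0 + 1 \<or> F s = F 0 - 1" by blast
    then have "F s - F 0 \<in> \<int>" by auto
    moreover have "s \<noteq> 1" using s(3) k \<open>\<bar>k\<bar> \<noteq> 1\<close> by auto
    ultimately have "s = 0" using small[of s 0] s by auto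
    then show False using s(3) by auto
  qed
  show ?thesis by (rule that[OF contF F inj k1 step])
qed

text \<open>
  A lift is monotone, increasing or decreasing according to its degree, so its square increases.
\<close>

lemma PL_homeo_square_lifts:
  assumes f: "PL_homeo f"
  shows "\<exists>F. lifts F (f \<circ> f)"
proof -
  obtain g where g: "homeomorphism UNIV UNIV f g" using f unfolding PL_homeo_def by blast
  obtain F and k :: int where contF: "continuous_on UNIV F" and F: "\<And>x. circle_of (F x) = f (circle_of x)"
    and inj: "inj F" and k: "\<bar>k\<bar> = 1" "\<And>x. F (x + 1) = F x + of_int k"
    using homeo_lift_exists[OF g] by blast
  have stepn: "F (x + real n) = F x + of_int k * real n" for x n
  proof (induction n)
    case (Suc n)
    have "F (x + real n + 1) = F (x + real n) + of_int k" by (rule k(2))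
    then show ?case using Suc by (simp add: algebra_simps)
  qed simp
  have mono: "if k = 1 then F x < F y else F y < F x" if "x < y" for x y
  proof -
    obtain n where n: "y - x < real n" using reals_Archimedean2 by blast
    have "F x < F y \<and> F y < F (x + real n) \<or> F (x + real n) < F y \<and> F y < F x"
      using that n inj by (intro continuous_inj_imp_mono continuous_on_subset[OF contF])
        (auto intro: inj_on_subset)
    then show ?thesis using stepn[of x n] n that k(1) by (auto simp: abs_if split: if_splits)
  qed
  have "plmap (F \<circ> F)"
    unfolding plmap_def
  proof (intro conjI allI)
    show "strict_mono (F \<circ> F)"
      unfolding strict_mono_def comp_def using mono by (cases "k = 1") simp_all
    show cont: "continuous_on UNIV (F \<circ> F)" using contF by (metis continuous_on_compose continuous_on_subset subset_UNIV)
    show "(F \<circ> F) (x + 1) = (F \<circ> F) x + 1" for x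
    proof -
      have "k = 1 \<or> k = -1" using k(1) by linarith
      then show ?thesis
      proof
        assume "k = 1" then show ?thesis by (simp add: k(2))
      next
        assume "k = -1" then show ?thesis using k(2)[of "F x - 1"] by (simp add: k(2))
      qed
    qed
    fix b z
    have lift: "circle_of ((F \<circ> F) x) = (f \<circ> f) (circle_of x)" for x by (simp add: F)
    show "\<exists>a. \<forall>\<^sub>F t in side b z. (F \<circ> F) t = (F \<circ> F) z + a * (t - z)"
      by (rule PL_lift_germs[OF cont lift PL_homeo_comp[OF f f]])
  qed
  then have "lifts (F \<circ> F) (f \<circ> f)" by (simp add: lifts_def F)
  then show ?thesis by blast
qed

section \<open>Maps with a common fixed point\<close>

text \<open>
  Rigidity in an inverse-free form: the first equation says that \<open>k\<close> is the conjugate of \<open>g\<close> by \<open>h\<close>.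
\<close>

definition conj_rigid :: "('a \<Rightarrow> 'a) set \<Rightarrow> bool" where
  "conj_rigid G \<longleftrightarrow> (\<forall>g\<in>G. \<forall>h\<in>G. \<forall>k\<in>G. k \<circ> h = h \<circ> g \<longrightarrow> g \<circ> k = k \<circ> g \<longrightarrow> g \<circ> h = h \<circ> g)"

lemma conj_rigidD:
  "conj_rigid G \<Longrightarrow> g \<in> G \<Longrightarrow> h \<in> G \<Longrightarrow> k \<in> G \<Longrightarrow> k \<circ> h = h \<circ> g \<Longrightarrow> g \<circ> k = k \<circ> g \<Longrightarrow> g \<circ> h = h \<circ> g"
  unfolding conj_rigid_def by blast

text \<open>
  At a common fixed point the one-sided germs are multiplications, and multiplications commute.
\<close>

lemma commutator_trivial_at_fixed_point:
  assumes U: "plmap U" "U c = c" and V: "plmap V" "V c = c"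
  shows "\<forall>\<^sub>F t in nhds c. U (V t) = V (U t)"
proof -
  have "\<forall>\<^sub>F t in side b c. U (V t) = V (U t)" for b
  proof -
    obtain u where u: "\<forall>\<^sub>F t in side b c. U t = U c + u * (t - c)"
      using U(1) unfolding plmap_def by blast
    obtain v where v: "\<forall>\<^sub>F t in side b c. V t = V c + v * (t - c)"
      using V(1) unfolding plmap_def by blast
    have "filterlim V (side b c) (side b c)" "filterlim U (side b c) (side b c)"
      using plmap_side[OF V(1), of b c] plmap_side[OF U(1), of b c] U V by simp_all
    from eventually_compose_filterlim[OF u this(1)] eventually_compose_filterlim[OF v this(2)] u v
    show ?thesis by eventually_elim (simp add: U V)
  qed
  then have "\<forall>\<^sub>F t in at c. U (V t) = V (U t)" by (simp add: eventually_at_sides)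
  then show ?thesis using U V by (simp add: eventually_nhds_conv_at)
qed

lemma plmap_nhds: "plmap F \<Longrightarrow> filterlim F (nhds (F c)) (nhds c)"
  using plmap_isCont[of F c] unfolding isCont_def by (simp add: tendsto_nhds_iff)

text \<open>
  Here \<open>K\<close> is a rigid group all of whose elements fix the common fixed points of \<open>U\<close> and \<open>V\<close>. The set
  \<open>Q\<close> collects its nontrivial elements that are the identity near every point of \<open>C\<close>, and \<open>E g\<close> consists
  of the left endpoints, within one period, of the gaps of \<open>C\<close> in which \<open>g\<close> is nontrivial. If \<open>U\<close> and
  \<open>V\<close> did not commute, \<open>Q\<close> would contain their commutator; but an element of \<open>Q\<close> with a minimal
  number of gaps can be improved.
\<close>

lemma commute_of_common_fixed_point_line:
  fixes K :: "(real \<Rightarrow> real) set"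
  defines "C \<equiv> {x. \<forall>F\<in>K. F x = x}"
  assumes pl: "\<And>F. F \<in> K \<Longrightarrow> plmap F"
    and comp: "\<And>F G. F \<in> K \<Longrightarrow> G \<in> K \<Longrightarrow> F \<circ> G \<in> K"
    and inv: "\<And>F. F \<in> K \<Longrightarrow> inv_into UNIV F \<in> K"
    and rigid: "conj_rigid K"
    and U: "U \<in> K" and V: "V \<in> K"
    and C_UV: "\<And>x. U x = x \<Longrightarrow> V x = x \<Longrightarrow> x \<in> C"
    and base: "base \<in> C"
  shows "U \<circ> V = V \<circ> U"
proof (rule ccontr)
  assume nc: "U \<circ> V \<noteq> V \<circ> U"
  note invR = plmap_inv_right[OF pl] and invL = plmap_inv_left[OF pl]
  have fixC: "F c = c" if "F \<in> K" "c \<in> C" for F c using that by (simp add: C_def)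
  have C_eq: "C = {x. U x = x} \<inter> {x. V x = x}" using C_UV U V by (auto simp: C_def)
  have closedC: "closed C"
    unfolding C_eq by (intro closed_Int closed_fixed_points pl U V)
  have Cint: "x + of_int n \<in> C" if "x \<in> C" for x n
    using that by (simp add: C_def plmap_add_int[OF pl])
  have Cbelow: "\<exists>c\<in>C. c \<le> x" and Cabove: "\<exists>c\<in>C. x \<le> c" for x
  proof -
    have "base + of_int \<lfloor>x - base\<rfloor> \<le> x" "x \<le> base + of_int \<lceil>x - base\<rceil>" by linarith+
    then show "\<exists>c\<in>C. c \<le> x" "\<exists>c\<in>C. x \<le> c" using Cint base by blast+
  qed
  define gap where "gap = (\<lambda>c x. c \<in> C \<and> c < x \<and> {c<..x} \<inter> C = {})"
  have gap_exists: "\<exists>c d. gap c x \<and> d \<in> C \<and> x < d \<and> (\<forall>z. c < z \<longrightarrow> z < d \<longrightarrow> z \<notin> C)" if x: "x \<notin> C" for x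
  proof -
    obtain a b where "a \<in> C" "a \<le> x" "b \<in> C" "x \<le> b" using Cbelow Cabove by blast
    then obtain c d where "c \<in> C" "d \<in> C" "c < x" "x < d" "\<And>z. c < z \<Longrightarrow> z < d \<Longrightarrow> z \<notin> C"
      using complementary_gap[OF closedC _ _ _ _ x] by metis
    moreover from this have "gap c x" unfolding gap_def by fastforce
    ultimately show ?thesis by blast
  qed
  have gap_inv: "gap c (F x)" if "gap c x" "F \<in> K" for c x F
  proof -
    have "c < F x" using that plmap_less_iff[OF pl, of F c x] fixC[of F c] by (auto simp: gap_def)
    moreover have False if y: "y \<in> C" "c < y" "y \<le> F x" for y
    proof -
      have "F y \<le> F x" using y fixC[of F y] \<open>F \<in> K\<close> by simp
      then have "y \<le> x" using plmap_le_iff[OF pl] \<open>F \<in> K\<close> by blast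
      then show False using \<open>gap c x\<close> y unfolding gap_def by auto
    qed
    ultimately show ?thesis using that(1) unfolding gap_def by auto
  qed
  define Q where "Q = {g\<in>K. g \<noteq> id \<and> (\<forall>c\<in>C. \<forall>\<^sub>F t in nhds c. g t = t)}"
  define E where "E = (\<lambda>g::real\<Rightarrow>real. {c \<in> {base..base + 1}. \<exists>x. gap c x \<and> g x \<noteq> x})"
  have finE: "finite (E g)" for g
  proof -
    have "E g \<subseteq> (frontier {x. U x = x} \<inter> {base..base + 1}) \<union> (frontier {x. V x = x} \<inter> {base..base + 1})"
    proof
      fix c assume c: "c \<in> E g"
      then obtain x where x: "gap c x" by (auto simp: E_def)
      have "c \<notin> interior C"
      proof
        assume "c \<in> interior C"
        then obtain e where e: "e > 0" "ball c e \<subseteq> C" using mem_interior by blast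
        define y where "y = c + min (e/2) (x - c)"
        have y: "c < y" "y \<le> x" "dist c y < e" using e x by (auto simp: y_def gap_def dist_real_def min_def)
        then have "y \<in> C" using e by auto
        then show False using x y unfolding gap_def by auto
      qed
      then have "c \<notin> interior {x. U x = x} \<or> c \<notin> interior {x. V x = x}" by (simp add: C_eq)
      moreover have "c \<in> closure {x. U x = x}" "c \<in> closure {x. V x = x}"
        using x closure_subset[of "{x. U x = x}"] closure_subset[of "{x. V x = x}"]
        unfolding gap_def C_eq by blast+
      ultimately show "c \<in> (frontier {x. U x = x} \<inter> {base..base + 1}) \<union> (frontier {x. V x = x} \<inter> {base..base + 1})"
        using c by (auto simp: frontier_def E_def)
    qed
    then show ?thesis
      using finite_frontier_fixed_points[OF pl[OF U]] finite_frontier_fixed_points[OF pl[OF V]]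
      by (meson finite_UnI finite_subset)
  qed
  have commutator_Q: "\<exists>g'\<in>Q. \<forall>x. G (H x) = H (G x) \<longrightarrow> g' x = x"
    if GH: "G \<in> K" "H \<in> K" "G \<circ> H \<noteq> H \<circ> G" and ev: "\<And>c. c \<in> C \<Longrightarrow> \<forall>\<^sub>F t in nhds c. G (H t) = H (G t)" for G H
  proof -
    define g' where "g' = inv_into UNIV (H \<circ> G) \<circ> (G \<circ> H)"
    have HG: "H \<circ> G \<in> K" using comp GH by blast
    have "g' \<in> K" unfolding g'_def using comp inv GH by blast
    moreover have g': "g' x = x \<longleftrightarrow> G (H x) = H (G x)" for x
    proof -
      have "(H \<circ> G) (g' x) = G (H x)" using invR[OF HG, of "G (H x)"] by (simp add: g'_def)
      then show ?thesis using plmap_eq_iff[OF pl[OF HG], of "g' x" x] by auto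
    qed
    moreover have "g' \<noteq> id"
    proof
      assume "g' = id"
      then have "G (H x) = H (G x)" for x using g'[of x] by simp
      then show False using GH(3) by (simp add: fun_eq_iff)
    qed
    moreover have "\<forall>\<^sub>F t in nhds c. g' t = t" if "c \<in> C" for c
      using ev[OF that] by eventually_elim (simp add: g')
    ultimately show ?thesis unfolding Q_def by blast
  qed
  have "Q \<noteq> {}"
    using commutator_Q[OF U V nc] commutator_trivial_at_fixed_point[OF pl[OF U] _ pl[OF V]]
      fixC[OF U] fixC[OF V] by blast
  then obtain g where g: "g \<in> Q" and min: "\<And>g'. g' \<in> Q \<Longrightarrow> card (E g) \<le> card (E g')"
    using ex_has_least_nat[of "\<lambda>g. g \<in> Q" _ "\<lambda>g. card (E g)"] by blast
  have gK: "g \<in> K" and gid: "g \<noteq> id" and gC: "\<And>c. c \<in> C \<Longrightarrow> \<forall>\<^sub>F t in nhds c. g t = t"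
    using g by (auto simp: Q_def)
  have "\<exists>c x. c \<in> {base..base+1} \<and> gap c x \<and> g x \<noteq> x"
  proof -
    obtain x' where x': "g x' \<noteq> x'" using gid by (metis eq_id_iff ext)
    define x where "x = x' + of_int (- \<lfloor>x' - base\<rfloor>)"
    have "g x = g x' + of_int (- \<lfloor>x' - base\<rfloor>)"
      unfolding x_def by (rule plmap_add_int[OF pl[OF gK]])
    then have gx: "g x \<noteq> x" using x' by (simp add: x_def)
    have x: "base \<le> x" "x \<le> base + 1" unfolding x_def by linarith+
    obtain c where c: "gap c x" using gap_exists[of x] fixC[OF gK] gx by blast
    then have "base \<le> c" using x base fixC[OF gK] unfolding gap_def
      by (metis IntI disjoint_iff greaterThanAtMost_iff linorder_le_less_linear)
    then show ?thesis using c x gx unfolding gap_def by (intro exI[of _ c] exI[of _ x]) (auto simp: gap_def)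
  qed
  then obtain c x where cx: "c \<in> E g" "gap c x" "g x \<noteq> x" unfolding E_def by blast
  have cC: "c \<in> C" and cx': "c < x" "\<And>y. y \<in> C \<Longrightarrow> c < y \<Longrightarrow> y \<le> x \<Longrightarrow> False"
    using cx(2) unfolding gap_def by auto
  obtain c' d where c': "gap c' x" and d: "d \<in> C" "x < d" "\<And>z. c' < z \<Longrightarrow> z < d \<Longrightarrow> z \<notin> C"
    using gap_exists[of x] fixC[OF gK] cx(3) by blast
  have "c' = c"
  proof (rule ccontr)
    assume "c' \<noteq> c"
    then consider "c' < c" | "c < c'" by linarith
    then show False
    proof cases
      case 1
      then show False using d(3)[of c] cC cx'(1) d(2) by simp
    next
      case 2
      then show False using cx'(2)[of c'] c' by (auto simp: gap_def)
    qed
  qed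
  then have noC: "y \<notin> C" if "c < y" "y < d" for y using d(3) that by blast
  have gap_iff: "gap c y \<longleftrightarrow> c < y \<and> y < d" for y
  proof
    assume y: "gap c y"
    have "d \<in> C" "c < d" using d cx' by auto
    with y have "\<not> d \<le> y" unfolding gap_def by auto
    then show "c < y \<and> y < d" using y unfolding gap_def by simp
  next
    assume y: "c < y \<and> y < d"
    then have "z \<notin> C" if "c < z" "z \<le> y" for z using noC[of z] that by simp
    then show "gap c y" using y cC unfolding gap_def by auto
  qed
  define S where "S = {z. gap c z \<and> g z \<noteq> z}"
  have xS: "x \<in> S" using cx by (simp add: S_def)
  have Sb: "c \<le> z" "z \<le> d" if "z \<in> S" for z using that gap_iff by (auto simp: S_def)
  define m1 where "m1 = Inf S"
  define m2 where "m2 = Sup S"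
  have m: "m1 \<le> z" "z \<le> m2" if "z \<in> S" for z
    unfolding m1_def m2_def using that Sb
    by (auto intro!: cInf_lower cSup_upper bdd_belowI[of _ c] bdd_aboveI[of _ d])
  have cm1: "c < m1"
  proof -
    obtain e where e: "e > 0" "\<And>t. dist t c < e \<Longrightarrow> g t = t" using gC[OF cC] unfolding eventually_nhds_metric by blast
    have "c + e \<le> z" if z: "z \<in> S" for z
    proof (rule ccontr)
      assume "\<not> c + e \<le> z"
      then have "dist z c < e" using Sb[OF z] by (simp add: dist_real_def)
      then show False using e z by (simp add: S_def)
    qed
    then have "c + e \<le> m1" unfolding m1_def using xS by (intro cInf_greatest) auto
    then show ?thesis using e by simp
  qed
  have m2d: "m2 < d"
  proof -
    have dC: "d \<in> C" by (rule d(1))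
    obtain e where e: "e > 0" "\<And>t. dist t d < e \<Longrightarrow> g t = t" using gC[OF dC] unfolding eventually_nhds_metric by blast
    have "z \<le> d - e" if z: "z \<in> S" for z
    proof (rule ccontr)
      assume "\<not> z \<le> d - e"
      then have "dist z d < e" using Sb[OF z] by (simp add: dist_real_def)
      then show False using e z by (simp add: S_def)
    qed
    then have "m2 \<le> d - e" unfolding m2_def using xS by (intro cSup_least) auto
    then show ?thesis using e by simp
  qed
  (* Otherwise the supremum s of the orbit of m1 is a common fixed point inside the gap. *)
  have "\<exists>h\<in>K. h m1 > m2"
  proof (rule ccontr)
    assume "\<not> (\<exists>h\<in>K. h m1 > m2)"
    then have le: "\<And>h. h \<in> K \<Longrightarrow> h m1 \<le> m2" by force
    define s where "s = (SUP h\<in>K. h m1)"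
    have ub: "h m1 \<le> s" if "h \<in> K" for h
      unfolding s_def using that le by (intro cSUP_upper) (auto intro!: bdd_aboveI[of _ m2])
    have lub: "s \<le> y" if "\<And>h. h \<in> K \<Longrightarrow> h m1 \<le> y" for y
      unfolding s_def using that U by (intro cSUP_least) auto
    have *: "s \<le> F s" if F: "F \<in> K" for F
    proof (rule lub)
      fix h assume h: "h \<in> K"
      have "inv_into UNIV F (h m1) \<le> s" using ub[OF comp[OF inv[OF F] h]] by simp
      then have "F (inv_into UNIV F (h m1)) \<le> F s" using plmap_le_iff[OF pl[OF F]] by blast
      then show "h m1 \<le> F s" by (simp only: invR[OF F])
    qed
    have "F s = s" if F: "F \<in> K" for F
    proof -
      have "s \<le> inv_into UNIV F s" using * inv F by blast
      then have "F s \<le> F (inv_into UNIV F s)" using plmap_le_iff[OF pl[OF F]] by blast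
      then show ?thesis using *[OF F] by (simp only: invR[OF F])
    qed
    then have "s \<in> C" by (simp add: C_def)
    moreover have "inv_into UNIV U \<circ> U \<in> K" using comp inv U by blast
    from ub[OF this] have "m1 \<le> s" by (simp add: invL[OF U])
    moreover have "s \<le> m2" by (rule lub) (rule le)
    ultimately show False using noC[of s] cm1 m2d by simp
  qed
  then obtain h where h: "h \<in> K" "h m1 > m2" by blast
  define hi where "hi = inv_into UNIV h"
  have hi: "hi \<in> K" "\<And>z. h (hi z) = z" "\<And>z. hi (h z) = z"
    using h inv invR[OF h(1)] invL[OF h(1)] by (auto simp: hi_def)
  (* The supports of g and of its conjugate k are disjoint in the gap (c, d). *)
  define k where "k = h \<circ> g \<circ> hi"
  have kK: "k \<in> K" unfolding k_def using comp h gK hi by blast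
  have kh: "k \<circ> h = h \<circ> g" by (rule ext) (simp add: k_def hi(3))
  have "g \<circ> k \<noteq> k \<circ> g"
  proof
    assume "g \<circ> k = k \<circ> g"
    then have "g \<circ> h = h \<circ> g" using conj_rigidD[OF rigid gK h(1) kK kh] by blast
    then have "g (h x) = h (g x)" by (metis comp_apply)
    then have "g (h x) \<noteq> h x" using cx(3) plmap_eq_iff[OF pl[OF h(1)]] by simp
    then have "h x \<in> S" using gap_inv[OF cx(2) h(1)] by (simp add: S_def)
    moreover have "h m1 \<le> h x" using m[OF xS] plmap_le_iff[OF pl[OF h(1)]] by simp
    ultimately show False using m(2)[of "h x"] h(2) by simp
  qed
  moreover have "\<forall>\<^sub>F t in nhds b. g (k t) = k (g t)" if b: "b \<in> C" for b
  proof -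
    have "filterlim k (nhds b) (nhds b)"
      using plmap_nhds[OF pl[OF kK], of b] by (simp add: fixC[OF kK b])
    from eventually_compose_filterlim[OF gC[OF b] this] gC[OF b]
    show ?thesis by eventually_elim simp
  qed
  ultimately obtain g' where g': "g' \<in> Q" "\<And>x. g (k x) = k (g x) \<Longrightarrow> g' x = x"
    using commutator_Q[OF gK kK] by blast
  have "E g' \<subseteq> E g"
  proof
    fix b assume b: "b \<in> E g'"
    then obtain y where y: "gap b y" "g' y \<noteq> y" "b \<in> {base..base+1}" by (auto simp: E_def)
    have "\<exists>z. gap b z \<and> g z \<noteq> z"
    proof (rule ccontr)
      assume "\<not> (\<exists>z. gap b z \<and> g z \<noteq> z)"
      then have triv: "\<And>z. gap b z \<Longrightarrow> g z = z" by blast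
      have "k y = y" using triv[OF gap_inv[OF y(1) hi(1)]] by (simp add: k_def hi(2))
      then have "g (k y) = k (g y)" using triv[OF y(1)] by simp
      then show False using g'(2) y(2) by blast
    qed
    then show "b \<in> E g" using y by (simp add: E_def)
  qed
  moreover have "c \<notin> E g'"
  proof
    assume "c \<in> E g'"
    then obtain z where z: "gap c z" "g' z \<noteq> z" by (auto simp: E_def)
    have kS: "h m1 \<le> y" if "gap c y" "k y \<noteq> y" for y
    proof -
      have "g (hi y) \<noteq> hi y" using that(2) unfolding k_def by (metis comp_apply hi(2))
      then have "hi y \<in> S" using gap_inv[OF that(1) hi(1)] by (simp add: S_def)
      then have "h m1 \<le> h (hi y)" using m plmap_le_iff[OF pl[OF h(1)]] by simp
      then show ?thesis by (simp only: hi(2))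
    qed
    have gS: "y \<le> m2" if "gap c y" "g y \<noteq> y" for y using m(2)[of y] that by (simp add: S_def)
    have dis: "g y = y \<or> k y = y" if "gap c y" for y using kS gS h(2) that by force
    have "g (k z) = k (g z)"
    proof (cases "g z = z")
      case False
      then have "k z = z" using dis z by blast
      moreover have "g (g z) \<noteq> g z" using False plmap_eq_iff[OF pl[OF gK]] by simp
      then have "k (g z) = g z" using dis gap_inv[OF z(1) gK] by blast
      ultimately show ?thesis by simp
    next
      case True
      show ?thesis
      proof (cases "k z = z")
        case False
        then have "k (k z) \<noteq> k z" using plmap_eq_iff[OF pl[OF kK]] by simp
        then have "g (k z) = k z" using dis gap_inv[OF z(1) kK] by blast
        then show ?thesis using True by simp
      qed (simp add: True)
    qed
    then show False using g'(2) z by blast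
  qed
  ultimately have "E g' \<subset> E g" using cx(1) by blast
  then have "card (E g') < card (E g)" using finE by (intro psubset_card_mono)
  then show False using min[OF g'(1)] by simp
qed

locale rigid_PL_group =
  fixes G :: "(circle \<Rightarrow> circle) set"
  assumes PL: "f \<in> G \<Longrightarrow> PL_homeo f"
    and lift: "f \<in> G \<Longrightarrow> \<exists>F. lifts F f"
    and comp: "f \<in> G \<Longrightarrow> g \<in> G \<Longrightarrow> f \<circ> g \<in> G"
    and id: "id \<in> G"
    and inverse: "f \<in> G \<Longrightarrow> \<exists>g\<in>G. f \<circ> g = id \<and> g \<circ> f = id"
    and rigid: "conj_rigid G"
begin

text \<open>
  Lifts fixing a given point over \<open>p\<close> multiply like the maps that they lift, so they inherit
  rigidity.
\<close>

theorem common_fixed_point_commute: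
  assumes u: "u \<in> G" "u p = p" and v: "v \<in> G" "v p = p"
  shows "u \<circ> v = v \<circ> u"
proof -
  obtain x0 where x0: "circle_of x0 = p" using circle_of_surj by metis
  obtain U where U: "lifts U u" "U x0 = x0" using lift[OF u(1)] lifts_fixing[of _ u x0] u x0 by metis
  obtain V where V: "lifts V v" "V x0 = x0" using lift[OF v(1)] lifts_fixing[of _ v x0] v x0 by metis
  define C where "C = {x. U x = x \<and> V x = x}"
  define K where "K = {F. (\<exists>f\<in>G. lifts F f) \<and> (\<forall>x\<in>C. F x = x)}"
  have KC: "{x. \<forall>F\<in>K. F x = x} = C"
    using U V u v by (auto simp: K_def C_def)
  have "U \<circ> V = V \<circ> U"
  proof (rule commute_of_common_fixed_point_line[where K = K and base = x0])
    show "plmap F" if "F \<in> K" for F using that by (auto simp: K_def lifts_def)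
    show "F \<circ> F' \<in> K" if FF: "F \<in> K" "F' \<in> K" for F F'
    proof -
      obtain f f' where "f \<in> G" "lifts F f" "f' \<in> G" "lifts F' f'" using FF by (auto simp: K_def)
      then have "\<exists>f\<in>G. lifts (F \<circ> F') f" using comp lifts_comp by blast
      then show ?thesis using FF by (simp add: K_def)
    qed
    show "inv_into UNIV F \<in> K" if FK: "F \<in> K" for F
    proof -
      obtain f where f: "f \<in> G" "lifts F f" using FK by (auto simp: K_def)
      obtain g where g: "g \<in> G" "g \<circ> f = id" using inverse f by blast
      have "inv_into UNIV F x = x" if "x \<in> C" for x
        using FK that plmap_inv_left[OF lifts_plmap[OF f(2)], of x] by (simp add: K_def)
      then show ?thesis using lifts_inv[OF f(2) g(2)] g(1) by (auto simp: K_def)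
    qed
    show "conj_rigid K"
      unfolding conj_rigid_def
    proof (intro ballI impI)
      fix A B D assume K: "A \<in> K" "B \<in> K" "D \<in> K" and eq: "D \<circ> B = B \<circ> A" "A \<circ> D = D \<circ> A"
      obtain a b d where abd: "a \<in> G" "b \<in> G" "d \<in> G" "lifts A a" "lifts B b" "lifts D d"
        using K by (auto simp: K_def)
      have "d \<circ> b = b \<circ> a" "a \<circ> d = d \<circ> a"
        using lifts_determines_map[OF lifts_comp lifts_comp eq(1)] lifts_determines_map[OF lifts_comp lifts_comp eq(2)] abd by blast+
      then have "a \<circ> b = b \<circ> a" using conj_rigidD[OF rigid] abd by blast
      then have "lifts (A \<circ> B) (b \<circ> a)" "lifts (B \<circ> A) (b \<circ> a)" using lifts_comp abd by metis+
      moreover have "(A \<circ> B) x0 = (B \<circ> A) x0" using K U V by (simp add: K_def C_def)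
      ultimately show "A \<circ> B = B \<circ> A" by (rule lifts_unique_fixing)
    qed
    show "U \<in> K" "V \<in> K" using u v U V by (auto simp: K_def C_def)
    show "x \<in> {x. \<forall>F\<in>K. F x = x}" if "U x = x" "V x = x" for x using that KC C_def by auto
    show "x0 \<in> {x. \<forall>F\<in>K. F x = x}" using U V KC C_def by auto
  qed
  then show ?thesis by (rule lifts_determines_map[OF lifts_comp[OF U(1) V(1)] lifts_comp[OF V(1) U(1)]])
qed

end

section \<open>Periodic points of commuting maps\<close>

lemma lifts_funpow: "lifts F f \<Longrightarrow> lifts (F ^^ n) (f ^^ n)"
proof (induction n)
  case 0
  show ?case using lifts_id by (simp add: id_def)
next
  case (Suc n)
  then show ?case unfolding funpow.simps by (intro lifts_comp)
qed

lemma lifts_inj: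
  assumes "lifts F f"
  shows "inj f"
proof (rule injI)
  fix p q assume eq: "f p = f q"
  obtain x y where xy: "p = circle_of x" "q = circle_of y" using circle_of_surj by metis
  have "circle_of (F x) = circle_of (F y)" using assms eq xy by (simp add: lifts_circle_of)
  then obtain k :: int where "F x = F y + of_int k" by (rule circle_of_eq_obtain)
  then have "F x = F (y + of_int k)" using plmap_add_int[OF lifts_plmap[OF assms]] by simp
  then have "x = y + of_int k" using plmap_eq_iff[OF lifts_plmap[OF assms]] by simp
  then show "p = q" using xy by simp
qed

lemma commuting_frontier_fixed_points:
  assumes K: "plmap K" and comm: "\<And>x. K (F x) = F (K x)" and r: "r \<in> frontier {x. F x = x}"
    and F: "plmap F"
  shows "K r \<in> frontier {x. F x = x}"
proof -
  have closed: "closed {x. F x = x}" using F by (rule closed_fixed_points)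
  have iff: "F (K x) = K x \<longleftrightarrow> F x = x" for x
    using comm[of x] plmap_eq_iff[OF K, of "F x" x] by simp
  have "F r = r" using r closed frontier_subset_closed by blast
  then have "K r \<in> {x. F x = x}" using iff[of r] by simp
  then have "K r \<in> closure {x. F x = x}" by (rule subsetD[OF closure_subset])
  moreover have "K r \<notin> interior {x. F x = x}"
  proof
    assume "K r \<in> interior {x. F x = x}"
    moreover have "open (K -` interior {x. F x = x})"
      using K unfolding plmap_def by (intro open_vimage) auto
    moreover have "K -` interior {x. F x = x} \<subseteq> {x. F x = x}"
      using interior_subset[of "{x. F x = x}"] iff by auto
    ultimately have "r \<in> interior {x. F x = x}" by (intro interiorI) auto
    then show False using r by (simp add: frontier_def)
  qed
  ultimately show ?thesis by (simp add: frontier_def)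
qed

text \<open>
  Consecutive integer translates of \<open>r\<close>, which are fixed as well, enclose both \<open>y\<close> and \<open>F y\<close>.
\<close>

lemma lift_displacement_less_one:
  assumes F: "plmap F" and r: "F r = r"
  shows "\<bar>F y - y\<bar> < 1"
proof -
  define n where "n = \<lfloor>y - r\<rfloor>"
  have n: "r + of_int n \<le> y" "y < r + of_int n + 1" unfolding n_def by linarith+
  have "F (r + of_int n) = r + of_int n" using plmap_add_int[OF F, of r n] r by simp
  moreover have "F (r + of_int n + 1) = r + of_int n + 1" using F calculation unfolding plmap_def by metis
  ultimately have "r + of_int n \<le> F y" "F y < r + of_int n + 1"
    using plmap_le_iff[OF F, of "r + of_int n" y] plmap_less_iff[OF F, of y "r + of_int n + 1"] n by auto
  then show ?thesis using n by linarith
qed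

text \<open>
  Lifts of commuting maps commute up to an integer \<open>j\<close>. Evaluated at a fixed point of \<open>F\<close>, this integer
  is a displacement of \<open>F\<close>, so it vanishes.
\<close>

lemma lifts_commute_fixed_point:
  assumes F: "lifts F f" "F r = r" and K: "lifts K k" and comm: "k \<circ> f = f \<circ> k"
  shows "K (F x) = F (K x)"
proof -
  have "lifts (K \<circ> F) (k \<circ> f)" "lifts (F \<circ> K) (k \<circ> f)" using lifts_comp F K comm by metis+
  then obtain j :: int where j: "\<And>x. (K \<circ> F) x = (F \<circ> K) x + of_int j" using lifts_unique by blast
  have "K r = F (K r) + of_int j" using j[of r] F by simp
  then have "\<bar>of_int j\<bar> < (1::real)" using lift_displacement_less_one[OF lifts_plmap[OF F(1)] F(2), of "K r"] by simp
  then have "j = 0" by linarith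
  then show ?thesis using j[of x] by simp
qed

text \<open>
  The boundary of the fixed point set of \<open>f\<close> is finite modulo one, it is not empty because the line is
  connected, and it is preserved by everything that commutes with \<open>f\<close>. One point \<open>p\<close> of it serves all
  commuting maps.
\<close>

lemma commuting_periodic_point:
  assumes F0: "lifts F0 f" and nt: "f \<noteq> id" and p0: "f p0 = p0"
  obtains p where "f p = p"
    "\<And>K k. lifts K k \<Longrightarrow> k \<circ> f = f \<circ> k \<Longrightarrow> \<exists>N\<ge>1. (k ^^ N) p = p"
proof -
  obtain r0 where r0: "p0 = circle_of r0" using circle_of_surj by metis
  obtain F where F: "lifts F f" "F r0 = r0" using lifts_fixing[OF F0, of r0] p0 r0 by blast
  note plF = lifts_plmap[OF F(1)]
  have "{x. F x = x} \<noteq> UNIV"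
  proof
    assume "{x. F x = x} = UNIV"
    then have "F = id" by (auto simp: fun_eq_iff)
    then have "f = id" using lifts_determines_map[OF F(1) lifts_id] by (simp add: id_def)
    then show False using nt by simp
  qed
  then have "frontier {x. F x = x} \<noteq> {}" using F(2) frontier_eq_empty[of "{x. F x = x}"] by auto
  then obtain r where r: "r \<in> frontier {x. F x = x}" by blast
  have Fr: "F r = r" using r closed_fixed_points[OF plF] frontier_subset_closed by blast
  define T where "T = circle_of ` (frontier {x. F x = x} \<inter> {0..1})"
  have finT: "finite T" unfolding T_def using finite_frontier_fixed_points[OF plF] by simp
  have T: "circle_of y \<in> T" if "y \<in> frontier {x. F x = x}" for y
  proof -
    have "y + of_int (- \<lfloor>y\<rfloor>) \<in> frontier {x. F x = x}"
      by (rule commuting_frontier_fixed_points[OF plmap_shift _ that plF])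
        (simp only: plmap_add_int[OF plF])
    moreover have "y + of_int (- \<lfloor>y\<rfloor>) \<in> {0..1}" by auto linarith+
    ultimately have "circle_of (y + of_int (- \<lfloor>y\<rfloor>)) \<in> T" unfolding T_def by blast
    then show ?thesis by (simp only: circle_of_add_int)
  qed
  show ?thesis
  proof (rule that)
    show "f (circle_of r) = circle_of r" using lifts_circle_of[OF F(1), of r] Fr by simp
    fix K k assume K: "lifts K k" and comm: "k \<circ> f = f \<circ> k"
    have "(K ^^ n) r \<in> frontier {x. F x = x}" for n
    proof (induction n)
      case (Suc n)
      then show ?case
        using commuting_frontier_fixed_points[OF lifts_plmap[OF K] lifts_commute_fixed_point[OF F(1) Fr K comm] _ plF]
        by simp
    qed (simp add: r)
    then have "(k ^^ n) (circle_of r) \<in> T" for n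
      using T lifts_circle_of[OF lifts_funpow[OF K], of n r] by metis
    then have "range (\<lambda>n. (k ^^ n) (circle_of r)) \<subseteq> T" by auto
    then have "\<not> inj (\<lambda>n. (k ^^ n) (circle_of r))"
      using finT finite_subset finite_imageD infinite_UNIV_nat by blast
    then obtain m n where mn: "m \<noteq> n" "(k ^^ m) (circle_of r) = (k ^^ n) (circle_of r)"
      unfolding inj_def by blast
    have *: "\<exists>N\<ge>1. (k ^^ N) (circle_of r) = circle_of r"
      if "m < n" "(k ^^ m) (circle_of r) = (k ^^ n) (circle_of r)" for m n
    proof -
      have "(k ^^ m) ((k ^^ (n - m)) (circle_of r)) = (k ^^ (m + (n - m))) (circle_of r)"
        by (simp only: funpow_add comp_apply)
      also have "\<dots> = (k ^^ m) (circle_of r)" using that by simp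
      finally have "(k ^^ (n - m)) (circle_of r) = circle_of r"
        using lifts_inj[OF lifts_funpow[OF K]] injD by metis
      then show ?thesis using that(1) by (intro exI[of _ "n - m"]) simp
    qed
    show "\<exists>N\<ge>1. (k ^^ N) (circle_of r) = circle_of r"
    proof (cases "m < n")
      case True
      then show ?thesis using * mn(2) by blast
    next
      case False
      then have "n < m" using mn(1) by simp
      then show ?thesis using * mn(2) by metis
    qed
  qed
qed

section \<open>Free actions on the line\<close>

lemma plmap_funpow_le: "plmap c \<Longrightarrow> x \<le> y \<Longrightarrow> (c ^^ n) x \<le> (c ^^ n) y"
  by (induction n) (simp_all add: plmap_le_iff)

text \<open>
  Hoelder's theorem. By freeness, comparing two elements at one point or at all points is the same, so
  the group is ordered, and it is Archimedean since a bounded orbit would converge to a fixed point. If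
  there is a least positive element, it generates the group. Otherwise there are positive \<open>c\<close> with
  \<open>c\<^sup>2\<close> below any given positive commutator of two positive elements, whereas squeezing these elements
  between consecutive powers of \<open>c\<close> shows that their two products differ by less than \<open>c\<^sup>2\<close>.
\<close>

theorem free_action_on_line_commutative:
  assumes pl: "\<And>F. F \<in> \<Lambda> \<Longrightarrow> plmap F"
    and comp: "\<And>F G. F \<in> \<Lambda> \<Longrightarrow> G \<in> \<Lambda> \<Longrightarrow> F \<circ> G \<in> \<Lambda>"
    and inv: "\<And>F. F \<in> \<Lambda> \<Longrightarrow> inv_into UNIV F \<in> \<Lambda>"
    and shift: "\<And>k::int. (\<lambda>x. x + of_int k) \<in> \<Lambda>"
    and free: "\<And>F x. F \<in> \<Lambda> \<Longrightarrow> F x = x \<Longrightarrow> F = id"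
    and A: "A \<in> \<Lambda>" and B: "B \<in> \<Lambda>"
  shows "A \<circ> B = B \<circ> A"
proof -
  have id: "id \<in> \<Lambda>" using shift[of 0] by (simp add: id_def)
  have eqI: "F = H" if F: "F \<in> \<Lambda>" "H \<in> \<Lambda>" "F x = H x" for F H x
  proof -
    have "(inv_into UNIV H \<circ> F) x = x" using F(3) plmap_inv_left[OF pl[OF F(2)], of x] by simp
    then have *: "inv_into UNIV H \<circ> F = id" by (rule free[OF comp[OF inv[OF F(2)] F(1)]])
    have "F y = H y" for y
      using fun_cong[OF *, of y] plmap_inv_right[OF pl[OF F(2)], of "F y"] by simp
    then show ?thesis by blast
  qed
  have less: "F x < H x" if F: "F \<in> \<Lambda>" "H \<in> \<Lambda>" "F y < H y" for F H x y
  proof (rule ccontr)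
    assume "\<not> F x < H x"
    then have le: "H x - F x \<le> 0" "0 \<le> H y - F y" using F(3) by simp_all
    have "continuous_on UNIV (\<lambda>t. H t - F t)"
      using pl[OF F(1)] pl[OF F(2)] unfolding plmap_def by (intro continuous_on_diff) auto
    then obtain z where "H z - F z = 0" using zero_between le by blast
    then have "F z = H z" by simp
    then have "F = H" using eqI F by blast
    then show False using F(3) by simp
  qed
  have le: "F x \<le> H x" if "F \<in> \<Lambda>" "H \<in> \<Lambda>" "F y \<le> H y" for F H x y
  proof (cases "F y = H y")
    case True
    then show ?thesis using eqI[of F H y] that by simp
  next
    case False
    then show ?thesis using less[of F H y x] that by simp
  qed
  define P where "P = {F\<in>\<Lambda>. F 0 > 0}"
  have powL: "c ^^ n \<in> \<Lambda>" if "c \<in> \<Lambda>" for c n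
    using that by (induction n) (auto simp: id comp)
  have PL: "c \<in> \<Lambda>" if "c \<in> P" for c using that by (simp add: P_def)
  have gt: "c x > x" if "c \<in> P" for c x
    using less[OF id, of c 0 x] that by (simp add: P_def)
  have arch: "\<exists>n. x < (c ^^ n) 0" if c: "c \<in> P" for c x
    using orbit_exceeds[OF pl[OF PL[OF c]], of 0 x] gt[OF c] by blast
  have bracket: "\<exists>n. (c ^^ n) 0 \<le> F 0 \<and> F 0 < (c ^^ Suc n) 0" if c: "c \<in> P" and F: "F 0 \<ge> 0" for c and F :: "real \<Rightarrow> real"
  proof -
    define n where "n = (LEAST n. F 0 < (c ^^ n) 0)"
    have n: "F 0 < (c ^^ n) 0" unfolding n_def using arch[OF c] by (rule LeastI_ex)
    then have "n \<noteq> 0" using F by (cases n) auto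
    then obtain m where m: "n = Suc m" by (cases n) auto
    then have "\<not> F 0 < (c ^^ m) 0" using not_less_Least[of m "\<lambda>n. F 0 < (c ^^ n) 0"] by (simp add: n_def)
    then show ?thesis using n m by (intro exI[of _ m]) simp
  qed
  have pos: "F \<circ> H = H \<circ> F" if F: "F \<in> \<Lambda>" "F 0 \<ge> 0" and H: "H \<in> \<Lambda>" "H 0 \<ge> 0" for F H
  proof (cases "\<exists>c\<in>P. \<forall>E\<in>P. c 0 \<le> E 0")
    case True
    then obtain c where c: "c \<in> P" "\<And>E. E \<in> P \<Longrightarrow> c 0 \<le> E 0" by blast
    have power: "\<exists>n. F = c ^^ n" if F: "F \<in> \<Lambda>" "F 0 \<ge> 0" for F
    proof -
      obtain n where n: "(c ^^ n) 0 \<le> F 0" "F 0 < (c ^^ Suc n) 0" using bracket[OF c(1), of F] F by blast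
      define D where "D = inv_into UNIV (c ^^ n)"
      have D: "D \<in> \<Lambda>" unfolding D_def using powL PL c(1) inv by blast
      have Dc: "D ((c ^^ n) x) = x" for x unfolding D_def using plmap_inv_left pl powL PL c(1) by blast
      have "0 \<le> D (F 0)" using n(1) plmap_le_iff[OF pl[OF D], of "(c ^^ n) 0" "F 0"] Dc by simp
      moreover have "F 0 < (c ^^ n) (c 0)" using n(2) by (simp add: funpow_swap1)
      then have "D (F 0) < c 0"
        using plmap_less_iff[OF pl[OF D], of "F 0" "(c ^^ n) (c 0)"] Dc by simp
      moreover have "D \<circ> F \<in> \<Lambda>" using D F comp by blast
      ultimately have "D (F 0) = 0" using c(2)[of "D \<circ> F"] by (force simp: P_def)
      then have "D (F 0) = D ((c ^^ n) 0)" using Dc by simp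
      then have "F 0 = (c ^^ n) 0" using plmap_eq_iff[OF pl[OF D]] by blast
      then show ?thesis using eqI[of F "c ^^ n" 0] F powL PL c(1) by blast
    qed
    obtain m n where "F = c ^^ m" "H = c ^^ n" using power F H by blast
    then show ?thesis by (metis add.commute funpow_add)
  next
    case False
    have nl: "\<not> H (F 0) < F (H 0)" if F: "F \<in> \<Lambda>" "F 0 \<ge> 0" and H: "H \<in> \<Lambda>" "H 0 \<ge> 0" for F H
    proof
      assume lt: "H (F 0) < F (H 0)"
      define D where "D = (F \<circ> H) \<circ> inv_into UNIV (H \<circ> F)"
      have HF: "H \<circ> F \<in> \<Lambda>" using comp F H by blast
      have D: "D \<in> \<Lambda>" unfolding D_def using comp inv F H by blast
      have Deq: "D (H (F x)) = F (H x)" for x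
        using plmap_inv_left[OF pl[OF HF], of x] by (simp add: D_def)
      have "D (H (F 0)) > id (H (F 0))" using lt Deq by simp
      then have DP: "D \<in> P" using less[OF id D, of _ 0] D by (simp add: P_def)
      then obtain e where e: "e \<in> P" "e 0 < D 0" using False by (metis linorder_not_le)
      (* If e is positive, below D and its square exceeds D, then the quotient of D by e does the job. *)
      have "\<exists>c\<in>P. c (c 0) \<le> D 0"
      proof (cases "e (e 0) \<le> D 0")
        case True
        then show ?thesis using e by blast
      next
        case False
        define c where "c = inv_into UNIV e \<circ> D"
        have ec: "e (c x) = D x" for x unfolding c_def using plmap_inv_right[OF pl[OF PL[OF e(1)]]] by simp
        have cL: "c \<in> \<Lambda>" unfolding c_def using comp inv D e PL by blast
        have "e 0 < e (c 0)" using ec e by simp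
        then have c0: "0 < c 0" using plmap_less_iff[OF pl[OF PL[OF e(1)]]] by blast
        have "e (c 0) < e (e 0)" using ec False by simp
        then have "c 0 < e 0" using plmap_less_iff[OF pl[OF PL[OF e(1)]]] by blast
        then have "c (c 0) \<le> e (c 0)" using less[OF cL PL[OF e(1)], of 0] by (simp add: less_imp_le)
        then show ?thesis using c0 cL ec by (auto simp: P_def)
      qed
      then obtain c where c: "c \<in> P" "c (c 0) \<le> D 0" by blast
      have cc: "c (c x) \<le> D x" for x
        using le[of "c \<circ> c" D 0 x] c PL comp D by simp
      obtain m where m: "(c ^^ m) 0 \<le> F 0" "F 0 < (c ^^ Suc m) 0" using bracket[OF c(1), of F] F by blast
      obtain n where n: "(c ^^ n) 0 \<le> H 0" "H 0 < (c ^^ Suc n) 0" using bracket[OF c(1), of H] H by blast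
      have cL: "c ^^ i \<in> \<Lambda>" for i using powL PL c(1) by blast
      have "F (H 0) < (c ^^ Suc m) (H 0)" using less[OF F(1) cL m(2)] .
      also have "\<dots> \<le> (c ^^ Suc m) ((c ^^ Suc n) 0)"
        using n(2) plmap_funpow_le[OF pl[OF PL[OF c(1)]]] by (simp only: less_imp_le)
      also have "\<dots> = (c ^^ (Suc m + Suc n)) 0" by (simp only: funpow_add comp_apply)
      also have "\<dots> = (c ^^ (2 + n + m)) 0" by (simp add: add.commute)
      also have "\<dots> = (c ^^ 2) ((c ^^ n) ((c ^^ m) 0))" by (simp only: funpow_add comp_apply)
      also have "\<dots> \<le> (c ^^ 2) ((c ^^ n) (F 0))"
        using m(1) plmap_funpow_le[OF pl[OF PL[OF c(1)]]] by simp
      also have "\<dots> \<le> (c ^^ 2) (H (F 0))"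
        using le[OF cL H(1) n(1), of "F 0"] plmap_funpow_le[OF pl[OF PL[OF c(1)]]] by simp
      also have "\<dots> \<le> D (H (F 0))" using cc by (simp add: numeral_2_eq_2)
      finally show False using Deq by simp
    qed
    have "H (F 0) = F (H 0)" using nl[OF F H] nl[OF H F] by simp
    then show ?thesis using eqI[of "F \<circ> H" "H \<circ> F" 0] comp F H by simp
  qed
  (* Integer translations are central, so A and B may be assumed positive. *)
  define A' where "A' = (\<lambda>x. A x + of_int \<lceil>- A 0\<rceil>)"
  define B' where "B' = (\<lambda>x. B x + of_int \<lceil>- B 0\<rceil>)"
  have "A' \<in> \<Lambda>" using comp[OF shift A, of "\<lceil>- A 0\<rceil>"] by (simp add: A'_def comp_def)
  moreover have "B' \<in> \<Lambda>" using comp[OF shift B, of "\<lceil>- B 0\<rceil>"] by (simp add: B'_def comp_def)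
  moreover have "A' 0 \<ge> 0" "B' 0 \<ge> 0" unfolding A'_def B'_def by linarith+
  ultimately have *: "A' \<circ> B' = B' \<circ> A'" using pos by blast
  have "A (B x) = B (A x)" for x
    using fun_cong[OF *, of x] unfolding A'_def B'_def
    by (simp add: plmap_add_int[OF pl[OF A]] plmap_add_int[OF pl[OF B]] del: of_int_minus of_int_ceiling)
  then show ?thesis by auto
qed

section \<open>Groups centralised by an element of infinite order\<close>

context rigid_PL_group
begin

lemma funpow_mem: "f \<in> G \<Longrightarrow> f ^^ n \<in> G"
  by (induction n) (auto simp: id comp)

text \<open>
  Either a power of \<open>z\<close> has a fixed point, and then powers of \<open>a\<close> and \<open>b\<close> share one; or no nontrivial
  element of \<open>G\<close> can have a fixed point, since \<open>z\<close> would permute the boundary points of its fixed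
  point set, and then Hoelder's theorem applies.
\<close>

theorem central_element_commute:
  assumes a: "a \<in> G" and b: "b \<in> G" and z: "lifts Z z" and comm: "\<And>g. g \<in> G \<Longrightarrow> z \<circ> g = g \<circ> z"
    and inf: "\<And>N. N \<ge> 1 \<Longrightarrow> z ^^ N \<noteq> id"
  shows "\<exists>M\<ge>1. \<exists>N\<ge>1. (a ^^ M) \<circ> (b ^^ N) = (b ^^ N) \<circ> (a ^^ M)"
proof (cases "\<exists>N\<ge>1. \<exists>p. (z ^^ N) p = p")
  case True
  then obtain N p0 where N: "N \<ge> 1" "(z ^^ N) p0 = p0" by blast
  obtain p where p: "\<And>K k. lifts K k \<Longrightarrow> k \<circ> z ^^ N = z ^^ N \<circ> k \<Longrightarrow> \<exists>N\<ge>1. (k ^^ N) p = p"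
    using commuting_periodic_point[OF lifts_funpow[OF z] inf[OF N(1)] N(2)] by blast
  have zN: "g \<circ> z ^^ N = z ^^ N \<circ> g" if "g \<in> G" for g
  proof (induction N)
    case (Suc n)
    have "g \<circ> z ^^ Suc n = (g \<circ> z) \<circ> z ^^ n" by (simp add: comp_assoc)
    also have "\<dots> = z \<circ> (g \<circ> z ^^ n)" by (simp only: comm[OF that, symmetric] comp_assoc)
    also have "\<dots> = z ^^ Suc n \<circ> g" by (simp only: Suc comp_assoc funpow.simps)
    finally show ?case .
  qed simp
  obtain M where "M \<ge> 1" "(a ^^ M) p = p" using p lift[OF a] zN[OF a] by blast
  moreover obtain M' where "M' \<ge> 1" "(b ^^ M') p = p" using p lift[OF b] zN[OF b] by blast
  ultimately show ?thesis
    using common_fixed_point_commute funpow_mem a b by blast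
next
  case False
  have free: "g = id" if g: "g \<in> G" "g p = p" for g p
  proof (rule ccontr)
    assume "g \<noteq> id"
    moreover obtain F where "lifts F g" using lift[OF g(1)] by blast
    ultimately obtain q where "\<exists>N\<ge>1. (z ^^ N) q = q"
      using commuting_periodic_point[of F g p] g z comm by metis
    then show False using False by blast
  qed
  define \<Lambda> where "\<Lambda> = {F. \<exists>g\<in>G. lifts F g}"
  obtain A B where AB: "lifts A a" "lifts B b" using lift a b by metis
  have "A \<circ> B = B \<circ> A"
  proof (rule free_action_on_line_commutative[where \<Lambda> = \<Lambda>])
    show "plmap F" if "F \<in> \<Lambda>" for F using that lifts_plmap by (auto simp: \<Lambda>_def)
    show "F \<circ> H \<in> \<Lambda>" if "F \<in> \<Lambda>" "H \<in> \<Lambda>" for F H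
      using that comp lifts_comp unfolding \<Lambda>_def by blast
    show "inv_into UNIV F \<in> \<Lambda>" if "F \<in> \<Lambda>" for F
      using that inverse lifts_inv unfolding \<Lambda>_def by blast
    show "(\<lambda>x. x + of_int k) \<in> \<Lambda>" for k :: int
      using lifts_shift[OF lifts_id] id unfolding \<Lambda>_def by blast
    show "F = id" if F: "F \<in> \<Lambda>" "F x = x" for F x
    proof -
      obtain g where g: "g \<in> G" "lifts F g" using F(1) by (auto simp: \<Lambda>_def)
      then have "g (circle_of x) = circle_of x" using F(2) lifts_circle_of by metis
      then have "g = id" using free g by blast
      then show ?thesis using lifts_unique_fixing[OF g(2), of "\<lambda>x. x" x] lifts_id F(2) by auto
    qed
    show "A \<in> \<Lambda>" "B \<in> \<Lambda>" using AB a b by (auto simp: \<Lambda>_def)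
  qed
  then have "a \<circ> b = b \<circ> a" by (rule lifts_determines_map[OF lifts_comp[OF AB] lifts_comp[OF AB(2,1)]])
  then have "(a ^^ 1) \<circ> (b ^^ 1) = (b ^^ 1) \<circ> (a ^^ 1)" by simp
  then show ?thesis by blast
qed

end

section \<open>Break points of free actions of \<open>\<int>\<^sup>2\<close>\<close>

locale Z2_action =
  fixes R :: "int \<Rightarrow> int \<Rightarrow> circle \<Rightarrow> circle"
  assumes R_PL: "PL_homeo (R m n)"
    and R_lift: "\<exists>F. lifts F (R m n)"
    and R_add: "R m n \<circ> R m' n' = R (m + m') (n + n')"
    and R_zero: "R 0 0 = id"
begin

lemma R_R: "R m n (R m' n' p) = R (m + m') (n + n') p"
  using fun_cong[OF R_add, of m n m' n' p] by simp

lemma R_id: "R 0 0 p = p" by (simp add: R_zero)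

lemma affine_trans:
  "locally_affine_at (R m n) p \<Longrightarrow> locally_affine_at (R m' n') (R m n p) \<Longrightarrow>
     locally_affine_at (R (m + m') (n + n')) p"
  using locally_affine_at_comp[of "R m n" p "R m' n'"] by (simp add: R_add add.commute)

lemma affine_sym:
  "locally_affine_at (R m n) p \<Longrightarrow> locally_affine_at (R (- m) (- n)) (R m n p)"
  by (rule locally_affine_at_inverse) (simp_all add: R_R R_id)

lemma affine_row:
  assumes B: "\<And>p. p \<notin> B \<Longrightarrow> locally_affine_at (R 1 0) p" and p: "\<And>k. R k 0 p \<notin> B"
  shows "locally_affine_at (R k 0) p"
proof -
  have nat: "locally_affine_at (R (int n) 0) q" if q: "\<And>k. R k 0 q \<notin> B" for n q
  proof (induction n)
    case 0
    show ?case by (simp only: R_zero of_nat_0 locally_affine_at_id)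
  next
    case (Suc n)
    show ?case using affine_trans[OF Suc B[OF q]] by (simp add: add.commute)
  qed
  show ?thesis
  proof (cases "k \<ge> 0")
    case True
    then show ?thesis using nat[OF p, of "nat k"] by simp
  next
    case False
    have "locally_affine_at (R (int (nat (- k))) 0) (R k 0 p)"
      by (rule nat) (use p in \<open>simp add: R_R\<close>)
    then have "locally_affine_at (R (- k) 0) (R k 0 p)" using False by simp
    from affine_sym[OF this] show ?thesis using R_R[of "- k" 0 k 0 p] by (simp add: R_id)
  qed
qed

lemma swap: "Z2_action (\<lambda>m n. R n m)"
  by unfold_locales (simp_all add: R_PL R_lift R_add R_zero)

text \<open>
  Think of the orbit of \<open>p\<close> as the grid \<open>\<int>\<^sup>2\<close>, in which an edge is broken if it starts in \<open>B\<close>. Two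
  rows that avoid \<open>B\<close> are joined by a column that avoids \<open>B\<close>: by freeness different columns are
  disjoint, and \<open>B\<close> is finite.
\<close>

lemma affine_between_clear_rows:
  assumes B: "finite B" "\<And>p. p \<notin> B \<Longrightarrow> locally_affine_at (R 1 0) p" "\<And>p. p \<notin> B \<Longrightarrow> locally_affine_at (R 0 1) p"
    and free: "\<And>m n. R m n p = p \<Longrightarrow> m = 0 \<and> n = 0"
    and p: "\<And>k. R k 0 p \<notin> B" and q: "\<And>k. R (k + m) n p \<notin> B"
  shows "locally_affine_at (R m n) p"
proof -
  have inj: "m = m' \<and> n = n'" if "R m n p = R m' n' p" for m n m' n'
  proof -
    have "R (m - m') (n - n') p = R (- m') (- n') (R m n p)" by (simp add: R_R)
    also have "\<dots> = p" unfolding that by (simp add: R_R R_id)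
    finally show ?thesis using free by fastforce
  qed
  have "\<exists>M. \<forall>k. R M k p \<notin> B"
  proof (rule ccontr)
    assume "\<not> (\<exists>M. \<forall>k. R M k p \<notin> B)"
    then have "\<forall>M. \<exists>k. R M k p \<in> B" by simp
    then obtain k where k: "\<And>M. R M (k M) p \<in> B" by metis
    have "inj (\<lambda>M. R M (k M) p)" by (rule injI) (use inj in blast)
    moreover have "range (\<lambda>M. R M (k M) p) \<subseteq> B" using k by auto
    ultimately show False using B(1) finite_subset finite_imageD infinite_UNIV_int by blast
  qed
  then obtain M where M: "\<And>k. R M k p \<notin> B" by blast
  interpret sw: Z2_action "\<lambda>m n. R n m" by (rule swap)
  have 1: "locally_affine_at (R M 0) p" by (rule affine_row[OF B(2) p])
  have 2: "locally_affine_at (R 0 n) (R M 0 p)"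
  proof (rule sw.affine_row[OF B(3)])
    fix k show "R 0 k (R M 0 p) \<notin> B" using M[of k] by (simp add: R_R)
  qed
  have 3: "locally_affine_at (R (m - M) 0) (R M n p)"
  proof (rule affine_row[OF B(2)])
    fix k show "R k 0 (R M n p) \<notin> B" using q[of "k + M - m"] by (simp add: R_R)
  qed
  have "locally_affine_at (R M n) p" using affine_trans[OF 1 2] by simp
  from affine_trans[OF this 3] show ?thesis by simp
qed

text \<open>
  One-endedness of \<open>\<int>\<^sup>2\<close>. The set \<open>D\<close> consists of the points whose row and whose column both meet the
  set \<open>B\<close> of broken points; it is finite because a point is determined by one element of \<open>B\<close> in its
  row and one in its column. Two points of an orbit outside \<open>D\<close> are joined by a path in the
  grid along unbroken edges, and since the action is commutative the path realises the given element.
\<close>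

theorem finitely_many_breaks:
  assumes inv: "\<And>p m n. p \<in> X \<Longrightarrow> R m n p \<in> X"
    and free: "\<And>p m n. p \<in> X \<Longrightarrow> R m n p = p \<Longrightarrow> m = 0 \<and> n = 0"
  shows "\<exists>D. finite D \<and>
    (\<forall>p\<in>X. \<forall>m n. p \<notin> D \<longrightarrow> R m n p \<notin> D \<longrightarrow> locally_affine_at (R m n) p)"
proof -
  obtain A1 where A1: "finite A1" "\<And>p. p \<notin> A1 \<Longrightarrow> locally_affine_at (R 1 0) p"
    using R_PL[of 1 0] unfolding PL_homeo_def by blast
  obtain A2 where A2: "finite A2" "\<And>p. p \<notin> A2 \<Longrightarrow> locally_affine_at (R 0 1) p"
    using R_PL[of 0 1] unfolding PL_homeo_def by blast
  define B where "B = A1 \<union> A2"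
  have B: "finite B" "\<And>p. p \<notin> B \<Longrightarrow> locally_affine_at (R 1 0) p" "\<And>p. p \<notin> B \<Longrightarrow> locally_affine_at (R 0 1) p"
    using A1 A2 by (auto simp: B_def)
  interpret sw: Z2_action "\<lambda>m n. R n m" by (rule swap)
  define D where "D = {p\<in>X. (\<exists>k. R k 0 p \<in> B) \<and> (\<exists>k. R 0 k p \<in> B)}"
  have "\<forall>p\<in>D. \<exists>k l. R k 0 p \<in> B \<and> R 0 l p \<in> B" by (auto simp: D_def)
  then obtain k l where kl: "\<And>p. p \<in> D \<Longrightarrow> R (k p) 0 p \<in> B" "\<And>p. p \<in> D \<Longrightarrow> R 0 (l p) p \<in> B" by metis
  have "inj_on (\<lambda>p. (R (k p) 0 p, R 0 (l p) p)) D"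
  proof (rule inj_onI)
    fix p p' assume p: "p \<in> D" "p' \<in> D" and "(R (k p) 0 p, R 0 (l p) p) = (R (k p') 0 p', R 0 (l p') p')"
    then have eq: "R (k p) 0 p = R (k p') 0 p'" "R 0 (l p) p = R 0 (l p') p'" by auto
    have 1: "p' = R (- k p') 0 (R (k p') 0 p')" by (simp add: R_R R_id)
    have "p' = R (k p - k p') 0 p" by (subst 1, subst eq(1)[symmetric]) (simp add: R_R)
    moreover have 2: "p' = R 0 (- l p') (R 0 (l p') p')" by (simp add: R_R R_id)
    have "p' = R 0 (l p - l p') p" by (subst 2, subst eq(2)[symmetric]) (simp add: R_R)
    ultimately have "R (k p - k p') 0 p = R 0 (l p - l p') p" by simp
    then have "R 0 (l p' - l p) (R (k p - k p') 0 p) = R 0 (l p' - l p) (R 0 (l p - l p') p)" by simp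
    then have "R (k p - k p') (l p' - l p) p = p" by (simp add: R_R R_id)
    then have "k p - k p' = 0 \<and> l p' - l p = 0"
      by (rule free[rotated]) (use p in \<open>simp add: D_def\<close>)
    then have "k p - k p' = 0" ..
    then show "p = p'" using \<open>p' = R (k p - k p') 0 p\<close> by (simp add: R_id)
  qed
  moreover have "(\<lambda>p. (R (k p) 0 p, R 0 (l p) p)) ` D \<subseteq> B \<times> B" using kl by auto
  then have "finite ((\<lambda>p. (R (k p) 0 p, R 0 (l p) p)) ` D)"
    by (rule finite_subset) (simp add: B(1))
  ultimately have "finite D" by (blast intro: finite_imageD)
  moreover have "locally_affine_at (R m n) p" if p: "p \<in> X" "p \<notin> D" and q: "R m n p \<notin> D" for p m n
  proof -
    have fr: "m = 0 \<and> n = 0" if "R m n p = p" for m n using free p(1) that by blast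
    then have fr': "n = 0 \<and> m = 0" if "R m n p = p" for m n using that by blast
    from p have "(\<forall>k. R k 0 p \<notin> B) \<or> (\<forall>k. R 0 k p \<notin> B)" by (auto simp: D_def)
    moreover have "(\<forall>k. R (k + m) n p \<notin> B) \<or> (\<forall>k. R m (k + n) p \<notin> B)"
      using q inv[OF p(1), of m n] by (auto simp: D_def R_R)
    ultimately consider
        (hh) "\<And>k. R k 0 p \<notin> B" "\<And>k. R (k + m) n p \<notin> B"
      | (vv) "\<And>k. R 0 k p \<notin> B" "\<And>k. R m (k + n) p \<notin> B"
      | (hv) "\<And>k. R k 0 p \<notin> B" "\<And>k. R m (k + n) p \<notin> B"
      | (vh) "\<And>k. R 0 k p \<notin> B" "\<And>k. R (k + m) n p \<notin> B"
      by blast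
    then show ?thesis
    proof cases
      case hh
      show ?thesis by (rule affine_between_clear_rows[OF B fr hh])
    next
      case vv
      show ?thesis by (rule sw.affine_between_clear_rows[OF B(1,3,2) fr' vv])
    next
      case hv
      have 1: "locally_affine_at (R m 0) p" by (rule affine_row[OF B(2) hv(1)])
      have "locally_affine_at (R 0 n) (R m 0 p)"
      proof (rule sw.affine_row[OF B(3)])
        fix k show "R 0 k (R m 0 p) \<notin> B" using hv(2)[of "k - n"] by (simp add: R_R)
      qed
      from affine_trans[OF 1 this] show ?thesis by simp
    next
      case vh
      have 1: "locally_affine_at (R 0 n) p" by (rule sw.affine_row[OF B(3) vh(1)])
      have "locally_affine_at (R m 0) (R 0 n p)"
      proof (rule affine_row[OF B(2)])
        fix k show "R k 0 (R 0 n p) \<notin> B" using vh(2)[of "k - m"] by (simp add: R_R)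
      qed
      from affine_trans[OF 1 this] show ?thesis by simp
    qed
  qed
  ultimately show ?thesis by blast
qed

end

text \<open>
  The largest element that moves up would be mapped to a still larger one.
\<close>

lemma strict_mono_finite_invariant:
  fixes F :: "'a::linorder \<Rightarrow> 'a"
  assumes "strict_mono F" "finite S" "F ` S \<subseteq> S" "r \<in> S"
  shows "F r = r"
proof (rule ccontr)
  assume "F r \<noteq> r"
  then consider "F r > r" | "F r < r" by fastforce
  then show False
  proof cases
    case 1
    define T where "T = {x\<in>S. F x > x}"
    have T: "finite T" "T \<noteq> {}" using 1 assms by (auto simp: T_def)
    then have "Max T \<in> T" by simp
    then have "F (Max T) \<in> T" "Max T < F (Max T)"
      using assms strict_monoD[OF assms(1)] by (auto simp: T_def)
    then show False using T(1) Max_ge leD by blast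
  next
    case 2
    define T where "T = {x\<in>S. F x < x}"
    have T: "finite T" "T \<noteq> {}" using 2 assms by (auto simp: T_def)
    then have "Min T \<in> T" by simp
    then have "F (Min T) \<in> T" "F (Min T) < Min T"
      using assms strict_monoD[OF assms(1)] by (auto simp: T_def)
    then show False using T(1) Min_le leD by blast
  qed
qed

section \<open>Actions of \<open>\<int>\<^sup>2\<close> with a global fixed point\<close>

context Z2_action
begin

lemma lift_family:
  assumes fixes_p: "\<And>m n. R m n (circle_of x0) = circle_of x0"
  obtains L where "\<And>m n. lifts (L m n) (R m n)" "\<And>m n. L m n x0 = x0"
    "\<And>m n m' n'. L m n \<circ> L m' n' = L (m + m') (n + n')" "L 0 0 = id"
proof -
  have "\<exists>F. lifts F (R m n) \<and> F x0 = x0" for m n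
    using R_lift[of m n] lifts_fixing[of _ "R m n" x0] fixes_p by metis
  then obtain L where L: "\<And>m n. lifts (L m n) (R m n)" "\<And>m n. L m n x0 = x0" by metis
  have "L m n \<circ> L m' n' = L (m + m') (n + n')" for m n m' n'
  proof (rule lifts_unique_fixing[where x = x0])
    show "lifts (L m n \<circ> L m' n') (R (m + m') (n + n'))"
      using lifts_comp[OF L(1) L(1), of m n m' n'] by (simp add: R_add)
  qed (simp_all add: L)
  moreover have "L 0 0 = (\<lambda>x. x)"
    by (rule lifts_unique_fixing[OF _ lifts_id, where x = x0])
      (use L(1)[of 0 0] L(2)[of 0 0] in \<open>simp_all add: R_zero\<close>)
  then have "L 0 0 = id" by (simp add: id_def)
  ultimately show ?thesis using that L by blast
qed

text \<open>
  Let \<open>F\<close> move points up. A large power \<open>H\<close> of \<open>F\<close> takes an interval near \<open>c\<close> to one near \<open>d\<close>, and neither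
  meets \<open>D\<close>. So \<open>H\<close>, which commutes with \<open>F\<close>, is affine on the first interval, and comparing
  the orbit segment \<open>x0\<close>, \<open>F x0\<close>, \<open>F (F x0)\<close> with its image shows that the slope \<open>a\<close> of \<open>F\<close> at \<open>c\<close>
  equals its slope \<open>b\<close> at \<open>d\<close>. Moving up means \<open>a > 1\<close> and \<open>b < 1\<close>.
\<close>

lemma no_free_action_on_interval:
  assumes L: "\<And>m n. lifts (L m n) (R m n)"
    and L_add: "\<And>m n m' n'. L m n \<circ> L m' n' = L (m + m') (n + n')" and L_zero: "L 0 0 = id"
    and cd: "c < d" "d \<le> c + 1" and fixc: "\<And>m n. L m n c = c" and fixd: "\<And>m n. L m n d = d"
  shows "\<exists>z m n. c < z \<and> z < d \<and> L m n z = z \<and> (m \<noteq> 0 \<or> n \<noteq> 0)"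
proof (rule ccontr)
  assume "\<not> ?thesis"
  then have free: "\<And>z m n. c < z \<Longrightarrow> z < d \<Longrightarrow> L m n z = z \<Longrightarrow> m = 0 \<and> n = 0" by blast
  note plL = lifts_plmap[OF L]
  have LL: "L m n (L m' n' x) = L (m + m') (n + n') x" for m n m' n' x
    using fun_cong[OF L_add, of m n m' n' x] by simp
  have L_in: "c < L m n z \<and> L m n z < d" if "c < z" "z < d" for m n z
    using plmap_less_iff[OF plL, of m n c z] plmap_less_iff[OF plL, of m n z d] that fixc fixd by simp
  define X where "X = circle_of ` {c<..<d}"
  have RX: "R m n (circle_of z) = circle_of (L m n z)" for m n z
    using lifts_circle_of[OF L] by simp
  have X_inv: "R m n p \<in> X" if "p \<in> X" for p m n
    using that L_in by (auto simp: X_def RX)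
  have X_free: "m = 0 \<and> n = 0" if p: "p \<in> X" and eq: "R m n p = p" for p m n
  proof -
    obtain z where z: "p = circle_of z" "c < z" "z < d" using p by (auto simp: X_def)
    have "circle_of (L m n z) = circle_of z" using eq z RX by simp
    then obtain k :: int where k: "L m n z = z + of_int k" by (rule circle_of_eq_obtain)
    then have "\<bar>of_int k\<bar> < (1::real)" using L_in[of z m n] z cd by (simp add: abs_if)
    then have "k = 0" by linarith
    then show ?thesis using free z k by simp
  qed
  have "\<exists>D. finite D \<and>
      (\<forall>p\<in>X. \<forall>m n. p \<notin> D \<longrightarrow> R m n p \<notin> D \<longrightarrow> locally_affine_at (R m n) p)"
    by (rule finitely_many_breaks) (fact X_inv, fact X_free)
  then obtain D where D: "finite D"
    "\<forall>p\<in>X. \<forall>m n. p \<notin> D \<longrightarrow> R m n p \<notin> D \<longrightarrow> locally_affine_at (R m n) p" by (elim exE conjE)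
  define D' where "D' = {t. circle_of t \<in> D} \<inter> {c..d}"
  have finD': "finite D'" unfolding D'_def using D(1) by (rule finite_circle_of_vimage)
  have aff: "\<exists>a b. \<forall>\<^sub>F t in nhds z. L m n t = a * t + b"
    if z: "c < z" "z < d" "z \<notin> D'" "L m n z \<notin> D'" for m n z
  proof -
    have "circle_of z \<notin> D" using z by (simp add: D'_def)
    moreover have "R m n (circle_of z) \<notin> D"
      using z(4) L_in[OF z(1,2), of m n] by (simp add: D'_def RX)
    moreover have "circle_of z \<in> X" using z by (simp add: X_def)
    ultimately have "locally_affine_at (R m n) (circle_of z)" using D(2) by blast
    then show ?thesis by (rule lifts_locally_affine[OF L])
  qed
  define y where "y = (c + d) / 2"
  have y: "c < y" "y < d" using cd by (auto simp: y_def)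
  have "\<exists>e::int. e \<noteq> 0 \<and> L e 0 y > y"
  proof (cases "L 1 0 y > y")
    case True
    then show ?thesis by (intro exI[of _ 1]) simp
  next
    case False
    moreover have "L 1 0 y \<noteq> y" using free[OF y, of 1 0] by auto
    ultimately have "L 1 0 y < y" by simp
    then have "L (-1) 0 (L 1 0 y) < L (-1) 0 y" using plmap_less_iff[OF plL] by blast
    then have "y < L (-1) 0 y" by (simp add: LL L_zero)
    then show ?thesis by (intro exI[of _ "-1"]) simp
  qed
  then obtain e :: int where e: "e \<noteq> 0" "L e 0 y > y" by blast
  define F where "F = L e 0"
  have plF: "plmap F" unfolding F_def by (rule plL)
  have up: "z < F z" if z: "c < z" "z < d" for z
  proof (rule ccontr)
    assume "\<not> z < F z"
    then have le: "F z - z \<le> 0" "0 \<le> F y - y" using e by (auto simp: F_def)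
    have "continuous_on UNIV (\<lambda>t. F t - t)"
      using plF unfolding plmap_def by (intro continuous_on_diff continuous_on_id) auto
    then obtain w where "w \<in> closed_segment z y" "F w - w = 0" using zero_between le by blast
    then show False using free[of w e 0] y z e(1)
      by (auto simp: F_def closed_segment_eq_real_ivl split: if_splits)
  qed
  obtain a where a: "\<forall>\<^sub>F t in at_right c. F t = F c + a * (t - c)"
    using plmap_germ[OF plF, where b = True and z = c] by (auto simp: side_def)
  obtain b where b: "\<forall>\<^sub>F t in at_left d. F t = F d + b * (t - d)"
    using plmap_germ[OF plF, where b = False and z = d] by (auto simp: side_def)
  obtain c1 where c1: "c1 > c" "\<And>t. c < t \<Longrightarrow> t < c1 \<Longrightarrow> F t = c + a * (t - c)"
    using a fixc by (auto simp: eventually_at_right_field F_def)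
  obtain d1 where d1: "d1 < d" "\<And>t. d1 < t \<Longrightarrow> t < d \<Longrightarrow> F t = d + b * (t - d)"
    using b fixd by (auto simp: eventually_at_left_field F_def)
  define M1 where "M1 = insert c1 (insert y (D' \<inter> {c<..}))"
  (* Below m1 the map F is affine and there are no points of D'; m2 plays this role near d. *)
  define m1 where "m1 = Min M1"
  have M1: "finite M1" "M1 \<noteq> {}" "\<And>t. t \<in> M1 \<Longrightarrow> c < t"
    using finD' c1(1) y(1) by (auto simp: M1_def)
  have m1: "c < m1" "m1 \<le> c1" "m1 \<le> y" "\<And>z. z \<in> D' \<Longrightarrow> c < z \<Longrightarrow> m1 \<le> z"
    using M1(3)[OF Min_in[OF M1(1,2)]] Min_le[OF M1(1)] by (auto simp: m1_def M1_def)
  define M2 where "M2 = insert d1 (insert y (D' \<inter> {..<d}))"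
  define m2 where "m2 = Max M2"
  have M2: "finite M2" "M2 \<noteq> {}" "\<And>t. t \<in> M2 \<Longrightarrow> t < d"
    using finD' d1(1) y(2) by (auto simp: M2_def)
  have m2: "m2 < d" "d1 \<le> m2" "y \<le> m2" "\<And>z. z \<in> D' \<Longrightarrow> z < d \<Longrightarrow> z \<le> m2"
    using M2(3)[OF Max_in[OF M2(1,2)]] Max_ge[OF M2(1)] by (auto simp: m2_def M2_def)
  define x2 where "x2 = (c + m1) / 2"
  have x2: "c < x2" "x2 < m1" using m1 by (auto simp: x2_def)
  (* Three steps back leave room for x0, x1, x2 in the open interval (w, m1). *)
  define w where "w = L (- 3 * e) 0 x2"
  have w: "c < w" "w < d" using L_in[of x2 "- 3 * e" 0] x2 m1 y by (auto simp: w_def)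
  have FFF: "F (F (F w)) = x2" by (simp add: w_def F_def LL L_zero)
  define x0 where "x0 = F w"
  define x1 where "x1 = F x0"
  have F_in: "c < F z \<and> F z < d" if "c < z" "z < d" for z unfolding F_def using that by (rule L_in)
  have x01: "c < x0" "x0 < d" "c < x1" "x1 < d" unfolding x1_def x0_def using F_in w by auto
  have xs: "w < x0" "x0 < x1" "x1 < x2" "F x1 = x2"
    using up[OF w] up[OF x01(1,2)] up[OF x01(3,4)] FFF by (auto simp: x0_def x1_def)
  obtain n where n: "m2 < (F ^^ n) w"
    using orbit_exceeds[OF plF, of w m2] up w m2 by (metis le_less_trans less_le_trans)
  define H where "H = F ^^ n"
  have "H = L (int n * e) 0"
    unfolding H_def
  proof (induction n)
    case (Suc n)
    then show ?case by (simp add: F_def L_add algebra_simps)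
  qed (simp add: L_zero)
  then have H_aff: "\<exists>a b. \<forall>\<^sub>F t in nhds z. H t = a * t + b" if z: "z \<in> {w<..<m1}" for z
  proof -
    have zz: "c < z" "z < d" using z w m1 y by auto
    have "z \<notin> D'" using m1(4)[of z] zz z by auto
    moreover have "(F ^^ n) w < H z"
      unfolding H_def using z plmap_less_iff[OF lifts_plmap[OF lifts_funpow[OF L[of e 0]]]] by (simp add: F_def)
    then have "m2 < H z" using n by simp
    then have "H z \<notin> D'" using m2(4)[of "H z"] L_in[OF zz, of "int n * e" 0] \<open>H = L (int n * e) 0\<close> by force
    ultimately show ?thesis using aff[OF zz, of "int n * e" 0] \<open>H = L (int n * e) 0\<close> by simp
  qed
  obtain \<alpha> \<beta> where H: "\<And>z. z \<in> {w<..<m1} \<Longrightarrow> H z = \<alpha> * z + \<beta>"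
    using affine_on_interval[OF H_aff] by blast
  have xin: "x0 \<in> {w<..<m1}" "x1 \<in> {w<..<m1}" "x2 \<in> {w<..<m1}" using xs x2 by auto
  have HF: "H (F z) = F (H z)" for z unfolding H_def by (simp add: funpow_swap1)
  have Hm: "H z < H z' \<longleftrightarrow> z < z'" for z z'
    unfolding H_def F_def by (rule plmap_less_iff[OF lifts_plmap[OF lifts_funpow[OF L]]])
  have Hbig: "d1 < H z \<and> H z < d" if "w < z" "z < d" for z
  proof -
    have "(F ^^ n) w < H z" using that Hm unfolding H_def by blast
    moreover have "H z < d" using L_in[of z "int n * e" 0] that w \<open>H = L (int n * e) 0\<close> by simp
    ultimately show ?thesis using n m2 by simp
  qed
  have fa: "x1 = c + a * (x0 - c)" "x2 = c + a * (x1 - c)"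
    using c1(2)[of x0] c1(2)[of x1] x01 xs x2 m1 by (auto simp: x1_def)
  have fb: "H x1 = d + b * (H x0 - d)" "H x2 = d + b * (H x1 - d)"
    using d1(2)[of "H x0"] d1(2)[of "H x1"] Hbig[of x0] Hbig[of x1] xs x01 HF[of x0] HF[of x1]
    by (auto simp: x1_def)
  have "\<alpha> * x1 - \<alpha> * x0 > 0" using H[OF xin(1)] H[OF xin(2)] Hm[of x0 x1] xs by simp
  moreover have "\<alpha> * x2 - \<alpha> * x1 = a * (\<alpha> * x1 - \<alpha> * x0)"
  proof -
    have "x2 - x1 = a * (x1 - x0)" using fa by (simp add: algebra_simps)
    then have "\<alpha> * (x2 - x1) = \<alpha> * (a * (x1 - x0))" by simp
    then show ?thesis by (simp add: algebra_simps)
  qed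
  moreover have "\<alpha> * x2 - \<alpha> * x1 = b * (\<alpha> * x1 - \<alpha> * x0)"
  proof -
    have "H x2 - H x1 = b * (H x1 - H x0)" using fb by (simp add: algebra_simps)
    then show ?thesis using H[OF xin(1)] H[OF xin(2)] H[OF xin(3)] by simp
  qed
  ultimately have "a * (\<alpha> * x1 - \<alpha> * x0) = b * (\<alpha> * x1 - \<alpha> * x0)" "\<alpha> * x1 - \<alpha> * x0 \<noteq> 0" by linarith+
  then have "a = b" using mult_right_cancel by blast
  moreover have "a > 1"
  proof -
    have "a * (x0 - c) > 1 * (x0 - c)" using fa(1) xs by simp
    then show ?thesis by (rule mult_right_less_imp_less) (use x01 in simp)
  qed
  moreover have "b < 1"
  proof -
    have "H x0 < H x1" "H x0 < d" using Hm xs Hbig[of x0] x01 by auto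
    then have "1 * (d - H x0) > b * (d - H x0)" using fb(1) by (simp add: algebra_simps)
    then show ?thesis by (rule mult_right_less_imp_less) (use \<open>H x0 < d\<close> in simp)
  qed
  ultimately show False by simp
qed

text \<open>
  Let \<open>(c, d)\<close> be the gap of the common fixed point set around a lift \<open>y\<close> of \<open>q\<close>. Some nontrivial element
  fixes a point in it. If this element moved \<open>y\<close>, its fixed point set would have a boundary
  point in the gap, and the finitely many such points would be fixed by the whole group.
\<close>

theorem nontrivial_stabilizer:
  assumes fixes_p: "\<And>m n. R m n p = p"
  shows "\<exists>m n. (m \<noteq> 0 \<or> n \<noteq> 0) \<and> R m n q = q"
proof (rule ccontr)
  assume "\<not> ?thesis"
  then have nq: "\<And>m n. R m n q = q \<Longrightarrow> m = 0 \<and> n = 0" by blast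
  obtain x0 where x0: "circle_of x0 = p" using circle_of_surj by metis
  obtain L where L: "\<And>m n. lifts (L m n) (R m n)" "\<And>m n. L m n x0 = x0"
    "\<And>m n m' n'. L m n \<circ> L m' n' = L (m + m') (n + n')" "L 0 0 = id"
    using lift_family[of x0] fixes_p x0 by blast
  note plL = lifts_plmap[OF L(1)]
  have LL: "L m n (L m' n' x) = L (m + m') (n + n') x" for m n m' n' x
    using fun_cong[OF L(3), of m n m' n' x] by simp
  obtain y' where y': "circle_of y' = q" using circle_of_surj by metis
  define y where "y = y' + of_int (- \<lfloor>y' - x0\<rfloor>)"
  have y: "circle_of y = q" "x0 \<le> y" "y \<le> x0 + 1"
    unfolding y_def using y' by (simp only: circle_of_add_int, linarith+)
  have ny: "m = 0 \<and> n = 0" if "L m n y = y" for m n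
    using nq[of m n] lifts_circle_of[OF L(1), of m n y] that y by simp
  define C where "C = (\<Inter>m. \<Inter>n. {x. L m n x = x})"
  have closedC: "closed C" unfolding C_def by (intro closed_INT ballI closed_fixed_points plL)
  have "x0 + 1 \<in> C" using L(2) plL unfolding C_def plmap_def by auto
  moreover have "x0 \<in> C" using L(2) by (auto simp: C_def)
  moreover have "y \<notin> C" using ny[of 1 0] by (auto simp: C_def)
  ultimately have C: "x0 \<in> C" "x0 + 1 \<in> C" "y \<notin> C" by auto
  obtain c d where cd: "c \<in> C" "d \<in> C" "x0 \<le> c" "c < y" "y < d" "d \<le> x0 + 1"
    and noC: "\<And>z. c < z \<Longrightarrow> z < d \<Longrightarrow> z \<notin> C"
    using complementary_gap[OF closedC C(1) y(2) C(2) y(3) C(3)] by metis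
  have fixc: "L m n c = c" and fixd: "L m n d = d" for m n using cd by (auto simp: C_def)
  obtain z m n where z: "c < z" "z < d" "L m n z = z" "m \<noteq> 0 \<or> n \<noteq> 0"
    using no_free_action_on_interval[OF L(1,3,4) _ _ fixc fixd] cd by force
  define A where "A = {x. L m n x = x}"
  have "closed_segment z y \<inter> frontier A \<noteq> {}"
  proof (rule connected_Int_frontier)
    show "closed_segment z y \<inter> A \<noteq> {}" using z by (auto simp: A_def)
    show "closed_segment z y - A \<noteq> {}" using ny[of m n] z(4) by (auto simp: A_def)
  qed simp
  then obtain r where r: "r \<in> frontier A" "r \<in> closed_segment z y" by blast
  then have r': "c < r" "r < d" using z cd by (auto simp: closed_segment_eq_real_ivl split: if_splits)
  have "L i j r = r" for i j
  proof (rule strict_mono_finite_invariant)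
    show "strict_mono (L i j)" using plL by (simp add: plmap_def)
    show "finite (frontier A \<inter> {c..d})" unfolding A_def by (rule finite_frontier_fixed_points[OF plL])
    show "L i j ` (frontier A \<inter> {c..d}) \<subseteq> frontier A \<inter> {c..d}"
    proof
      fix x assume "x \<in> L i j ` (frontier A \<inter> {c..d})"
      then obtain x' where x': "x = L i j x'" "x' \<in> frontier A" "c \<le> x'" "x' \<le> d" by auto
      have "L i j x' \<in> frontier A"
        unfolding A_def
        by (rule commuting_frontier_fixed_points[OF plL _ _ plL])
          (use x'(2) in \<open>simp_all add: LL A_def add.commute\<close>)
      moreover have "c \<le> L i j x'" "L i j x' \<le> d"
        using plmap_le_iff[OF plL, of i j c x'] plmap_le_iff[OF plL, of i j x' d] x' fixc fixd by auto
      ultimately show "x \<in> frontier A \<inter> {c..d}" using x' by simp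
    qed
    show "r \<in> frontier A \<inter> {c..d}" using r r' by simp
  qed
  then have "r \<in> C" by (auto simp: C_def)
  then show False using noC r' by blast
qed

end

section \<open>Recurrence of free actions of \<open>\<int>\<^sup>2\<close>\<close>

text \<open>
  Let \<open>a\<close> be the slope at \<open>x0\<close>. If \<open>a\<close> were not close to one, the affine map with slope \<open>a\<close> that agrees
  with \<open>l\<close> at \<open>x0\<close> would have a fixed point at distance less than \<open>r\<close> from \<open>x0\<close>. The map \<open>l\<close> stays
  affine as long as its argument and its value remain in the ball around \<open>x0\<close>, and on the segment from
  \<open>x0\<close> to this point neither can leave the ball first, so \<open>l\<close> would have this fixed point too.
\<close>

lemma near_identity_affine:
  fixes l :: "real \<Rightarrow> real"
  assumes l: "plmap l" and r: "0 < r" and \<delta>: "0 < \<delta>" "\<delta> \<le> r / 4" "\<bar>l x0 - x0\<bar> \<le> \<delta>"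
    and aff: "\<And>x. \<bar>x - x0\<bar> < r \<Longrightarrow> \<bar>l x - x0\<bar> < r \<Longrightarrow> \<exists>a b. \<forall>\<^sub>F t in nhds x. l t = a * t + b"
    and nofix: "\<And>x. l x \<noteq> x"
  obtains s where "\<bar>s - 1\<bar> \<le> \<delta> / r" "\<And>x. \<bar>x - x0\<bar> \<le> r / 2 \<Longrightarrow> l x = l x0 + s * (x - x0)"
proof -
  define li where "li = inv_into UNIV l"
  have li: "l (li x) = x" for x unfolding li_def by (rule plmap_inv_right[OF l])
  define p where "p = max (x0 - r) (li (x0 - r))"
  define q where "q = min (x0 + r) (li (x0 + r))"
  have less: "l x < l y \<longleftrightarrow> x < y" for x y by (rule plmap_less_iff[OF l])
  have lx: "li x < y \<longleftrightarrow> x < l y" "y < li x \<longleftrightarrow> l y < x" for x y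
    using less[of "li x" y] less[of y "li x"] li by auto
  have pq: "p < x0" "x0 < q" using \<delta> r lx by (auto simp: p_def q_def abs_le_iff)
  have loc: "\<exists>a b. \<forall>\<^sub>F t in nhds x. l t = a * t + b" if x: "x \<in> {p<..<q}" for x
  proof (rule aff)
    show "\<bar>x - x0\<bar> < r" using x by (auto simp: p_def q_def)
    show "\<bar>l x - x0\<bar> < r" using x lx by (auto simp: p_def q_def abs_less_iff)
  qed
  obtain a b where ab: "\<And>x. x \<in> {p<..<q} \<Longrightarrow> l x = a * x + b"
    using affine_on_interval[OF loc] by blast
  have contl: "continuous_on S l" for S
    using l continuous_on_subset[OF _ subset_UNIV] unfolding plmap_def by blast
  have A: "l x = l x0 + a * (x - x0)" if x: "p \<le> x" "x \<le> q" for x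
  proof -
    have "l x - (l x0 + a * (x - x0)) = 0"
    proof (rule continuous_constant_on_closure[where S = "{p<..<q}"
          and f = "\<lambda>x. l x - (l x0 + a * (x - x0))" and a = 0])
      show "continuous_on (closure {p<..<q}) (\<lambda>x. l x - (l x0 + a * (x - x0)))"
        by (intro continuous_on_diff continuous_on_add continuous_on_mult continuous_on_const
            continuous_on_id contl)
      show "l y - (l x0 + a * (y - x0)) = 0" if "y \<in> {p<..<q}" for y
        using ab[OF that] ab[of x0] pq by (simp add: algebra_simps)
      show "x \<in> closure {p<..<q}" using x pq by (simp add: closure_greaterThanLessThan)
    qed
    then show ?thesis by simp
  qed
  have a0: "a > 0"
  proof -
    define m where "m = (x0 + q) / 2"
    have m: "x0 < m" "m \<le> q" "p \<le> m" using pq by (auto simp: m_def)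
    have "a * (m - x0) > 0" using A[OF m(3,2)] less[of x0 m] m by linarith
    then show ?thesis using m by (simp add: zero_less_mult_iff)
  qed
  have qr: "l q = x0 + r" if "q \<noteq> x0 + r" using that li by (auto simp: q_def min_def)
  have pr: "l p = x0 - r" if "p \<noteq> x0 - r" using that li by (auto simp: p_def max_def)
  have s: "\<bar>a - 1\<bar> \<le> \<delta> / r"
  proof (rule ccontr)
    assume "\<not> \<bar>a - 1\<bar> \<le> \<delta> / r"
    then have big: "\<delta> < r * \<bar>a - 1\<bar>" using r by (simp add: field_simps)
    then have a1: "a \<noteq> 1" using \<delta>(1) by auto
    (* x0 + e is the fixed point of the affine map. *)
    define e where "e = (l x0 - x0) / (1 - a)"
    have e: "l x0 + a * e = x0 + e" using a1 by (simp add: e_def field_simps)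
    have "\<bar>e\<bar> * \<bar>a - 1\<bar> = \<bar>l x0 - x0\<bar>" using a1 by (simp add: e_def abs_divide abs_minus_commute)
    then have "\<bar>e\<bar> * \<bar>a - 1\<bar> < r * \<bar>a - 1\<bar>" using \<delta>(3) big by linarith
    then have er: "\<bar>e\<bar> < r" by (rule mult_less_cancel_right_disj[THEN iffD1, THEN disjE]) auto
    consider "p \<le> x0 + e \<and> x0 + e \<le> q" | "x0 + e > q" | "x0 + e < p" by linarith
    then show False
    proof cases
      case 1
      then show False using A[of "x0 + e"] nofix[of "x0 + e"] e by simp
    next
      case 2
      then have "l q = x0 + r" using qr er by auto
      moreover have "l q = l x0 + a * (q - x0)" using A[of q] pq by simp
      moreover have "a * (q - x0) < a * e" using 2 a0 by simp
      ultimately show False using e er by linarith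
    next
      case 3
      then have "l p = x0 - r" using pr er by auto
      moreover have "l p = l x0 + a * (p - x0)" using A[of p] pq by simp
      moreover have "a * (p - x0) > a * e" using 3 a0 by simp
      ultimately show False using e er by linarith
    qed
  qed
  have "\<delta> / r \<le> 1 / 4" using \<delta>(2) r by (simp add: field_simps)
  then have a54: "a \<le> 5 / 4" using s by linarith
  have "l x = l x0 + a * (x - x0)" if x: "\<bar>x - x0\<bar> \<le> r / 2" for x
  proof (rule A)
    have m: "a * (r / 2) \<le> (5 / 4) * (r / 2)" using a54 r by (intro mult_right_mono) auto
    show "x \<le> q"
    proof (rule ccontr)
      assume "\<not> x \<le> q"
      then have q: "q < x0 + r / 2" using x by linarith
      then have "l q = x0 + r" using qr r by auto
      moreover have "l q = l x0 + a * (q - x0)" using A[of q] pq by simp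
      moreover have "a * (q - x0) \<le> a * (r / 2)" using q a0 by (intro mult_left_mono) auto
      ultimately show False using \<delta> m r by linarith
    qed
    show "p \<le> x"
    proof (rule ccontr)
      assume "\<not> p \<le> x"
      then have p: "p > x0 - r / 2" using x by linarith
      then have "l p = x0 - r" using pr r by auto
      moreover have "l p = l x0 + a * (p - x0)" using A[of p] pq by simp
      moreover have "a * (x0 - p) \<le> a * (r / 2)" using p a0 by (intro mult_left_mono) auto
      ultimately show False using \<delta> m r by (simp add: algebra_simps)
    qed
  qed
  with s that show ?thesis by blast
qed

lemma funpow_diff_add:
  assumes "i \<le> k"
  shows "(F ^^ (k - i)) ((F ^^ i) x) = (F ^^ k) x" "(F ^^ i) ((F ^^ (k - i)) x) = (F ^^ k) x"
  using fun_cong[OF funpow_add[of "k - i" i F], of x] fun_cong[OF funpow_add[of i "k - i" F], of x] assms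
  by simp_all

lemma avoid_finite_ball:
  assumes "finite D" "circle_of x \<notin> D"
  obtains r where "r > 0" "\<And>t. \<bar>t - x\<bar> < r \<Longrightarrow> circle_of t \<notin> D"
proof -
  have "finite ({t. circle_of t \<in> D} \<inter> {x - 1..x + 1})" by (rule finite_circle_of_vimage[OF assms(1)])
  then obtain d where d: "d > 0" "\<And>t. t \<in> {t. circle_of t \<in> D} \<inter> {x - 1..x + 1} \<Longrightarrow> t \<noteq> x \<Longrightarrow> d \<le> dist x t"
    using finite_set_avoid[of _ x] by meson
  have "circle_of t \<notin> D" if t: "\<bar>t - x\<bar> < min d 1" for t
  proof
    assume "circle_of t \<in> D"
    moreover from this have "t \<noteq> x" using assms(2) by auto
    ultimately have "d \<le> dist x t" using t by (intro d(2)) auto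
    then show False using t by (simp add: dist_real_def abs_minus_commute)
  qed
  then show ?thesis using that[of "min d 1"] d(1) by simp
qed

text \<open>
  A free action together with a set \<open>D\<close> as in \<open>finitely_many_breaks\<close>.
\<close>

locale free_Z2_action = Z2_action +
  fixes D :: "circle set"
  assumes free: "R m n p = p \<Longrightarrow> m = 0 \<and> n = 0"
    and finD: "finite D"
    and affine: "p \<notin> D \<Longrightarrow> R m n p \<notin> D \<Longrightarrow> locally_affine_at (R m n) p"
begin

lemma near_identity:
  assumes l: "lifts l (R m n)" and mn: "m \<noteq> 0 \<or> n \<noteq> 0"
    and r: "0 < r" "\<And>t. \<bar>t - x0\<bar> < r \<Longrightarrow> circle_of t \<notin> D"
    and \<delta>: "0 < \<delta>" "\<delta> \<le> r / 4" "\<bar>l x0 - x0\<bar> \<le> \<delta>"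
  obtains s where "\<bar>s - 1\<bar> \<le> \<delta> / r" "\<And>x. \<bar>x - x0\<bar> \<le> r / 2 \<Longrightarrow> l x = l x0 + s * (x - x0)"
proof (rule near_identity_affine[OF lifts_plmap[OF l] r(1) \<delta>])
  fix x assume "\<bar>x - x0\<bar> < r" "\<bar>l x - x0\<bar> < r"
  then have "circle_of x \<notin> D" "R m n (circle_of x) \<notin> D"
    using r(2) lifts_circle_of[OF l, of x] by metis+
  then show "\<exists>a b. \<forall>\<^sub>F t in nhds x. l t = a * t + b"
    by (intro lifts_locally_affine[OF l] affine)
next
  fix x show "l x \<noteq> x"
  proof
    assume "l x = x"
    then have "R m n (circle_of x) = circle_of x" using lifts_circle_of[OF l, of x] by simp
    then show False using free mn by blast
  qed
qed (use that in blast)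

lemma lifts_R_pow:
  assumes "lifts F (R 1 0)"
  shows "lifts (F ^^ n) (R (int n) 0)"
proof -
  have "(R 1 0) ^^ n = R (int n) 0"
  proof (induction n)
    case (Suc n)
    then show ?case by (simp add: R_add)
  qed (simp add: R_zero)
  then show ?thesis using lifts_funpow[OF assms, of n] by simp
qed

text \<open>
  The points \<open>w k\<close> converge to \<open>z\<close>, but closeness of \<open>w k\<close> and \<open>w l\<close> has to be carried back to \<open>y\<close> by
  the map \<open>\<nu> k\<close>, which takes \<open>y\<close> to \<open>w k\<close>, and a priori \<open>\<nu> k\<close> could contract strongly. Now \<open>\<nu> k\<close>
  factors through the fixed map \<open>\<nu> k0\<close>, followed by a map \<open>\<mu>\<close> that moves \<open>w k0\<close> to the nearby point
  \<open>w k\<close>. Both points are close to \<open>z\<close>, which is not in \<open>D\<close>, so \<open>\<mu>\<close> has slope close to one there.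
\<close>

lemma return_near:
  assumes F: "lifts F (R 1 0)" and j: "strict_mono (j :: nat \<Rightarrow> nat)" and z: "circle_of z \<notin> D"
    and w: "(\<lambda>i. (F ^^ j i) y - of_int (a i)) \<longlonglongrightarrow> z" and \<epsilon>: "\<epsilon> > 0"
  shows "\<exists>K. \<forall>k\<ge>K. \<forall>l>k. \<bar>(F ^^ (j l - j k)) y - of_int (a l - a k) - y\<bar> < \<epsilon>"
proof -
  define w where "w = (\<lambda>i. (F ^^ j i) y - of_int (a i))"
  have wz: "w \<longlonglongrightarrow> z" unfolding w_def by fact
  obtain r0 where r0: "r0 > 0" "\<And>t. \<bar>t - z\<bar> < r0 \<Longrightarrow> circle_of t \<notin> D"
    using avoid_finite_ball[OF finD z] by blast
  define r where "r = r0 / 2"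
  have r: "r > 0" "\<And>t. \<bar>t - z\<bar> < 2 * r \<Longrightarrow> circle_of t \<notin> D" using r0 by (auto simp: r_def)
  note plF = lifts_plmap[OF F]
  have plP: "plmap (F ^^ i)" for i by (rule lifts_plmap[OF lifts_funpow[OF F]])
  define \<nu> where "\<nu> = (\<lambda>k x. (F ^^ j k) x + of_int (- a k))"
  have pl\<nu>: "plmap (\<nu> k)" for k unfolding \<nu>_def by (rule lifts_plmap[OF lifts_shift[OF lifts_funpow[OF F]]])
  obtain k0 where k0: "\<And>k. k \<ge> k0 \<Longrightarrow> \<bar>w k - z\<bar> < r / 8"
    using LIMSEQ_D[OF wz, of "r / 8"] r(1) by auto
  have \<nu>y: "\<nu> k y = w k" for k by (simp add: \<nu>_def w_def)
  have "isCont (inv_into UNIV (\<nu> k0)) (w k0)" using plmap_isCont[OF plmap_inv[OF pl\<nu>]] .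
  moreover have inv_y: "inv_into UNIV (\<nu> k0) (w k0) = y" using plmap_inv_left[OF pl\<nu>, of k0 y] \<nu>y by simp
  ultimately obtain \<eta> where \<eta>: "\<eta> > 0"
    "\<And>x. \<bar>x - w k0\<bar> < \<eta> \<Longrightarrow> \<bar>inv_into UNIV (\<nu> k0) x - y\<bar> < \<epsilon>"
    using \<epsilon> unfolding continuous_at_eps_delta by (auto simp: dist_real_def)
  obtain K1 where K1: "\<And>k l. k \<ge> K1 \<Longrightarrow> l \<ge> K1 \<Longrightarrow> \<bar>w k - w l\<bar> < \<eta> / 2"
    using LIMSEQ_imp_Cauchy[OF wz] \<eta>(1) unfolding Cauchy_def dist_real_def
    by (metis half_gt_zero)
  show ?thesis
  proof (intro exI allI impI)
    fix k l assume k: "k \<ge> max K1 (Suc k0)" and kl: "l > k"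
    have close: "\<bar>w k - z\<bar> < r / 8" "\<bar>w k0 - z\<bar> < r / 8" "\<bar>w l - z\<bar> < r / 8"
      using k0[of k] k0[of k0] k0[of l] k kl by auto
    have jk: "j k0 < j k" "j k < j l" using k kl strict_monoD[OF j] by auto
    define \<mu> where "\<mu> = (\<lambda>x. (F ^^ (j k - j k0)) x + of_int (- (a k - a k0)))"
    have \<mu>: "lifts \<mu> (R (int (j k - j k0)) 0)"
      unfolding \<mu>_def by (rule lifts_shift[OF lifts_R_pow[OF F]])
    have \<mu>\<nu>: "\<mu> (\<nu> k0 x) = \<nu> k x" for x
    proof -
      have "\<mu> (\<nu> k0 x) = (F ^^ (j k - j k0)) ((F ^^ j k0) x) + of_int (- a k0) + of_int (- (a k - a k0))"
        unfolding \<mu>_def \<nu>_def by (simp only: plmap_add_int[OF plP])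
      also have "(F ^^ (j k - j k0)) ((F ^^ j k0) x) = (F ^^ j k) x"
        using jk by (intro funpow_diff_add) simp
      finally show ?thesis by (simp add: \<nu>_def)
    qed
    define l' where "l' = inv_into UNIV \<mu>"
    have "R (- int (j k - j k0)) 0 \<circ> R (int (j k - j k0)) 0 = id" by (simp add: R_add R_zero)
    from lifts_inv[OF \<mu> this] have l': "lifts l' (R (- int (j k - j k0)) 0)" by (simp add: l'_def)
    have l'\<mu>: "l' (\<mu> x) = x" for x unfolding l'_def by (rule plmap_inv_left[OF lifts_plmap[OF \<mu>]])
    have wk: "l' (w k) = w k0" using l'\<mu>[of "w k0"] \<mu>\<nu>[of y] \<nu>y by simp
    obtain s where s: "\<bar>s - 1\<bar> \<le> r / 4 / r" "\<And>x. \<bar>x - w k\<bar> \<le> r / 2 \<Longrightarrow> l' x = l' (w k) + s * (x - w k)"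
    proof (rule near_identity[OF l' _ r(1), of "w k" "r / 4"])
      show "- int (j k - j k0) \<noteq> 0 \<or> (0::int) \<noteq> 0" using jk by simp
      show "circle_of t \<notin> D" if "\<bar>t - w k\<bar> < r" for t
        by (rule r(2)) (use that close r(1) in linarith)
      show "0 < r / 4" "r / 4 \<le> r / 4" using r(1) by auto
      show "\<bar>l' (w k) - w k\<bar> \<le> r / 4" unfolding wk using close r(1) by linarith
    qed blast
    define x where "x = (F ^^ (j l - j k)) y - of_int (a l - a k)"
    have "\<nu> k x = w l"
    proof -
      have "\<nu> k x = (F ^^ j k) ((F ^^ (j l - j k)) y + of_int (- (a l - a k))) + of_int (- a k)"
        by (simp only: \<nu>_def x_def of_int_minus add_uminus_conv_diff)
      also have "\<dots> = (F ^^ j k) ((F ^^ (j l - j k)) y) + of_int (- (a l - a k)) + of_int (- a k)"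
        by (simp only: plmap_add_int[OF plP])
      also have "(F ^^ j k) ((F ^^ (j l - j k)) y) = (F ^^ j l) y"
        using jk by (intro funpow_diff_add) simp
      finally show ?thesis by (simp add: w_def)
    qed
    then have "\<nu> k0 x = l' (w l)" using \<mu>\<nu>[of x] l'\<mu>[of "\<nu> k0 x"] by simp
    moreover have "\<bar>w l - w k\<bar> \<le> r / 2" using close r(1) by linarith
    ultimately have 1: "\<nu> k0 x = w k0 + s * (w l - w k)" using s(2)[of "w l"] wk by simp
    have "r / 4 / r = 1 / 4" using r(1) by simp
    then have "\<bar>s\<bar> \<le> 2" using s(1) by linarith
    then have "\<bar>s * (w l - w k)\<bar> \<le> 2 * \<bar>w l - w k\<bar>"
      unfolding abs_mult by (intro mult_right_mono) auto
    moreover have "\<bar>w l - w k\<bar> < \<eta> / 2" using K1[of l k] k kl by simp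
    ultimately have "\<bar>\<nu> k0 x - w k0\<bar> < \<eta>" using 1 by simp
    then have "\<bar>inv_into UNIV (\<nu> k0) (\<nu> k0 x) - y\<bar> < \<epsilon>" by (rule \<eta>(2))
    then show "\<bar>(F ^^ (j l - j k)) y - of_int (a l - a k) - y\<bar> < \<epsilon>"
      using plmap_inv_left[OF pl\<nu>, of k0 x] by (simp add: x_def)
  qed
qed

text \<open>
  The orbits of \<open>y\<close> and \<open>y'\<close> modulo one accumulate along a common subsequence. Applying one further power
  of \<open>F\<close>, the two limits can be moved out of \<open>D\<close>, because by freeness an orbit meets \<open>D\<close> finitely often.
\<close>

lemma simultaneous_return:
  assumes F: "lifts F (R 1 0)" and \<epsilon>: "\<epsilon> > 0"
  obtains n and k k' :: int where "n \<ge> 1" "\<bar>(F ^^ n) y + of_int k - y\<bar> < \<epsilon>" "\<bar>(F ^^ n) y' + of_int k' - y'\<bar> < \<epsilon>"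
proof -
  define u where "u = (\<lambda>i. ((F ^^ i) y - of_int \<lfloor>(F ^^ i) y\<rfloor>, (F ^^ i) y' - of_int \<lfloor>(F ^^ i) y'\<rfloor>))"
  have "seq_compact ({0..1::real} \<times> {0..1::real})"
    by (intro compact_imp_seq_compact compact_Times) auto
  moreover have "u i \<in> {0..1} \<times> {0..1}" for i unfolding u_def by (auto, linarith+)
  ultimately obtain z0 z0' \<phi> where \<phi>: "strict_mono (\<phi> :: nat \<Rightarrow> nat)" "(u \<circ> \<phi>) \<longlonglongrightarrow> (z0, z0')"
    unfolding seq_compact_def by (metis surj_pair)
  have fin: "finite {m::nat. R (int m) 0 p \<in> D}" for p
  proof -
    have "inj_on (\<lambda>m. R (int m) 0 p) {m. R (int m) 0 p \<in> D}"
    proof (rule inj_onI)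
      fix m n :: nat assume "R (int m) 0 p = R (int n) 0 p"
      then have "R (- int n) 0 (R (int m) 0 p) = R (- int n) 0 (R (int n) 0 p)" by simp
      then have "R (int m - int n) 0 p = p" by (simp add: R_R R_id)
      then show "m = n" using free by fastforce
    qed
    moreover have "(\<lambda>m. R (int m) 0 p) ` {m. R (int m) 0 p \<in> D} \<subseteq> D" by auto
    ultimately show ?thesis using finD finite_subset finite_imageD by metis
  qed
  obtain m where m: "R (int m) 0 (circle_of z0) \<notin> D" "R (int m) 0 (circle_of z0') \<notin> D"
    using ex_new_if_finite[OF infinite_UNIV_nat finite_UnI[OF fin[of "circle_of z0"] fin[of "circle_of z0'"]]] by auto
  define z where "z = (F ^^ m) z0"
  define z' where "z' = (F ^^ m) z0'"
  have zD: "circle_of z \<notin> D" "circle_of z' \<notin> D"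
    using m lifts_circle_of[OF lifts_R_pow[OF F]] by (auto simp: z_def z'_def)
  have plP: "plmap (F ^^ i)" for i by (rule lifts_plmap[OF lifts_funpow[OF F]])
  define j where "j = (\<lambda>i. m + \<phi> i)"
  have j: "strict_mono j" using \<phi>(1) by (simp add: j_def strict_mono_def)
  have "(\<lambda>i. fst ((u \<circ> \<phi>) i)) \<longlonglongrightarrow> fst (z0, z0')" "(\<lambda>i. snd ((u \<circ> \<phi>) i)) \<longlonglongrightarrow> snd (z0, z0')"
    using \<phi>(2) by (intro tendsto_fst tendsto_snd; assumption)+
  then have "(\<lambda>i. (F ^^ m) (fst ((u \<circ> \<phi>) i))) \<longlonglongrightarrow> z" "(\<lambda>i. (F ^^ m) (snd ((u \<circ> \<phi>) i))) \<longlonglongrightarrow> z'"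
    unfolding z_def z'_def by (auto intro: plmap_tendsto[OF plP])
  moreover have "(F ^^ m) ((F ^^ i) x - of_int k) = (F ^^ (m + i)) x - of_int k" for i x k
    using plmap_add_int[OF plP, of m "(F ^^ i) x" "- k"] by (simp add: funpow_add)
  ultimately have
    "(\<lambda>i. (F ^^ j i) y - of_int \<lfloor>(F ^^ \<phi> i) y\<rfloor>) \<longlonglongrightarrow> z"
    "(\<lambda>i. (F ^^ j i) y' - of_int \<lfloor>(F ^^ \<phi> i) y'\<rfloor>) \<longlonglongrightarrow> z'"
    by (simp_all add: u_def j_def)
  from return_near[OF F j zD(1) this(1) \<epsilon>] return_near[OF F j zD(2) this(2) \<epsilon>]
  obtain K K' where
    K: "\<And>k l. k \<ge> K \<Longrightarrow> l > k \<Longrightarrow> \<bar>(F ^^ (j l - j k)) y - of_int (\<lfloor>(F ^^ \<phi> l) y\<rfloor> - \<lfloor>(F ^^ \<phi> k) y\<rfloor>) - y\<bar> < \<epsilon>"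
    and K': "\<And>k l. k \<ge> K' \<Longrightarrow> l > k \<Longrightarrow> \<bar>(F ^^ (j l - j k)) y' - of_int (\<lfloor>(F ^^ \<phi> l) y'\<rfloor> - \<lfloor>(F ^^ \<phi> k) y'\<rfloor>) - y'\<bar> < \<epsilon>"
    by metis
  define k where "k = max K K'"
  have jk: "j k < j (Suc k)" using strict_monoD[OF j] by simp
  show ?thesis
  proof (rule that)
    show "j (Suc k) - j k \<ge> 1" using jk by simp
    show "\<bar>(F ^^ (j (Suc k) - j k)) y + of_int (- (\<lfloor>(F ^^ \<phi> (Suc k)) y\<rfloor> - \<lfloor>(F ^^ \<phi> k) y\<rfloor>)) - y\<bar> < \<epsilon>"
      using K[of k "Suc k"] by (simp only: of_int_minus add_uminus_conv_diff) (simp add: k_def)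
    show "\<bar>(F ^^ (j (Suc k) - j k)) y' + of_int (- (\<lfloor>(F ^^ \<phi> (Suc k)) y'\<rfloor> - \<lfloor>(F ^^ \<phi> k) y'\<rfloor>)) - y'\<bar> < \<epsilon>"
      using K'[of k "Suc k"] by (simp only: of_int_minus add_uminus_conv_diff) (simp add: k_def)
  qed
qed

end

section \<open>Elements commuting with part of \<open>\<int>\<^sup>2\<close>\<close>

text \<open>
  Bookkeeping for words in maps that are affine near \<open>y\<close>: \<open>k\<close> counts letters, each letter costs \<open>d\<close> in
  the radius on which the word is affine and moves points by at most \<open>d\<close>. The slope \<open>a\<close> is
  multiplicative.
\<close>

definition affine_near :: "real \<Rightarrow> real \<Rightarrow> real \<Rightarrow> nat \<Rightarrow> real \<Rightarrow> (real \<Rightarrow> real) \<Rightarrow> bool" where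
  "affine_near y r d k a A \<longleftrightarrow> a > 0 \<and>
     (\<exists>b. \<forall>x. \<bar>x - y\<bar> \<le> r - k * d \<longrightarrow> A x = a * x + b \<and> \<bar>A x - x\<bar> \<le> k * d)"

lemma affine_near_comp:
  assumes A: "affine_near y r d k a A" and B: "affine_near y r d l b B" and d: "d \<ge> 0"
  shows "affine_near y r d (k + l) (a * b) (A \<circ> B)"
proof -
  obtain a' where a': "\<And>x. \<bar>x - y\<bar> \<le> r - k * d \<Longrightarrow> A x = a * x + a' \<and> \<bar>A x - x\<bar> \<le> k * d"
    using A unfolding affine_near_def by blast
  obtain b' where b': "\<And>x. \<bar>x - y\<bar> \<le> r - l * d \<Longrightarrow> B x = b * x + b' \<and> \<bar>B x - x\<bar> \<le> l * d"
    using B unfolding affine_near_def by blast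
  have "(A \<circ> B) x = (a * b) * x + (a * b' + a') \<and> \<bar>(A \<circ> B) x - x\<bar> \<le> real (k + l) * d"
    if x: "\<bar>x - y\<bar> \<le> r - real (k + l) * d" for x
  proof -
    have dist: "real (k + l) * d = k * d + l * d" by (simp add: algebra_simps)
    have "real k * d \<ge> 0" using d by simp
    then have Bx: "B x = b * x + b'" "\<bar>B x - x\<bar> \<le> l * d" using b'[of x] x dist by auto
    then have "\<bar>B x - y\<bar> \<le> r - k * d" using x dist by linarith
    then have "A (B x) = a * B x + a'" "\<bar>A (B x) - B x\<bar> \<le> k * d" using a'[of "B x"] by blast+
    then show ?thesis using Bx dist by (simp add: algebra_simps)
  qed
  then have *: "\<forall>x. \<bar>x - y\<bar> \<le> r - real (k + l) * d \<longrightarrow>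
      (A \<circ> B) x = (a * b) * x + (a * b' + a') \<and> \<bar>(A \<circ> B) x - x\<bar> \<le> real (k + l) * d"
    by (intro allI impI)
  have "a * b > 0" using A B by (simp add: affine_near_def)
  with * show ?thesis unfolding affine_near_def by (intro conjI exI[of _ "a * b' + a'"])
qed

lemma affine_near_inv:
  assumes A: "affine_near y r d k a A" and pl: "plmap A" and d: "d \<ge> 0"
  shows "affine_near y r d (2 * k) (1 / a) (inv_into UNIV A)"
proof -
  obtain a' where a': "\<And>x. \<bar>x - y\<bar> \<le> r - k * d \<Longrightarrow> A x = a * x + a' \<and> \<bar>A x - x\<bar> \<le> k * d"
    using A unfolding affine_near_def by blast
  have a: "a > 0" using A by (simp add: affine_near_def)
  have kd: "real k * d \<ge> 0" using d by simp
  have "inv_into UNIV A x = (1 / a) * x + (- a' / a) \<and> \<bar>inv_into UNIV A x - x\<bar> \<le> real (2 * k) * d"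
    if x: "\<bar>x - y\<bar> \<le> r - real (2 * k) * d" for x
  proof -
    define w where "w = inv_into UNIV A x"
    have Aw: "A w = x" unfolding w_def by (rule plmap_inv_right[OF pl])
    have x': "\<bar>x - y\<bar> \<le> r - 2 * (k * d)" using x by (simp add: algebra_simps)
    have "\<bar>A (x - k * d) - (x - k * d)\<bar> \<le> k * d" "\<bar>A (x + k * d) - (x + k * d)\<bar> \<le> k * d"
      using a'[of "x - k * d"] a'[of "x + k * d"] x' kd by linarith+
    then have "A (x - k * d) \<le> A w" "A w \<le> A (x + k * d)" unfolding Aw by linarith+
    then have w: "x - k * d \<le> w" "w \<le> x + k * d" using plmap_le_iff[OF pl] by blast+
    then have "\<bar>w - y\<bar> \<le> r - k * d" using x' by linarith
    then have "x = a * w + a'" using a' Aw by metis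
    then have "w = (1 / a) * x + (- a' / a)" using a by (simp add: field_simps)
    moreover have "\<bar>w - x\<bar> \<le> 2 * k * d" using w kd by (simp add: abs_le_iff)
    ultimately show ?thesis by (simp add: w_def)
  qed
  then have *: "\<forall>x. \<bar>x - y\<bar> \<le> r - real (2 * k) * d \<longrightarrow>
      inv_into UNIV A x = (1 / a) * x + (- a' / a) \<and> \<bar>inv_into UNIV A x - x\<bar> \<le> real (2 * k) * d"
    by (intro allI impI)
  from a have "1 / a > 0" by simp
  with * show ?thesis unfolding affine_near_def by (intro conjI exI[of _ "- a' / a"])
qed

text \<open>
  Germs of affine maps form a metabelian group: \<open>u\<close> and \<open>v\<close> have slope one, so they are translations near
  \<open>y\<close>. The words have lengths \<open>6\<close> and \<open>9\<close>, inverses being counted twice.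
\<close>

lemma local_second_commutator:
  assumes l: "plmap l" "affine_near y r d 1 a l" and m: "plmap m" "affine_near y r d 1 b m"
    and d: "d \<ge> 0"
  defines "u \<equiv> l \<circ> m \<circ> inv_into UNIV l \<circ> inv_into UNIV m"
  defines "v \<equiv> l \<circ> u \<circ> inv_into UNIV l"
  assumes x: "\<bar>x - y\<bar> \<le> r - 15 * d"
  shows "u (v x) = v (u x)"
proof -
  note comp = affine_near_comp[OF _ _ d]
  have li: "affine_near y r d 2 (1 / a) (inv_into UNIV l)" using affine_near_inv[OF l(2,1) d] by simp
  have mi: "affine_near y r d 2 (1 / b) (inv_into UNIV m)" using affine_near_inv[OF m(2,1) d] by simp
  have pos: "a > 0" "b > 0" using l(2) m(2) by (auto simp: affine_near_def)
  have "(1 + 1) + 2 + 2 = (6::nat)" "1 + 6 + 2 = (9::nat)" by simp_all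
  moreover have "a * b * (1 / a) * (1 / b) = 1" "a * 1 * (1 / a) = 1" using pos by simp_all
  ultimately have u: "affine_near y r d 6 1 u" and v: "affine_near y r d 6 1 u \<Longrightarrow> affine_near y r d 9 1 v"
    using comp[OF comp[OF comp[OF l(2) m(2)] li] mi] comp[OF comp[OF l(2), of 6 1 u] li]
    by (simp_all only: u_def v_def)
  note v = v[OF u]
  obtain p where p: "\<And>x. \<bar>x - y\<bar> \<le> r - 6 * d \<Longrightarrow> u x = x + p \<and> \<bar>u x - x\<bar> \<le> 6 * d"
    using u unfolding affine_near_def by auto
  obtain q where q: "\<And>x. \<bar>x - y\<bar> \<le> r - 9 * d \<Longrightarrow> v x = x + q \<and> \<bar>v x - x\<bar> \<le> 9 * d"
    using v unfolding affine_near_def by auto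
  have ux: "u x = x + p" "\<bar>u x - x\<bar> \<le> 6 * d" and vx: "v x = x + q" "\<bar>v x - x\<bar> \<le> 9 * d"
    using p[of x] q[of x] x d by linarith+
  have "u (v x) = v x + p" using p[of "v x"] vx x by linarith
  moreover have "v (u x) = u x + q" using q[of "u x"] ux x by linarith
  ultimately show ?thesis using ux vx by simp
qed

locale rigid_Z2 = rigid_PL_group G + Z2_action R for G R +
  assumes R_in: "R m n \<in> G" and R_inj: "R m n = id \<Longrightarrow> m = 0 \<and> n = 0"
begin

lemma R_cancel: "R m n (R (- m) (- n) p) = p" "R (- m) (- n) (R m n p) = p"
  by (simp_all add: R_R R_id)

lemma R_pow: "R 1 0 ^^ N = R (int N) 0" "R 0 1 ^^ N = R 0 (int N)"
proof -
  show "R 1 0 ^^ N = R (int N) 0" by (induction N) (simp_all add: R_zero R_add)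
  show "R 0 1 ^^ N = R 0 (int N)" by (induction N) (simp_all add: R_zero R_add)
qed

text \<open>
  After passing to a subgroup of finite index, the whole of \<open>\<int>\<^sup>2\<close> fixes a point \<open>p\<close>. A nontrivial \<open>k\<close> in
  it that fixes \<open>t p\<close> shares the fixed point \<open>p\<close> with its conjugate by \<open>t\<close>.
\<close>

lemma commuting_pair_of_fixed_point:
  assumes t: "t \<in> G" and mn: "m \<noteq> 0 \<or> n \<noteq> 0" "R m n p0 = p0"
  shows "\<exists>m n. (m \<noteq> 0 \<or> n \<noteq> 0) \<and> R m n \<circ> t = t \<circ> R m n"
proof -
  obtain F where F: "lifts F (R m n)" using R_lift by blast
  have "R m n \<noteq> id" using R_inj mn(1) by blast
  then obtain p where p: "\<And>K k. lifts K k \<Longrightarrow> k \<circ> R m n = R m n \<circ> k \<Longrightarrow> \<exists>N\<ge>1. (k ^^ N) p = p"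
    using commuting_periodic_point[OF F _ mn(2)] by metis
  have comm: "R i j \<circ> R m n = R m n \<circ> R i j" for i j by (simp add: R_add add.commute)
  have "\<exists>N\<ge>1. (R i j ^^ N) p = p" for i j
    using p[OF _ comm[of i j]] R_lift[of i j] by blast
  then obtain M N where MN: "M \<ge> 1" "(R 1 0 ^^ M) p = p" "N \<ge> 1" "(R 0 1 ^^ N) p = p" by metis
  then have base: "R (int M) 0 p = p" "R 0 (int N) p = p" by (simp_all add: R_pow)
  have multiple: "R (i * a) (i * b) p = p" if ab: "R a b p = p" for a b i
  proof -
    have nat: "R (int i * a) (int i * b) p = p" for i
    proof (induction i)
      case (Suc i)
      have "R (int (Suc i) * a) (int (Suc i) * b) p = R a b (R (int i * a) (int i * b) p)"
        by (simp add: R_R algebra_simps)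
      then show ?case using Suc ab by simp
    qed (simp add: R_id)
    show ?thesis
    proof (cases "i \<ge> 0")
      case True
      then show ?thesis using nat[of "nat i"] by simp
    next
      case False
      then have "R (- (i * a)) (- (i * b)) p = p" using nat[of "nat (- i)"] by simp
      then show ?thesis using R_cancel(1)[of "i * a" "i * b" p] by simp
    qed
  qed
  interpret S: Z2_action "\<lambda>i j. R (i * int M) (j * int N)"
    by unfold_locales (simp_all add: R_PL R_lift R_add R_zero algebra_simps)
  have fixp: "R (i * int M) (j * int N) p = p" for i j
  proof -
    have "R (i * int M) (j * int N) p = R (i * int M) (i * 0) (R (j * 0) (j * int N) p)" by (simp add: R_R)
    then show ?thesis using multiple base by presburger
  qed
  obtain i j where ij: "i \<noteq> 0 \<or> j \<noteq> 0" "R (i * int M) (j * int N) (t p) = t p"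
    using S.nontrivial_stabilizer[OF fixp, of "t p"] by blast
  define k where "k = R (i * int M) (j * int N)"
  obtain t' where t': "t' \<in> G" "t \<circ> t' = id" "t' \<circ> t = id" using inverse[OF t] by blast
  define s where "s = t' \<circ> k \<circ> t"
  have kG: "k \<in> G" and sG: "s \<in> G" using R_in t t' comp by (auto simp: k_def s_def)
  have "k \<circ> s = s \<circ> k"
  proof (rule common_fixed_point_commute[OF kG _ sG])
    show "k p = p" unfolding k_def by (rule fixp)
    have "s p = t' (t p)" using ij(2) by (simp add: s_def k_def)
    then show "s p = p" using t'(3) by (metis comp_apply id_apply)
  qed
  moreover have kt: "k \<circ> t = t \<circ> s" unfolding s_def using t'(2) by (metis comp_assoc id_comp)
  ultimately have "s \<circ> t = t \<circ> s" using conj_rigidD[OF rigid sG t kG kt] by metis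
  then have "s \<circ> t = k \<circ> t" using kt by simp
  then have "(s \<circ> t) \<circ> t' = (k \<circ> t) \<circ> t'" by simp
  then have "s = k" using t'(2) by (simp add: comp_assoc)
  then have "k \<circ> t = t \<circ> k" using kt by simp
  moreover have "i * int M \<noteq> 0 \<or> j * int N \<noteq> 0" using ij(1) MN by auto
  ultimately show ?thesis unfolding k_def by blast
qed

lemma conj_commute:
  assumes "g \<in> G" "h \<in> G" "h' \<in> G" "h' \<circ> h = id" "g \<circ> (h \<circ> g \<circ> h') = (h \<circ> g \<circ> h') \<circ> g"
  shows "g \<circ> h = h \<circ> g"
proof (rule conj_rigidD[OF rigid assms(1,2) _ _ assms(5)])
  show "h \<circ> g \<circ> h' \<in> G" using assms comp by blast
  show "h \<circ> g \<circ> h' \<circ> h = h \<circ> g" using assms(4) by (simp add: comp_assoc)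
qed

text \<open>
  Choose \<open>y\<close> such that \<open>y\<close> and \<open>y' = t\<inverse> y\<close> avoid \<open>D\<close> and \<open>t\<inverse>\<close> is affine near \<open>y\<close>. An element \<open>\<sigma>\<close> of \<open>\<int>\<^sup>2\<close>
  that almost returns both points is affine near both, so \<open>\<sigma>\<close> and \<open>\<tau> = t \<sigma> t\<inverse>\<close> are affine and close to
  the identity near \<open>y\<close>. Then \<open>u = [\<sigma>, \<tau>]\<close> and \<open>v = \<sigma> u \<sigma>\<inverse>\<close> commute near \<open>y\<close>, that is, \<open>x = [u, v]\<close>
  fixes all points near \<open>y\<close>. So \<open>x\<close> and \<open>\<sigma> x \<sigma>\<inverse>\<close> share a fixed point and commute, and by rigidity \<open>x\<close>
  commutes with \<open>\<sigma>\<close>. As no power of \<open>\<sigma>\<close> has a fixed point, \<open>x\<close> is trivial. Three more applications of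
  rigidity give that \<open>\<sigma>\<close> commutes with \<open>u\<close>, with \<open>\<tau>\<close> and with \<open>t\<close>.
\<close>

lemma commuting_pair_of_free_action:
  assumes t: "t \<in> G" and free: "\<And>m n p. R m n p = p \<Longrightarrow> m = 0 \<and> n = 0"
  shows "\<exists>m n. (m \<noteq> 0 \<or> n \<noteq> 0) \<and> R m n \<circ> t = t \<circ> R m n"
proof -
  have "\<exists>D. finite D \<and>
      (\<forall>p\<in>UNIV. \<forall>m n. p \<notin> D \<longrightarrow> R m n p \<notin> D \<longrightarrow> locally_affine_at (R m n) p)"
    by (rule finitely_many_breaks) (rule UNIV_I, rule free)
  then obtain D where D: "finite D"
    "\<forall>p\<in>UNIV. \<forall>m n. p \<notin> D \<longrightarrow> R m n p \<notin> D \<longrightarrow> locally_affine_at (R m n) p" by (elim exE conjE)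
  interpret free_Z2_action R D
    by unfold_locales (use free D in blast)+
  obtain t' where t': "t' \<in> G" "t \<circ> t' = id" "t' \<circ> t = id" using inverse[OF t] by blast
  obtain A where A: "finite A" "\<And>p. p \<notin> A \<Longrightarrow> locally_affine_at t' p"
    using PL[OF t'(1)] unfolding PL_homeo_def by blast
  obtain F where F: "lifts F (R 1 0)" using R_lift by blast
  obtain S where S: "lifts S t'" using lift[OF t'(1)] by blast
  have "\<exists>y. circle_of y \<notin> D \<union> A \<union> t ` D"
  proof (rule ccontr)
    assume "\<not> ?thesis"
    then have "{0..1::real} \<subseteq> {y. circle_of y \<in> D \<union> A \<union> t ` D} \<inter> {0..1}" by auto
    moreover have "finite \<dots>" using D(1) A(1) by (intro finite_circle_of_vimage) auto
    ultimately have "finite {0..1::real}" by (rule finite_subset)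
    then show False by (simp add: infinite_Icc)
  qed
  then obtain y where y: "circle_of y \<notin> D" "circle_of y \<notin> A" "circle_of y \<notin> t ` D" by auto
  define y' where "y' = S y"
  have cy': "circle_of y' = t' (circle_of y)" unfolding y'_def by (rule lifts_circle_of[OF S])
  have "t (t' p) = p" "t' (t p) = p" for p using t' by (metis comp_apply id_apply)+
  then have y'D: "circle_of y' \<notin> D" using y(3) cy' by (metis imageI)
  obtain \<alpha> \<beta> where "\<forall>\<^sub>F x in nhds y. S x = \<alpha> * x + \<beta>"
    using lifts_locally_affine[OF S A(2)[OF y(2)]] by blast
  then obtain \<rho> where \<rho>: "\<rho> > 0" "\<And>x. \<bar>x - y\<bar> < \<rho> \<Longrightarrow> S x = \<alpha> * x + \<beta>"
    unfolding eventually_nhds_metric dist_real_def by blast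
  have \<alpha>: "\<alpha> > 0"
  proof -
    have "S y < S (y + \<rho> / 2)" using \<rho>(1) plmap_less_iff[OF lifts_plmap[OF S]] by simp
    then show ?thesis using \<rho>(1) \<rho>(2)[of y] \<rho>(2)[of "y + \<rho> / 2"] by (simp add: algebra_simps zero_less_mult_iff)
  qed
  have Sx: "S x = y' + \<alpha> * (x - y)" if "\<bar>x - y\<bar> < \<rho>" for x
    using \<rho>(2)[OF that] \<rho>(2)[of y] \<rho>(1) by (simp add: y'_def algebra_simps)
  obtain r1 where r1: "r1 > 0" "\<And>x. \<bar>x - y\<bar> < r1 \<Longrightarrow> circle_of x \<notin> D"
    using avoid_finite_ball[OF D(1) y(1)] by blast
  obtain r2 where r2: "r2 > 0" "\<And>x. \<bar>x - y'\<bar> < r2 \<Longrightarrow> circle_of x \<notin> D"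
    using avoid_finite_ball[OF D(1) y'D] by blast
  (* On the ball of radius r around y everything is affine: the return map, t', and the return map on
     the image of the ball under t'. *)
  define r where "r = min (r1 / 2) (min (r2 / (2 * \<alpha>)) (\<rho> / 2))"
  have r: "r > 0" "r \<le> r1 / 2" "r * \<alpha> \<le> r2 / 2" "r \<le> \<rho> / 2"
  proof -
    show "r > 0" "r \<le> r1 / 2" "r \<le> \<rho> / 2" using r1 r2 \<rho> \<alpha> by (auto simp: r_def)
    have "r * \<alpha> \<le> (r2 / (2 * \<alpha>)) * \<alpha>" using \<alpha> by (intro mult_right_mono) (auto simp: r_def)
    then show "r * \<alpha> \<le> r2 / 2" using \<alpha> by simp
  qed
  (* The words below have at most 15 letters, so r / 100 is a generous step size. *)
  define d where "d = r / 100"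
  define \<delta> where "\<delta> = min (min (r1 / 4) (r2 / 4)) (min (d / 2) (d * \<alpha> / 2))"
  have d: "d > 0" using r(1) by (simp add: d_def)
  have \<delta>: "\<delta> > 0" "\<delta> \<le> r1 / 4" "\<delta> \<le> r2 / 4" "2 * \<delta> \<le> d" "2 * \<delta> \<le> d * \<alpha>"
  proof -
    have "d * \<alpha> > 0" using d \<alpha> by simp
    then show "\<delta> > 0" using r1(1) r2(1) d by (simp add: \<delta>_def)
    show "\<delta> \<le> r1 / 4" "\<delta> \<le> r2 / 4" unfolding \<delta>_def by linarith+
    have "\<delta> \<le> d / 2" "\<delta> \<le> d * \<alpha> / 2" unfolding \<delta>_def by linarith+
    then show "2 * \<delta> \<le> d" "2 * \<delta> \<le> d * \<alpha>" by linarith+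
  qed
  obtain n k k' where n: "n \<ge> 1" "\<bar>(F ^^ n) y + of_int k - y\<bar> < \<delta>" "\<bar>(F ^^ n) y' + of_int k' - y'\<bar> < \<delta>"
    using simultaneous_return[OF F \<delta>(1)] by metis
  define l where "l = (\<lambda>x. (F ^^ n) x + of_int k)"
  define l' where "l' = (\<lambda>x. (F ^^ n) x + of_int k')"
  have l: "lifts l (R (int n) 0)" and l': "lifts l' (R (int n) 0)"
    unfolding l_def l'_def by (intro lifts_shift lifts_R_pow F)+
  have ly: "\<bar>l y - y\<bar> \<le> \<delta>" "\<bar>l' y' - y'\<bar> \<le> \<delta>" using n by (auto simp: l_def l'_def)
  have n0: "int n \<noteq> 0 \<or> (0::int) \<noteq> 0" using n(1) by simp
  have move: "\<bar>z + s * x - x\<bar> \<le> 2 * \<delta>"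
    if "\<bar>s - 1\<bar> \<le> \<delta> / c" "c > 0" "\<bar>x\<bar> \<le> c / 2" "\<bar>z\<bar> \<le> \<delta>" for s x z c :: real
  proof -
    have "\<bar>s - 1\<bar> * \<bar>x\<bar> \<le> (\<delta> / c) * (c / 2)" using that \<delta>(1) by (intro mult_mono) auto
    then have "\<bar>(s - 1) * x\<bar> \<le> \<delta> / 2" using that(2) by (simp add: abs_mult)
    moreover have "z + s * x - x = z + (s - 1) * x" by (simp add: algebra_simps)
    ultimately show ?thesis using that(4) \<delta>(1) by linarith
  qed
  have slope_pos: "s > 0" if "\<bar>s - 1\<bar> \<le> \<delta> / c" "c > 0" "\<delta> \<le> c / 4" for s c :: real
  proof -
    have "\<delta> / c \<le> 1 / 4" using that by (simp add: field_simps)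
    then show ?thesis using that(1) by linarith
  qed
  obtain s where s: "\<bar>s - 1\<bar> \<le> \<delta> / r1" "\<And>x. \<bar>x - y\<bar> \<le> r1 / 2 \<Longrightarrow> l x = l y + s * (x - y)"
    using near_identity[OF l n0 r1 \<delta>(1,2) ly(1)] by blast
  obtain s' where s': "\<bar>s' - 1\<bar> \<le> \<delta> / r2" "\<And>x. \<bar>x - y'\<bar> \<le> r2 / 2 \<Longrightarrow> l' x = l' y' + s' * (x - y')"
    using near_identity[OF l' n0 r2 \<delta>(1,3) ly(2)] by blast
  have near_l: "affine_near y r d 1 s l"
    unfolding affine_near_def
  proof (intro conjI exI[of _ "l y - s * y"] allI impI)
    show "s > 0" by (rule slope_pos[OF s(1) r1(1) \<delta>(2)])
    fix x assume "\<bar>x - y\<bar> \<le> r - real 1 * d"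
    then have x: "\<bar>x - y\<bar> \<le> r1 / 2" using r(2) d by simp
    show "l x = s * x + (l y - s * y)" using s(2)[OF x] by (simp add: algebra_simps)
    have "\<bar>(l y - y) + s * (x - y) - (x - y)\<bar> \<le> 2 * \<delta>" by (rule move[OF s(1) r1(1) x ly(1)])
    then show "\<bar>l x - x\<bar> \<le> real 1 * d" using s(2)[OF x] \<delta>(4) by (simp add: algebra_simps)
  qed
  define Si where "Si = inv_into UNIV S"
  have Si: "lifts Si t" unfolding Si_def by (rule lifts_inv[OF S t'(2)])
  have SiS: "Si (S x) = x" for x unfolding Si_def by (rule plmap_inv_left[OF lifts_plmap[OF S]])
  define m where "m = Si \<circ> l' \<circ> S"
  have m: "lifts m (t \<circ> R (int n) 0 \<circ> t')" unfolding m_def by (intro lifts_comp Si l' S)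
  have near_m: "affine_near y r d 1 s' m"
    unfolding affine_near_def
  proof (intro conjI exI[of _ "y + (l' y' - y') / \<alpha> - s' * y"] allI impI)
    show "s' > 0" by (rule slope_pos[OF s'(1) r2(1) \<delta>(3)])
    fix x assume "\<bar>x - y\<bar> \<le> r - real 1 * d"
    then have x: "\<bar>x - y\<bar> \<le> r" "\<bar>x - y\<bar> < \<rho>" using r d by auto
    have "\<bar>\<alpha> * (x - y)\<bar> \<le> \<alpha> * r" unfolding abs_mult using \<alpha> x(1) by simp
    then have ax: "\<bar>\<alpha> * (x - y)\<bar> \<le> r2 / 2" using r(3) by (simp add: mult.commute)
    then have lS: "l' (S x) = l' y' + s' * (\<alpha> * (x - y))" using s'(2)[of "S x"] Sx[OF x(2)] by simp
    define z where "z = x + ((l' y' - y') + s' * (\<alpha> * (x - y)) - \<alpha> * (x - y)) / \<alpha>"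
    have "\<bar>(l' y' - y') + s' * (\<alpha> * (x - y)) - \<alpha> * (x - y)\<bar> \<le> 2 * \<delta>"
      by (rule move[OF s'(1) r2(1) ax ly(2)])
    then have "\<bar>(l' y' - y') + s' * (\<alpha> * (x - y)) - \<alpha> * (x - y)\<bar> / \<alpha> \<le> d"
      using \<alpha> \<delta>(5) by (simp add: pos_divide_le_eq)
    then have zx: "\<bar>z - x\<bar> \<le> d" using \<alpha> by (simp add: z_def abs_divide)
    moreover have "d < r" using r(1) by (simp add: d_def)
    ultimately have "\<bar>z - y\<bar> < \<rho>" using x(1) r(1,4) by linarith
    then have "S z = y' + \<alpha> * (z - y)" by (rule Sx)
    also have "\<dots> = l' (S x)" unfolding lS z_def using \<alpha> by (simp add: field_simps)
    finally have mx: "m x = z" using SiS[of z] by (simp add: m_def)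
    show "m x = s' * x + (y + (l' y' - y') / \<alpha> - s' * y)"
      unfolding mx z_def using \<alpha> by (simp add: field_simps)
    show "\<bar>m x - x\<bar> \<le> real 1 * d" using zx mx by simp
  qed
  define li where "li = inv_into UNIV l"
  define mi where "mi = inv_into UNIV m"
  define U where "U = l \<circ> m \<circ> li \<circ> mi"
  define V where "V = l \<circ> U \<circ> li"
  have comm: "U (V x) = V (U x)" if "\<bar>x - y\<bar> \<le> r - 15 * d" for x
    unfolding U_def V_def li_def mi_def
    using that by (intro local_second_commutator[OF lifts_plmap[OF l] near_l lifts_plmap[OF m] near_m]) (use d in auto)
  define \<sigma> where "\<sigma> = R (int n) 0"
  define \<sigma>' where "\<sigma>' = R (- int n) 0"
  have \<sigma>: "\<sigma> \<in> G" "\<sigma>' \<in> G" "\<sigma>' \<circ> \<sigma> = id" "\<sigma> \<circ> \<sigma>' = id"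
    using R_in by (simp_all add: \<sigma>_def \<sigma>'_def R_add R_zero)
  define \<tau> where "\<tau> = t \<circ> \<sigma> \<circ> t'"
  define \<tau>' where "\<tau>' = t \<circ> \<sigma>' \<circ> t'"
  have \<tau>: "\<tau> \<in> G" "\<tau>' \<in> G" "\<tau>' \<circ> \<tau> = id" "\<tau> \<circ> \<tau>' = id"
    using t t' \<sigma> comp unfolding \<tau>_def \<tau>'_def by (auto simp: fun_eq_iff)
  define u where "u = \<sigma> \<circ> \<tau> \<circ> \<sigma>' \<circ> \<tau>'"
  define v where "v = \<sigma> \<circ> u \<circ> \<sigma>'"
  have uG: "u \<in> G" and vG: "v \<in> G" using \<sigma> \<tau> comp by (auto simp: u_def v_def)
  have li: "lifts li \<sigma>'" unfolding li_def by (rule lifts_inv[OF l]) (use \<sigma> in \<open>simp add: \<sigma>_def\<close>)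
  have mi: "lifts mi \<tau>'" unfolding mi_def by (rule lifts_inv[OF m]) (use \<tau> in \<open>simp add: \<tau>_def \<sigma>_def\<close>)
  have U: "lifts U u" unfolding U_def u_def
    by (intro lifts_comp li mi) (use l m in \<open>simp_all add: \<sigma>_def \<tau>_def\<close>)
  have V: "lifts V v" unfolding V_def v_def
    by (intro lifts_comp li U) (use l in \<open>simp add: \<sigma>_def\<close>)
  have vuG: "v \<circ> u \<in> G" using uG vG comp by blast
  obtain w where w: "w \<in> G" "w \<circ> (v \<circ> u) = id" "(v \<circ> u) \<circ> w = id" using inverse[OF vuG] by blast
  define x where "x = w \<circ> (u \<circ> v)"
  have xG: "x \<in> G" using uG vG w comp by (simp add: x_def)
  have x_fix: "x (circle_of a) = circle_of a" if "\<bar>a - y\<bar> \<le> r - 15 * d" for a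
  proof -
    have "(u \<circ> v) (circle_of a) = (v \<circ> u) (circle_of a)"
      using comm[OF that] lifts_circle_of[OF U] lifts_circle_of[OF V] by (metis comp_apply)
    then show ?thesis using w(2) by (metis comp_apply id_apply x_def)
  qed
  have rd: "r - 15 * d \<ge> 2 * d" "r - 15 * d \<ge> 0" "r - 2 * d \<ge> 0" using r(1) by (auto simp: d_def)
  have "affine_near y r d (2 * 1) (1 / s) li"
    unfolding li_def by (rule affine_near_inv[OF near_l lifts_plmap[OF l]]) (use d in simp)
  moreover have "\<bar>y - y\<bar> \<le> r - real (2 * 1) * d" using rd(3) by simp
  ultimately have "\<bar>li y - y\<bar> \<le> real (2 * 1) * d" unfolding affine_near_def by blast
  then have "\<bar>li y - y\<bar> \<le> 2 * d" by simp
  then have "x (circle_of (li y)) = circle_of (li y)" using rd(1) by (intro x_fix) linarith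
  then have x1: "x (\<sigma>' (circle_of y)) = \<sigma>' (circle_of y)" by (simp add: lifts_circle_of[OF li])
  have x0: "x (circle_of y) = circle_of y" using rd by (intro x_fix) simp
  have "x \<circ> (\<sigma> \<circ> x \<circ> \<sigma>') = (\<sigma> \<circ> x \<circ> \<sigma>') \<circ> x"
  proof (rule common_fixed_point_commute[OF xG x0])
    show "\<sigma> \<circ> x \<circ> \<sigma>' \<in> G" using \<sigma> xG comp by blast
    show "(\<sigma> \<circ> x \<circ> \<sigma>') (circle_of y) = circle_of y" using x1 \<sigma>(4) by (metis comp_apply id_apply)
  qed
  then have x\<sigma>: "x \<circ> \<sigma> = \<sigma> \<circ> x" by (rule conj_commute[OF xG \<sigma>(1,2,3)])
  have "x = id"
  proof (rule ccontr)
    assume nid: "x \<noteq> id"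
    obtain Fx where "lifts Fx x" using lift[OF xG] by blast
    then obtain p where "\<exists>N\<ge>1. (\<sigma> ^^ N) p = p"
      using commuting_periodic_point[OF _ nid x0] l x\<sigma> unfolding \<sigma>_def by metis
    then obtain N where N: "N \<ge> 1" "(\<sigma> ^^ N) p = p" by blast
    have "\<sigma> ^^ N = R (int N * int n) 0"
      unfolding \<sigma>_def by (induction N) (simp_all add: R_zero R_add algebra_simps)
    then have "int N * int n = 0" using free[of "int N * int n" 0 p] N(2) by simp
    then show False using N(1) n(1) by simp
  qed
  then have "(v \<circ> u) \<circ> x = v \<circ> u" by simp
  then have "u \<circ> v = v \<circ> u" unfolding x_def using w(3) by (metis comp_assoc id_comp)
  then have "u \<circ> \<sigma> = \<sigma> \<circ> u" unfolding v_def by (rule conj_commute[OF uG \<sigma>(1,2,3)])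
  then have pt: "\<sigma> (\<tau> (\<sigma>' (\<tau>' (\<sigma> p)))) = \<sigma> (\<sigma> (\<tau> (\<sigma>' (\<tau>' p))))" for p
    by (simp add: u_def fun_eq_iff)
  have cancel: "\<sigma>' (\<sigma> p) = p" "\<sigma> (\<sigma>' p) = p" "\<tau>' (\<tau> p) = p" "\<tau> (\<tau>' p) = p" for p
    using \<sigma>(3,4) \<tau>(3,4) by (metis comp_apply id_apply)+
  have pt': "\<tau> (\<sigma>' (\<tau>' (\<sigma> p))) = \<sigma> (\<tau> (\<sigma>' (\<tau>' p)))" for p using pt cancel by metis
  have "\<sigma> (\<tau> (\<sigma> (\<tau>' p))) = \<tau> (\<sigma> (\<tau>' (\<sigma> p)))" for p
  proof -
    have "\<tau> (\<sigma>' (\<tau>' (\<sigma> (\<tau> (\<sigma> (\<tau>' p)))))) = \<sigma> p" using pt'[of "\<tau> (\<sigma> (\<tau>' p))"] cancel by simp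
    then have "\<tau> (\<sigma> (\<tau>' (\<tau> (\<sigma>' (\<tau>' (\<sigma> (\<tau> (\<sigma> (\<tau>' p))))))))) = \<tau> (\<sigma> (\<tau>' (\<sigma> p)))" by simp
    then show ?thesis by (simp only: cancel)
  qed
  then have "\<sigma> \<circ> (\<tau> \<circ> \<sigma> \<circ> \<tau>') = (\<tau> \<circ> \<sigma> \<circ> \<tau>') \<circ> \<sigma>" by (simp add: fun_eq_iff)
  then have "\<sigma> \<circ> \<tau> = \<tau> \<circ> \<sigma>" by (rule conj_commute[OF \<sigma>(1) \<tau>(1,2,3)])
  then have "\<sigma> \<circ> t = t \<circ> \<sigma>" unfolding \<tau>_def by (rule conj_commute[OF \<sigma>(1) t t'(1,3)])
  then show ?thesis using n0 unfolding \<sigma>_def by blast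
qed

theorem commuting_pair:
  assumes "t \<in> G"
  shows "\<exists>m n. (m \<noteq> 0 \<or> n \<noteq> 0) \<and> R m n \<circ> t = t \<circ> R m n"
  using commuting_pair_of_fixed_point[OF assms] commuting_pair_of_free_action[OF assms] by blast

end

section \<open>Rigidity of a congruence subgroup of \<open>SL\<^sub>2(\<int>[X])\<close>\<close>

text \<open>
  The factors \<open>t - u\<close> and \<open>t + u\<close> of \<open>4\<close> are constants.
\<close>

lemma int_poly_square_minus_four:
  fixes t u :: "int poly"
  assumes "u\<^sup>2 = t\<^sup>2 - 4" "coeff t 0 = 2"
  shows "u = 0"
proof -
  have prod: "(t - u) * (t + u) = 4" using assms(1) by (simp add: algebra_simps power2_eq_square)
  then have nz: "t - u \<noteq> 0" "t + u \<noteq> 0" by auto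
  have "degree (t - u) + degree (t + u) = 0"
    using degree_mult_eq[OF nz] prod by simp
  then have "degree (t - u + (t + u)) = 0" using degree_add_le[of "t - u" 0 "t + u"] by simp
  then have "degree (2 * t) = 0" by (simp add: algebra_simps flip: mult_2)
  then have "degree t = 0" using degree_mult_eq[of "2 :: int poly" t] by (cases "t = 0") auto
  then have "t = [:2:]" using assms(2) by (metis degree_eq_zeroE coeff_pCons_0)
  then have "u\<^sup>2 = 0" using assms(1) by (simp add: power2_eq_square numeral_poly)
  then show ?thesis by simp
qed

text \<open>
  The triples \<open>(p, q, r)\<close> and \<open>(p', q', r')\<close> stand for the traceless matrices
  \<open>N = (p, 2 q; 2 r, - p)\<close> and \<open>M = B N B\<inverse>\<close>, where \<open>B = (x, y; z, w)\<close>; they are parallel since \<open>M\<close> and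
  \<open>N\<close> commute, and the claim is that \<open>B\<close> and \<open>N\<close> commute. Both have the same determinant
  \<open>- (p\<^sup>2 + 4 q r)\<close>. If it is not zero, then \<open>M = \<plusminus> N\<close>, and the minus sign would force
  \<open>tr B = 0\<close>. If it is zero, then \<open>N\<^sup>2 = M N = 0\<close>, hence \<open>tr (B N) = 0\<close>, so \<open>B\<close> preserves the kernel of
  \<open>N\<close> and has an eigenvalue in the fraction field. Then \<open>(tr B)\<^sup>2 - 4\<close> is a square, so \<open>tr B = 2\<close>.
\<close>

lemma conjugate_commuting_vectors:
  fixes p q r p' q' r' x y z w :: "int poly"
  assumes det: "x * w - y * z = 1" and tr: "coeff (x + w) 0 = 2"
    and MB: "p' * x + 2 * q' * z = x * p + 2 * y * r" "p' * y + 2 * q' * w = 2 * x * q - y * p"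
      "2 * r' * x - p' * z = z * p + 2 * w * r" "2 * r' * y - p' * w = 2 * z * q - w * p"
    and par: "p * q' = p' * q" "p * r' = p' * r" "q * r' = q' * r"
  shows "q * z = r * y \<and> p * y = q * (x - w) \<and> p * z = r * (x - w)"
proof (cases "p = 0 \<and> q = 0 \<and> r = 0")
  case True
  then show ?thesis by simp
next
  case n0: False
  define t where "t = x + w"
  have t0: "t \<noteq> 0" using tr unfolding t_def by (metis coeff_0 zero_neq_numeral)
  have cdet: "p'^2 + 4 * q' * r' = p^2 + 4 * q * r"
  proof -
    have "p' * (x * w - y * z) = w * (p' * x + 2 * q' * z) - z * (p' * y + 2 * q' * w)"
      "2 * q' * (x * w - y * z) = x * (p' * y + 2 * q' * w) - y * (p' * x + 2 * q' * z)"
      "2 * r' * (x * w - y * z) = w * (2 * r' * x - p' * z) - z * (2 * r' * y - p' * w)"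
      by (simp_all add: algebra_simps)
    note e = this[unfolded MB det mult_1_right]
    have "p'^2 + 4 * q' * r' = p'^2 + (2 * q') * (2 * r')" by simp
    also have "\<dots> = (p^2 + 4 * q * r) * (x * w - y * z)^2"
      unfolding e by (simp add: algebra_simps power2_eq_square)
    finally show ?thesis by (simp add: det)
  qed
  show ?thesis
  proof (cases "p^2 + 4 * q * r = 0")
    case False
    have "p^2 * (p'^2 + 4 * q' * r') = p^2 * p'^2 + 4 * ((p * q') * (p * r'))"
      "q^2 * (p'^2 + 4 * q' * r') = (p' * q)^2 + 4 * (q * q' * (q * r'))"
      "r^2 * (p'^2 + 4 * q' * r') = (p' * r)^2 + 4 * (r * r' * (q' * r))" by (simp_all add: algebra_simps power2_eq_square)
    moreover have "p^2 * p'^2 + 4 * ((p' * q) * (p' * r)) = p'^2 * (p^2 + 4 * q * r)"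
      "(p * q')^2 + 4 * (q * q' * (q' * r)) = q'^2 * (p^2 + 4 * q * r)"
      "(p * r')^2 + 4 * (r * r' * (q * r')) = r'^2 * (p^2 + 4 * q * r)" by (simp_all add: algebra_simps power2_eq_square)
    ultimately have "p^2 * (p^2 + 4 * q * r) = p'^2 * (p^2 + 4 * q * r)"
      "q^2 * (p^2 + 4 * q * r) = q'^2 * (p^2 + 4 * q * r)"
      "r^2 * (p^2 + 4 * q * r) = r'^2 * (p^2 + 4 * q * r)"
      by (simp_all only: cdet par)
    then have sq: "p^2 = p'^2" "q^2 = q'^2" "r^2 = r'^2" using False mult_right_cancel by blast+
    have transfer: "b' = e * b" if "a' = e * a" "a * b' = a' * b" "a \<noteq> 0" for a a' b b' e :: "int poly"
      using that by (simp add: mult.assoc mult.left_commute[of a])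
    have sign: "\<exists>e. (e = 1 \<or> e = - 1) \<and> a' = e * a" if "a\<^sup>2 = a'\<^sup>2" for a a' :: "int poly"
      using that unfolding power2_eq_iff by (metis minus_minus mult_1 mult_minus1)
    have "\<exists>e. (e = 1 \<or> e = - 1) \<and> p' = e * p \<and> q' = e * q \<and> r' = e * r"
    proof (cases "p = 0")
      case False
      then show ?thesis using sign[OF sq(1)] transfer[OF _ par(1)] transfer[OF _ par(2)] by blast
    next
      case p: True
      then have p': "p' = 0" using sq(1) by simp
      show ?thesis
      proof (cases "q = 0")
        case False
        then show ?thesis using sign[OF sq(2)] transfer[OF _ par(3)] p p' by auto
      next
        case True
        then have "q' = 0" using sq(2) by simp
        then show ?thesis using True sign[OF sq(3)] p p' by auto
      qed
    qed
    then have "(p' = p \<and> q' = q \<and> r' = r) \<or> (p' = - p \<and> q' = - q \<and> r' = - r)" by auto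
    then show ?thesis
    proof
      assume eq: "p' = p \<and> q' = q \<and> r' = r"
      have "2 * (q * z) = 2 * (r * y)" "2 * (p * y) = 2 * (q * (x - w))" "2 * (p * z) = 2 * (r * (x - w))"
        using MB eq by (simp_all add: algebra_simps)
      then show ?thesis using mult_left_cancel[of "2 :: int poly"] by simp
    next
      assume eq: "p' = - p \<and> q' = - q \<and> r' = - r"
      have "2 * (p * t) = 0" "2 * (q * t) = 0" "2 * (r * t) = 0"
        unfolding t_def using MB eq by algebra+
      then show ?thesis using n0 t0 by simp
    qed
  next
    case disc: True
    have pp: "p * p' + 4 * q' * r = 0"
    proof -
      have "p * (p * p' + 4 * q' * r) = 0" "q * (p * p' + 4 * q' * r) = 0" "r * (p * p' + 4 * q' * r) = 0"
        using disc par by algebra+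
      then show ?thesis using n0 by auto
    qed
    define s where "s = p * (x - w) + 2 * (y * r + z * q)"
    have "p * s = 0" "2 * (q * s) = 0" "2 * (r * s) = 0"
      unfolding s_def using disc par pp MB by algebra+
    then have s: "s = 0" using n0 by auto
    have square0: "a * (x - w) = b" if sq: "(a * (x - w) - b)\<^sup>2 = a\<^sup>2 * (t\<^sup>2 - 4)" and a: "a \<noteq> 0" for a b
    proof -
      have "a\<^sup>2 dvd (a * (x - w) - b)\<^sup>2" using sq by simp
      then have "a dvd a * (x - w) - b" by (simp add: pow_divides_pow_iff)
      then obtain u where u: "a * (x - w) - b = a * u" by (elim dvdE)
      then have "a\<^sup>2 * u\<^sup>2 = a\<^sup>2 * (t\<^sup>2 - 4)" using sq by (simp add: power_mult_distrib)
      then have "u\<^sup>2 = t\<^sup>2 - 4" using a by simp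
      then have "u = 0" using tr unfolding t_def by (rule int_poly_square_minus_four)
      then show ?thesis using u by simp
    qed
    have s': "p * (x - w) + 2 * (y * r + z * q) = 0" using s by (simp add: s_def)
    have pk: "p * (x - w) = - 2 * (y * r + z * q)" and p2: "p * p = - 4 * q * r"
      using s' disc by (simp_all add: eq_neg_iff_add_eq_0 power2_eq_square)
    have kt: "(x - w)\<^sup>2 + 4 * y * z = t\<^sup>2 - 4"
    proof -
      have "(x - w)\<^sup>2 + 4 * y * z = t\<^sup>2 - 4 * (x * w - y * z)"
        unfolding t_def by (simp add: algebra_simps power2_eq_square)
      then show ?thesis by (simp add: det)
    qed
    have "q \<noteq> 0 \<or> r \<noteq> 0"
    proof (rule ccontr)
      assume qr: "\<not> (q \<noteq> 0 \<or> r \<noteq> 0)"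
      then have "p = 0" using p2 by simp
      then show False using n0 qr by simp
    qed
    then show ?thesis
    proof
      assume q: "q \<noteq> 0"
      have 1: "q * (x - w) = p * y"
      proof (rule square0[OF _ q])
        show "(q * (x - w) - p * y)\<^sup>2 = q\<^sup>2 * (t\<^sup>2 - 4)"
        proof -
          have "(q * (x - w) - p * y)\<^sup>2 = q\<^sup>2 * (x - w)\<^sup>2 - 2 * q * y * (p * (x - w)) + (p * p) * y\<^sup>2"
            by (simp add: algebra_simps power2_eq_square)
          also have "\<dots> = q\<^sup>2 * ((x - w)\<^sup>2 + 4 * y * z)"
            unfolding pk p2 by (simp add: algebra_simps power2_eq_square)
          finally show ?thesis unfolding kt .
        qed
      qed
      have "2 * q * (q * z - r * y) = 0" using 1 s' disc by algebra
      then have 2: "q * z = r * y" using q by simp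
      have "q * (p * z - r * (x - w)) = 0" using 1 2 by algebra
      then show ?thesis using 1 2 q by simp
    next
      assume r: "r \<noteq> 0"
      have 1: "r * (x - w) = p * z"
      proof (rule square0[OF _ r])
        show "(r * (x - w) - p * z)\<^sup>2 = r\<^sup>2 * (t\<^sup>2 - 4)"
        proof -
          have "(r * (x - w) - p * z)\<^sup>2 = r\<^sup>2 * (x - w)\<^sup>2 - 2 * r * z * (p * (x - w)) + (p * p) * z\<^sup>2"
            by (simp add: algebra_simps power2_eq_square)
          also have "\<dots> = r\<^sup>2 * ((x - w)\<^sup>2 + 4 * y * z)"
            unfolding pk p2 by (simp add: algebra_simps power2_eq_square)
          finally show ?thesis unfolding kt .
        qed
      qed
      have "2 * r * (q * z - r * y) = 0" using 1 s' disc by algebra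
      then have 2: "q * z = r * y" using r by simp
      have "r * (p * y - q * (x - w)) = 0" using 1 2 by algebra
      then show ?thesis using 1 2 r by simp
    qed
  qed
qed

definition mk2 :: "int poly \<Rightarrow> int poly \<Rightarrow> int poly \<Rightarrow> int poly \<Rightarrow> int poly^2^2" where
  "mk2 a b c d = vector [vector [a, b], vector [c, d]]"

lemma mk2_nth [simp]:
  "mk2 a b c d $ 1 $ 1 = a" "mk2 a b c d $ 1 $ 2 = b" "mk2 a b c d $ 2 $ 1 = c" "mk2 a b c d $ 2 $ 2 = d"
  by (simp_all add: mk2_def)

lemma mat2_eq_iff: "A = (B :: int poly^2^2) \<longleftrightarrow>
    A$1$1 = B$1$1 \<and> A$1$2 = B$1$2 \<and> A$2$1 = B$2$1 \<and> A$2$2 = B$2$2"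
  by (auto simp: vec_eq_iff forall_2)

lemma mat2_mult: "((A :: int poly^2^2) ** B) $ i $ j = A$i$1 * B$1$j + A$i$2 * B$2$j"
  by (simp add: matrix_matrix_mult_def sum_2)

lemma mat2_one: "(mat 1 :: int poly^2^2) = mk2 1 0 0 1"
  by (simp add: mat2_eq_iff mat_def)

text \<open>
  Matrices of determinant one that are the identity modulo \<open>X\<close>. The congruence makes the trace equal to
  \<open>2\<close> modulo \<open>X\<close>, which excludes elements that conjugate a matrix to its inverse.
\<close>

definition congruence_SL2 :: "int poly^2^2 \<Rightarrow> bool" where
  "congruence_SL2 A \<longleftrightarrow> A$1$1 * A$2$2 - A$1$2 * A$2$1 = 1 \<and>
     coeff (A$1$1) 0 = 1 \<and> coeff (A$1$2) 0 = 0 \<and> coeff (A$2$1) 0 = 0 \<and> coeff (A$2$2) 0 = 1"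

lemma congruence_SL2_mult: "congruence_SL2 A \<Longrightarrow> congruence_SL2 B \<Longrightarrow> congruence_SL2 (A ** B)"
proof -
  assume A: "congruence_SL2 A" and B: "congruence_SL2 B"
  have "(A ** B)$1$1 * (A ** B)$2$2 - (A ** B)$1$2 * (A ** B)$2$1 =
      (A$1$1 * A$2$2 - A$1$2 * A$2$1) * (B$1$1 * B$2$2 - B$1$2 * B$2$1)"
    unfolding mat2_mult by algebra
  then show ?thesis using A B by (simp add: congruence_SL2_def mat2_mult coeff_mult_0)
qed

lemma congruence_SL2_rigid:
  assumes B: "congruence_SL2 B" and CB: "C ** B = B ** A" and AC: "A ** C = C ** A"
  shows "A ** B = B ** A"
proof -
  define p where "p = A$1$1 - A$2$2"
  define p' where "p' = C$1$1 - C$2$2"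
  have det: "B$1$1 * B$2$2 - B$1$2 * B$2$1 = 1" using B by (simp add: congruence_SL2_def)
  have E: "C$1$1 * B$1$1 + C$1$2 * B$2$1 = B$1$1 * A$1$1 + B$1$2 * A$2$1"
    "C$1$1 * B$1$2 + C$1$2 * B$2$2 = B$1$1 * A$1$2 + B$1$2 * A$2$2"
    "C$2$1 * B$1$1 + C$2$2 * B$2$1 = B$2$1 * A$1$1 + B$2$2 * A$2$1"
    "C$2$1 * B$1$2 + C$2$2 * B$2$2 = B$2$1 * A$1$2 + B$2$2 * A$2$2"
    using CB unfolding mat2_eq_iff mat2_mult by auto
  have tr: "C$1$1 + C$2$2 = A$1$1 + A$2$2"
  proof -
    have "(C$1$1 + C$2$2) * (B$1$1 * B$2$2 - B$1$2 * B$2$1) =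
        B$2$2 * (C$1$1 * B$1$1 + C$1$2 * B$2$1) - B$2$1 * (C$1$1 * B$1$2 + C$1$2 * B$2$2)
        - B$1$2 * (C$2$1 * B$1$1 + C$2$2 * B$2$1) + B$1$1 * (C$2$1 * B$1$2 + C$2$2 * B$2$2)"
      by (simp add: algebra_simps)
    also have "\<dots> = (A$1$1 + A$2$2) * (B$1$1 * B$2$2 - B$1$2 * B$2$1)"
      unfolding E by (simp add: algebra_simps)
    finally show ?thesis by (simp add: det)
  qed
  have "A$1$2 * B$2$1 = A$2$1 * B$1$2 \<and> p * B$1$2 = A$1$2 * (B$1$1 - B$2$2) \<and>
      p * B$2$1 = A$2$1 * (B$1$1 - B$2$2)"
  proof (rule conjugate_commuting_vectors[OF det])
    show "coeff (B$1$1 + B$2$2) 0 = 2" using B by (simp add: congruence_SL2_def)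
    show "p' * B$1$1 + 2 * C$1$2 * B$2$1 = B$1$1 * p + 2 * B$1$2 * A$2$1"
      "p' * B$1$2 + 2 * C$1$2 * B$2$2 = 2 * B$1$1 * A$1$2 - B$1$2 * p"
      "2 * C$2$1 * B$1$1 - p' * B$2$1 = B$2$1 * p + 2 * B$2$2 * A$2$1"
      "2 * C$2$1 * B$1$2 - p' * B$2$2 = 2 * B$2$1 * A$1$2 - B$2$2 * p"
    proof -
      have "p' * B$1$1 + 2 * C$1$2 * B$2$1 = 2 * (C$1$1 * B$1$1 + C$1$2 * B$2$1) - (C$1$1 + C$2$2) * B$1$1"
        by (simp add: p'_def algebra_simps)
      also have "\<dots> = B$1$1 * p + 2 * B$1$2 * A$2$1" unfolding E tr by (simp add: p_def algebra_simps)
      finally show "p' * B$1$1 + 2 * C$1$2 * B$2$1 = B$1$1 * p + 2 * B$1$2 * A$2$1" .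
      have "p' * B$1$2 + 2 * C$1$2 * B$2$2 = 2 * (C$1$1 * B$1$2 + C$1$2 * B$2$2) - (C$1$1 + C$2$2) * B$1$2"
        by (simp add: p'_def algebra_simps)
      also have "\<dots> = 2 * B$1$1 * A$1$2 - B$1$2 * p" unfolding E tr by (simp add: p_def algebra_simps)
      finally show "p' * B$1$2 + 2 * C$1$2 * B$2$2 = 2 * B$1$1 * A$1$2 - B$1$2 * p" .
      have "2 * C$2$1 * B$1$1 - p' * B$2$1 = 2 * (C$2$1 * B$1$1 + C$2$2 * B$2$1) - (C$1$1 + C$2$2) * B$2$1"
        by (simp add: p'_def algebra_simps)
      also have "\<dots> = B$2$1 * p + 2 * B$2$2 * A$2$1" unfolding E tr by (simp add: p_def algebra_simps)
      finally show "2 * C$2$1 * B$1$1 - p' * B$2$1 = B$2$1 * p + 2 * B$2$2 * A$2$1" .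
      have "2 * C$2$1 * B$1$2 - p' * B$2$2 = 2 * (C$2$1 * B$1$2 + C$2$2 * B$2$2) - (C$1$1 + C$2$2) * B$2$2"
        by (simp add: p'_def algebra_simps)
      also have "\<dots> = 2 * B$2$1 * A$1$2 - B$2$2 * p" unfolding E tr by (simp add: p_def algebra_simps)
      finally show "2 * C$2$1 * B$1$2 - p' * B$2$2 = 2 * B$2$1 * A$1$2 - B$2$2 * p" .
    qed
    have F: "A$1$1 * C$1$1 + A$1$2 * C$2$1 = C$1$1 * A$1$1 + C$1$2 * A$2$1"
      "A$1$1 * C$1$2 + A$1$2 * C$2$2 = C$1$1 * A$1$2 + C$1$2 * A$2$2"
      "A$2$1 * C$1$1 + A$2$2 * C$2$1 = C$2$1 * A$1$1 + C$2$2 * A$2$1"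
      using AC unfolding mat2_eq_iff mat2_mult by blast+
    show "A$1$2 * C$2$1 = C$1$2 * A$2$1" using F(1) by (simp only: mult.commute[of "A$1$1"] add_left_cancel)
    have "p * C$1$2 - p' * A$1$2 = (A$1$1 * C$1$2 + A$1$2 * C$2$2) - (C$1$1 * A$1$2 + C$1$2 * A$2$2)"
      by (simp add: p_def p'_def algebra_simps)
    then show "p * C$1$2 = p' * A$1$2" unfolding F by simp
    have "p * C$2$1 - p' * A$2$1 = (C$2$1 * A$1$1 + C$2$2 * A$2$1) - (A$2$1 * C$1$1 + A$2$2 * C$2$1)"
      by (simp add: p_def p'_def algebra_simps)
    then show "p * C$2$1 = p' * A$2$1" unfolding F by simp
  qed
  then have G: "A$1$2 * B$2$1 = A$2$1 * B$1$2" "p * B$1$2 = A$1$2 * (B$1$1 - B$2$2)"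
    "p * B$2$1 = A$2$1 * (B$1$1 - B$2$2)" by auto
  show ?thesis
    unfolding mat2_eq_iff mat2_mult
  proof (intro conjI)
    show "A$1$1 * B$1$1 + A$1$2 * B$2$1 = B$1$1 * A$1$1 + B$1$2 * A$2$1"
      unfolding G(1) by (simp add: mult.commute)
    show "A$2$1 * B$1$2 + A$2$2 * B$2$2 = B$2$1 * A$1$2 + B$2$2 * A$2$2"
      unfolding G(1)[symmetric] by (simp add: mult.commute)
    have "(A$1$1 * B$1$2 + A$1$2 * B$2$2) - (B$1$1 * A$1$2 + B$1$2 * A$2$2) = p * B$1$2 - A$1$2 * (B$1$1 - B$2$2)"
      by (simp add: p_def algebra_simps)
    then show "A$1$1 * B$1$2 + A$1$2 * B$2$2 = B$1$1 * A$1$2 + B$1$2 * A$2$2" unfolding G by simp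
    have "(B$2$1 * A$1$1 + B$2$2 * A$2$1) - (A$2$1 * B$1$1 + A$2$2 * B$2$1) = p * B$2$1 - A$2$1 * (B$1$1 - B$2$2)"
      by (simp add: p_def algebra_simps)
    then show "A$2$1 * B$1$1 + A$2$2 * B$2$1 = B$2$1 * A$1$1 + B$2$2 * A$2$1" unfolding G by simp
  qed
qed

section \<open>Matrix representations\<close>

text \<open>
  The property \<open>conj_rigid\<close> for abstract groups.
\<close>

definition group_conj_rigid :: "('a, 'b) monoid_scheme \<Rightarrow> bool" where
  "group_conj_rigid \<Gamma> \<longleftrightarrow> (\<forall>g\<in>carrier \<Gamma>. \<forall>h\<in>carrier \<Gamma>. \<forall>k\<in>carrier \<Gamma>.
     k \<otimes>\<^bsub>\<Gamma>\<^esub> h = h \<otimes>\<^bsub>\<Gamma>\<^esub> g \<longrightarrow> g \<otimes>\<^bsub>\<Gamma>\<^esub> k = k \<otimes>\<^bsub>\<Gamma>\<^esub> g \<longrightarrow> g \<otimes>\<^bsub>\<Gamma>\<^esub> h = h \<otimes>\<^bsub>\<Gamma>\<^esub> g)"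

lemma group_conj_rigid_of_matrices:
  fixes \<rho> :: "'a \<Rightarrow> int poly^2^2"
  assumes "group \<Gamma>" and mult: "\<And>g h. g \<in> carrier \<Gamma> \<Longrightarrow> h \<in> carrier \<Gamma> \<Longrightarrow> \<rho> (g \<otimes>\<^bsub>\<Gamma>\<^esub> h) = \<rho> g ** \<rho> h"
    and SL: "\<And>g. g \<in> carrier \<Gamma> \<Longrightarrow> congruence_SL2 (\<rho> g)"
    and ker: "\<And>g. g \<in> carrier \<Gamma> \<Longrightarrow> \<rho> g = mat 1 \<Longrightarrow> g = \<one>\<^bsub>\<Gamma>\<^esub>"
    and one: "\<rho> \<one>\<^bsub>\<Gamma>\<^esub> = mat 1"
  shows "group_conj_rigid \<Gamma>"
proof -
  interpret group \<Gamma> by fact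
  have inj: "g = h" if gh: "g \<in> carrier \<Gamma>" "h \<in> carrier \<Gamma>" "\<rho> g = \<rho> h" for g h
  proof -
    have "\<rho> (g \<otimes>\<^bsub>\<Gamma>\<^esub> inv\<^bsub>\<Gamma>\<^esub> h) = \<rho> (h \<otimes>\<^bsub>\<Gamma>\<^esub> inv\<^bsub>\<Gamma>\<^esub> h)" 
      using mult[of g "inv\<^bsub>\<Gamma>\<^esub> h"] mult[of h "inv\<^bsub>\<Gamma>\<^esub> h"] gh by simp
    then have "g \<otimes>\<^bsub>\<Gamma>\<^esub> inv\<^bsub>\<Gamma>\<^esub> h = \<one>\<^bsub>\<Gamma>\<^esub>" using gh one by (intro ker) simp_all
    then show ?thesis using gh by (metis inv_closed inv_equality inv_inv)
  qed
  show ?thesis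
    unfolding group_conj_rigid_def
  proof (intro ballI impI)
    fix g h k assume c: "g \<in> carrier \<Gamma>" "h \<in> carrier \<Gamma>" "k \<in> carrier \<Gamma>"
      and eq: "k \<otimes>\<^bsub>\<Gamma>\<^esub> h = h \<otimes>\<^bsub>\<Gamma>\<^esub> g" "g \<otimes>\<^bsub>\<Gamma>\<^esub> k = k \<otimes>\<^bsub>\<Gamma>\<^esub> g"
    have "\<rho> k ** \<rho> h = \<rho> h ** \<rho> g" "\<rho> g ** \<rho> k = \<rho> k ** \<rho> g"
      using arg_cong[OF eq(1), of \<rho>] arg_cong[OF eq(2), of \<rho>] c by (simp_all add: mult)
    then have "\<rho> g ** \<rho> h = \<rho> h ** \<rho> g" using congruence_SL2_rigid[OF SL[OF c(2)]] by blast
    then have "\<rho> (g \<otimes>\<^bsub>\<Gamma>\<^esub> h) = \<rho> (h \<otimes>\<^bsub>\<Gamma>\<^esub> g)" using c by (simp add: mult)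
    then show "g \<otimes>\<^bsub>\<Gamma>\<^esub> h = h \<otimes>\<^bsub>\<Gamma>\<^esub> g" using c by (intro inj) simp_all
  qed
qed

definition upper :: "int poly \<Rightarrow> int poly^2^2" where "upper f = mk2 1 f 0 1"
definition lower :: "int poly \<Rightarrow> int poly^2^2" where "lower f = mk2 1 0 f 1"

lemma upper_lower_mult [simp]:
  "upper f ** upper g = upper (f + g)" "lower f ** lower g = lower (f + g)"
  by (simp_all add: mat2_eq_iff mat2_mult upper_def lower_def add.commute)

lemma upper_lower_zero [simp]: "upper 0 = mat 1" "lower 0 = mat 1"
  by (simp_all add: mat2_one upper_def lower_def)

lemma upper_lower_SL2: "coeff f 0 = 0 \<Longrightarrow> congruence_SL2 (upper f) \<and> congruence_SL2 (lower f)"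
  by (simp add: congruence_SL2_def upper_def lower_def)

lemma mat1_SL2: "congruence_SL2 (mat 1)"
  by (simp add: congruence_SL2_def mat2_one)

definition row_sum :: "int poly^2^2 \<Rightarrow> 2 \<Rightarrow> int poly" where "row_sum M i = M $ i $ 1 + M $ i $ 2"

lemma row_sum_mult:
  "row_sum (upper f ** M) 1 = row_sum M 1 + f * row_sum M 2" "row_sum (upper f ** M) 2 = row_sum M 2"
  "row_sum (lower f ** M) 2 = row_sum M 2 + f * row_sum M 1" "row_sum (lower f ** M) 1 = row_sum M 1"
  by (simp_all add: row_sum_def mat2_mult upper_def lower_def algebra_simps)

lemma row_sum_one [simp]: "row_sum (mat 1) i = 1"
proof -
  have "i = 1 \<or> i = 2" using exhaust_2 by blast
  then show ?thesis by (auto simp: row_sum_def mat2_one)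
qed

definition fg_letter_matrix :: "nat \<times> bool \<Rightarrow> int poly^2^2" where
  "fg_letter_matrix x = (if fst x = 0 then upper else lower) (if snd x then [:0, 1:] else [:0, -1:])"

definition fg_matrix :: "(nat \<times> bool) list \<Rightarrow> int poly^2^2" where
  "fg_matrix w = foldr (\<lambda>x M. fg_letter_matrix x ** M) w (mat 1)"

lemma fg_matrix_simps [simp]:
  "fg_matrix [] = mat 1" "fg_matrix (x # w) = fg_letter_matrix x ** fg_matrix w"
  by (simp_all add: fg_matrix_def)

lemma fg_letter_matrix_inv: "fg_letter_matrix x ** fg_letter_matrix (inv_letter x) = mat 1"
  by (auto simp: fg_letter_matrix_def inv_letter_def)

lemma fg_matrix_cons: "fg_matrix (fg_cons x w) = fg_letter_matrix x ** fg_matrix w"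
  by (cases w) (auto simp: matrix_mul_assoc fg_letter_matrix_inv)

lemma fg_matrix_mult: "fg_matrix (foldr fg_cons u v) = fg_matrix u ** fg_matrix v"
  by (induction u) (auto simp: fg_matrix_cons matrix_mul_assoc)

lemma fg_matrix_SL2: "congruence_SL2 (fg_matrix w)"
proof (induction w)
  case (Cons x w)
  then show ?case
    by (auto simp: fg_letter_matrix_def intro!: congruence_SL2_mult upper_lower_SL2[THEN conjunct1]
        upper_lower_SL2[THEN conjunct2])
qed (simp add: mat1_SL2)

lemma degree_push_signed:
  fixes P Q :: "int poly" and b :: int
  assumes P: "degree P \<le> Suc (degree Q)" and Q: "Q \<noteq> 0" and b: "b = 1 \<or> b = -1"
    and sgn: "b * coeff P (Suc (degree Q)) * lead_coeff Q \<ge> 0"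
  shows "degree (P + [:0, b:] * Q) = Suc (degree Q) \<and> b * lead_coeff (P + [:0, b:] * Q) * lead_coeff Q > 0"
proof -
  define R where "R = P + [:0, b:] * Q"
  have bQ: "[:0, b:] * Q = pCons 0 (smult b Q)" by simp
  have c: "coeff R (Suc (degree Q)) = coeff P (Suc (degree Q)) + b * lead_coeff Q"
    unfolding R_def bQ by simp
  have "lead_coeff Q * lead_coeff Q > 0" 
    using Q by (metis leading_coeff_0_iff linorder_neqE_linordered_idom mult_neg_neg mult_pos_pos)
  moreover have "b * coeff R (Suc (degree Q)) * lead_coeff Q =
      b * coeff P (Suc (degree Q)) * lead_coeff Q + lead_coeff Q * lead_coeff Q"
    unfolding c using b by (auto simp: algebra_simps)
  ultimately have pos: "b * coeff R (Suc (degree Q)) * lead_coeff Q > 0" using sgn by linarith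
  then have "coeff R (Suc (degree Q)) \<noteq> 0" by auto
  then have "Suc (degree Q) \<le> degree R" by (rule le_degree)
  moreover have "degree R \<le> Suc (degree Q)"
    unfolding R_def bQ using P b by (intro degree_add_le) (auto simp: degree_pCons_le intro: order_trans[OF degree_pCons_le])
  ultimately have "degree R = Suc (degree Q)" by simp
  then show ?thesis using pos by (simp add: R_def)
qed

text \<open>
  The ping-pong sets for the two generators, described by degrees. The sign of the leading coefficients
  distinguishes a generator from its inverse, so that a repeated letter cannot lower the degree.
\<close>

definition fg_dominates :: "nat \<times> bool \<Rightarrow> int poly \<Rightarrow> int poly \<Rightarrow> bool" where
  "fg_dominates x P Q \<longleftrightarrow> Q \<noteq> 0 \<and> degree P = Suc (degree Q) \<and>
     (if snd x then 1 else -1) * lead_coeff P * lead_coeff Q > 0"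

text \<open>
  Ping-pong with the vector \<open>(1, 1)\<close>: its image under a nontrivial reduced word has entries of different
  degrees.
\<close>

lemma fg_row_sums:
  assumes "fg_reduced w" "w \<noteq> []" "fst ` set w \<subseteq> {0, 1}"
  shows "if fst (hd w) = 0 then fg_dominates (hd w) (row_sum (fg_matrix w) 1) (row_sum (fg_matrix w) 2)
     else fg_dominates (hd w) (row_sum (fg_matrix w) 2) (row_sum (fg_matrix w) 1)"
  using assms
proof (induction w)
  case (Cons x w)
  define b :: int where "b = (if snd x then 1 else -1)"
  have b: "b = 1 \<or> b = -1" by (simp add: b_def)
  define M where "M = fg_matrix w"
  have step: "fg_dominates x (P + [:0, b:] * Q) Q"
    if PQ: "w = [] \<and> P = 1 \<and> Q = 1 \<or> w \<noteq> [] \<and> fst (hd w) = fst x \<and> fg_dominates (hd w) P Q \<or>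
        w \<noteq> [] \<and> fst (hd w) \<noteq> fst x \<and> fg_dominates (hd w) Q P" for P Q
  proof -
    from PQ consider (a) "w = []" "P = 1" "Q = 1"
      | (b) "w \<noteq> []" "fst (hd w) = fst x" "fg_dominates (hd w) P Q"
      | (c) "fg_dominates (hd w) Q P" by blast
    then have "degree P \<le> Suc (degree Q) \<and> Q \<noteq> 0 \<and> b * coeff P (Suc (degree Q)) * lead_coeff Q \<ge> 0"
    proof cases
      case a
      then show ?thesis by simp
    next
      case b
      then have "hd w \<noteq> inv_letter x" using Cons.prems(1) by (simp add: fg_reduced_Cons)
      then have "snd (hd w) = snd x" using b by (auto simp: inv_letter_def prod_eq_iff)
      then show ?thesis using b by (auto simp: fg_dominates_def b_def)
    next
      case c
      then show ?thesis by (auto simp: fg_dominates_def coeff_eq_0)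
    qed
    then show ?thesis
      using degree_push_signed[of P Q b] b unfolding fg_dominates_def b_def by auto
  qed
  have IH: "w \<noteq> [] \<Longrightarrow> if fst (hd w) = 0 then fg_dominates (hd w) (row_sum M 1) (row_sum M 2)
     else fg_dominates (hd w) (row_sum M 2) (row_sum M 1)"
    unfolding M_def using Cons by (auto simp: fg_reduced_Cons)
  have one: "w = [] \<Longrightarrow> row_sum M i = 1" for i by (simp add: M_def)
  have fst: "fst x \<in> {0, 1}" "w \<noteq> [] \<Longrightarrow> fst (hd w) \<in> {0, 1}"
    using Cons.prems(3) by (auto simp: image_subset_iff)
  have bb: "(if snd x then [:0, 1:] else [:0, -1:]) = [:0, b:]" by (simp add: b_def)
  show ?case
  proof (cases "fst x = 0")
    case True
    have "fg_dominates x (row_sum M 1 + [:0, b:] * row_sum M 2) (row_sum M 2)"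
      by (rule step, cases "w = []") (use IH one fst True in \<open>auto split: if_splits\<close>)
    then show ?thesis using True by (simp add: fg_letter_matrix_def bb row_sum_mult flip: M_def del: mult_pCons_left)
  next
    case False
    have "fg_dominates x (row_sum M 2 + [:0, b:] * row_sum M 1) (row_sum M 1)"
      by (rule step, cases "w = []") (use IH one fst False in \<open>auto split: if_splits\<close>)
    then show ?thesis using False by (simp add: fg_letter_matrix_def bb row_sum_mult flip: M_def del: mult_pCons_left)
  qed
qed simp

theorem free_group_conj_rigid: "group_conj_rigid (free_group {0, 1 :: nat})"
proof (rule group_conj_rigid_of_matrices[where \<rho> = fg_matrix])
  show "group (free_group {0, 1 :: nat})" by (rule group_free_group)
  show "w = \<one>\<^bsub>free_group {0, 1}\<^esub>"
    if w: "w \<in> carrier (free_group {0, 1})" "fg_matrix w = mat 1" for w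
  proof -
    have "w = []"
    proof (rule ccontr)
      assume "w \<noteq> []"
      then show False using fg_row_sums[of w] w by (auto simp: free_group_def fg_dominates_def split: if_splits)
    qed
    then show ?thesis by (simp add: free_group_def)
  qed
qed (simp_all add: free_group_def fg_matrix_mult fg_matrix_SL2)

text \<open>
  The element \<open>(m, n)\<close> of \<open>\<int>\<^sup>2\<close> acts by adding \<open>m X + n X\<^sup>2\<close> times the second coordinate to the first.
  This polynomial has positive degree for every nontrivial \<open>(m, n)\<close>, so each syllable of a reduced word
  increases the degree.
\<close>

definition fp_letter_matrix :: "(int \<times> int) + int \<Rightarrow> int poly^2^2" where
  "fp_letter_matrix x = (case x of Inl (m, n) \<Rightarrow> upper [:0, m, n:] | Inr k \<Rightarrow> lower [:0, k:])"

definition fp_matrix :: "((int \<times> int) + int) list \<Rightarrow> int poly^2^2" where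
  "fp_matrix w = foldr (\<lambda>x M. fp_letter_matrix x ** M) w (mat 1)"

lemma fp_matrix_simps [simp]:
  "fp_matrix [] = mat 1" "fp_matrix (x # w) = fp_letter_matrix x ** fp_matrix w"
  by (simp_all add: fp_matrix_def)

abbreviation (input) "Z2 \<equiv> integer_group \<times>\<times> integer_group"

lemma fp_letter_matrix_mult:
  "fp_letter_matrix (Inl g) ** fp_letter_matrix (Inl g') = fp_letter_matrix (Inl (g \<otimes>\<^bsub>Z2\<^esub> g'))"
  "fp_letter_matrix (Inr k) ** fp_letter_matrix (Inr k') = fp_letter_matrix (Inr (k \<otimes>\<^bsub>integer_group\<^esub> k'))"
  by (auto simp: fp_letter_matrix_def split: prod.split)

lemma fp_letter_matrix_one:
  "fp_letter_matrix (Inl \<one>\<^bsub>Z2\<^esub>) = mat 1" "fp_letter_matrix (Inr \<one>\<^bsub>integer_group\<^esub>) = mat 1"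
  by (auto simp: fp_letter_matrix_def)

lemma fp_matrix_cons: "fp_matrix (fp_cons Z2 integer_group x w) = fp_letter_matrix x ** fp_matrix w"
proof (cases w)
  case Nil
  then show ?thesis by (cases x) simp_all
next
  case (Cons y v)
  have "fp_letter_matrix x ** fp_matrix w = (fp_letter_matrix x ** fp_letter_matrix y) ** fp_matrix v"
    by (simp add: Cons matrix_mul_assoc)
  moreover have "fp_matrix (fp_cons Z2 integer_group x w) =
      (fp_letter_matrix x ** fp_letter_matrix y) ** fp_matrix v"
  proof (cases x)
    case x: (Inl g)
    show ?thesis
    proof (cases y)
      case (Inl g')
      show ?thesis unfolding Cons x Inl fp_letter_matrix_mult fp_cons.simps
        by (cases "g \<otimes>\<^bsub>Z2\<^esub> g' = \<one>\<^bsub>Z2\<^esub>")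
          (simp_all only: fp_matrix_simps fp_letter_matrix_one matrix_mul_lid if_True if_False simp_thms)
    qed (simp add: Cons x matrix_mul_assoc)
  next
    case x: (Inr k)
    show ?thesis
    proof (cases y)
      case (Inr k')
      show ?thesis unfolding Cons x Inr fp_letter_matrix_mult fp_cons.simps
        by (cases "k \<otimes>\<^bsub>integer_group\<^esub> k' = \<one>\<^bsub>integer_group\<^esub>")
          (simp_all only: fp_matrix_simps fp_letter_matrix_one matrix_mul_lid if_True if_False simp_thms)
    qed (simp add: Cons x matrix_mul_assoc)
  qed
  ultimately show ?thesis by simp
qed

lemma fp_matrix_mult:
  "fp_matrix (foldr (fp_cons Z2 integer_group) u v) = fp_matrix u ** fp_matrix v"
  by (induction u) (auto simp: fp_matrix_cons matrix_mul_assoc)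

lemma fp_matrix_SL2: "congruence_SL2 (fp_matrix w)"
proof (induction w)
  case (Cons x w)
  then show ?case
    by (auto simp: fp_letter_matrix_def split: sum.split prod.split intro!: congruence_SL2_mult upper_lower_SL2[THEN conjunct1]
        upper_lower_SL2[THEN conjunct2])
qed (simp add: mat1_SL2)

lemma degree_push:
  fixes P Q f :: "int poly"
  assumes "degree P \<le> degree Q" "Q \<noteq> 0" "degree f \<ge> 1"
  shows "degree Q < degree (P + f * Q)"
proof -
  have "degree (f * Q) = degree f + degree Q" using assms by (intro degree_mult_eq) auto
  then have "degree P < degree (f * Q)" using assms by simp
  then show ?thesis using degree_add_eq_right[of P "f * Q"] \<open>degree (f * Q) = degree f + degree Q\<close> assms by simp
qed

lemma fp_row_sums:
  assumes "fp_reduced Z2 integer_group w" "w \<noteq> []"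
  shows "if isl (hd w) then degree (row_sum (fp_matrix w) 2) < degree (row_sum (fp_matrix w) 1) \<and> row_sum (fp_matrix w) 2 \<noteq> 0
     else degree (row_sum (fp_matrix w) 1) < degree (row_sum (fp_matrix w) 2) \<and> row_sum (fp_matrix w) 1 \<noteq> 0"
  using assms
proof (induction w)
  case (Cons x w)
  define M where "M = fp_matrix w"
  have x: "fp_letter Z2 integer_group x" and w: "fp_reduced Z2 integer_group w"
    and alt: "w = [] \<or> isl x \<noteq> isl (hd w)"
    using Cons.prems(1) by (auto simp: fp_reduced_Cons)
  have IH: "w \<noteq> [] \<Longrightarrow> if isl (hd w) then degree (row_sum M 2) < degree (row_sum M 1) \<and> row_sum M 2 \<noteq> 0
     else degree (row_sum M 1) < degree (row_sum M 2) \<and> row_sum M 1 \<noteq> 0"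
    unfolding M_def using Cons.IH w by blast
  have one: "w = [] \<Longrightarrow> row_sum M i = 1" for i by (simp add: M_def)
  show ?case
  proof (cases x)
    case (Inl g)
    obtain m n where g: "g = (m, n)" by (cases g)
    have "m \<noteq> 0 \<or> n \<noteq> 0" using x Inl g by auto
    then have f: "degree [:0, m, n:] \<ge> 1" by auto
    have "degree (row_sum M 1) \<le> degree (row_sum M 2)" "row_sum M 2 \<noteq> 0"
      using alt IH one Inl by (cases "w = []"; force split: if_splits)+
    from degree_push[OF this f] this show ?thesis
      using Inl g by (simp add: fp_letter_matrix_def row_sum_mult flip: M_def del: mult_pCons_left)
  next
    case (Inr k)
    have f: "degree [:0, k:] \<ge> 1" using x Inr by auto
    have "degree (row_sum M 2) \<le> degree (row_sum M 1)" "row_sum M 1 \<noteq> 0"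
      using alt IH one Inr by (cases "w = []"; force split: if_splits)+
    from degree_push[OF this f] this show ?thesis
      using Inr by (simp add: fp_letter_matrix_def row_sum_mult flip: M_def del: mult_pCons_left)
  qed
qed simp

theorem free_product_conj_rigid: "group_conj_rigid (free_product Z2 integer_group)"
proof (rule group_conj_rigid_of_matrices[where \<rho> = fp_matrix])
  show "group (free_product Z2 integer_group)"
    by (intro group_free_product DirProd_group group_integer_group)
  show "w = \<one>\<^bsub>free_product Z2 integer_group\<^esub>"
    if w: "w \<in> carrier (free_product Z2 integer_group)" "fp_matrix w = mat 1" for w
  proof -
    have "w = []"
    proof (rule ccontr)
      assume "w \<noteq> []"
      then show False using fp_row_sums[of w] w by (auto simp: free_product_def split: if_splits)
    qed
    then show ?thesis by (simp add: free_product_def)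
  qed
qed (simp_all add: free_product_def fp_matrix_mult fp_matrix_SL2)

section \<open>Embeddings into the group of piecewise linear homeomorphisms\<close>

lemma hom_PL_mult:
  "\<phi> \<in> hom \<Gamma> PL_circle \<Longrightarrow> g \<in> carrier \<Gamma> \<Longrightarrow> h \<in> carrier \<Gamma> \<Longrightarrow> \<phi> (g \<otimes>\<^bsub>\<Gamma>\<^esub> h) = \<phi> g \<circ> \<phi> h"
  by (simp add: hom_def PL_circle_def)

lemma hom_PL_homeo: "\<phi> \<in> hom \<Gamma> PL_circle \<Longrightarrow> g \<in> carrier \<Gamma> \<Longrightarrow> PL_homeo (\<phi> g)"
  by (auto simp: hom_def PL_circle_def)

lemma hom_PL_one:
  assumes "group \<Gamma>" "\<phi> \<in> hom \<Gamma> PL_circle"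
  shows "\<phi> \<one>\<^bsub>\<Gamma>\<^esub> = id"
  using hom_one[OF assms(2,1) group_PL_circle] by (simp add: PL_circle_def)

lemma rigid_PL_group_of_embedding:
  assumes \<Gamma>: "group \<Gamma>" and rigid: "group_conj_rigid \<Gamma>"
    and \<phi>: "\<phi> \<in> hom \<Gamma> PL_circle" and inj: "inj_on \<phi> (carrier \<Gamma>)"
  shows "rigid_PL_group {f \<in> \<phi> ` carrier \<Gamma>. \<exists>F. lifts F f}"
proof -
  interpret group \<Gamma> by fact
  note mult = hom_PL_mult[OF \<phi>] and one = hom_PL_one[OF \<Gamma> \<phi>]
  define G where "G = {f \<in> \<phi> ` carrier \<Gamma>. \<exists>F. lifts F f}"
  have "rigid_PL_group G"
  proof
    show "PL_homeo f" if "f \<in> G" for f using that hom_PL_homeo[OF \<phi>] by (auto simp: G_def)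
    show "\<exists>F. lifts F f" if "f \<in> G" for f using that by (simp add: G_def)
    show "f \<circ> g \<in> G" if fg: "f \<in> G" "g \<in> G" for f g
    proof -
      obtain a b where ab: "a \<in> carrier \<Gamma>" "b \<in> carrier \<Gamma>" "f = \<phi> a" "g = \<phi> b"
        using fg by (auto simp: G_def)
      have "f \<circ> g = \<phi> (a \<otimes>\<^bsub>\<Gamma>\<^esub> b)" using ab mult by simp
      then have "f \<circ> g \<in> \<phi> ` carrier \<Gamma>" using ab by simp
      moreover have "\<exists>F. lifts F (f \<circ> g)" using fg lifts_comp unfolding G_def by blast
      ultimately show ?thesis by (simp add: G_def)
    qed
    show "id \<in> G" using one lifts_id one_closed unfolding G_def by (metis (mono_tags, lifting) imageI mem_Collect_eq)
    show "\<exists>g\<in>G. f \<circ> g = id \<and> g \<circ> f = id" if f: "f \<in> G" for f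
    proof -
      obtain a F where a: "a \<in> carrier \<Gamma>" "f = \<phi> a" "lifts F f" using f by (auto simp: G_def)
      define g where "g = \<phi> (inv\<^bsub>\<Gamma>\<^esub> a)"
      have "f \<circ> g = id" "g \<circ> f = id"
        using mult[of a "inv\<^bsub>\<Gamma>\<^esub> a"] mult[of "inv\<^bsub>\<Gamma>\<^esub> a" a] one a by (simp_all add: g_def)
      moreover from this have "g \<in> G" using lifts_inv[OF a(3)] a(1) by (auto simp: G_def g_def)
      ultimately show ?thesis by blast
    qed
    show "conj_rigid G"
      unfolding conj_rigid_def
    proof (intro ballI impI)
      fix f g h assume "f \<in> G" "g \<in> G" "h \<in> G" and eq: "h \<circ> g = g \<circ> f" "f \<circ> h = h \<circ> f"
      then obtain a b c where abc: "a \<in> carrier \<Gamma>" "b \<in> carrier \<Gamma>" "c \<in> carrier \<Gamma>"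
        "f = \<phi> a" "g = \<phi> b" "h = \<phi> c" by (auto simp: G_def)
      have "c \<otimes>\<^bsub>\<Gamma>\<^esub> b = b \<otimes>\<^bsub>\<Gamma>\<^esub> a" "a \<otimes>\<^bsub>\<Gamma>\<^esub> c = c \<otimes>\<^bsub>\<Gamma>\<^esub> a"
        using eq abc by (auto intro!: inj_onD[OF inj] simp: mult)
      then have "a \<otimes>\<^bsub>\<Gamma>\<^esub> b = b \<otimes>\<^bsub>\<Gamma>\<^esub> a" using rigid abc unfolding group_conj_rigid_def by blast
      then show "f \<circ> g = g \<circ> f" using mult[of a b] mult[of b a] abc by simp
    qed
  qed
  then show ?thesis by (simp add: G_def)
qed

text \<open>
  The orientation-preserving elements are the ones with an increasing lift; they include the squares.
\<close>

lemma square_in_orientation_preserving: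
  assumes "\<phi> \<in> hom \<Gamma> PL_circle" "g \<in> carrier \<Gamma>" "g \<otimes>\<^bsub>\<Gamma>\<^esub> g = h" "h \<in> carrier \<Gamma>"
  shows "\<phi> h \<in> {f \<in> \<phi> ` carrier \<Gamma>. \<exists>F. lifts F f}"
proof -
  have "\<phi> h = \<phi> g \<circ> \<phi> g" using hom_PL_mult[OF assms(1,2,2)] assms(3) by simp
  then have "\<exists>F. lifts F (\<phi> h)" using PL_homeo_square_lifts[OF hom_PL_homeo[OF assms(1,2)]] by simp
  then show ?thesis using assms(4) by blast
qed

lemma fg_positive_append:
  "list_all snd u \<Longrightarrow> list_all snd v \<Longrightarrow> foldr fg_cons u v = u @ v"
proof (induction u)
  case (Cons x u)
  then have "list_all snd (u @ v)" by simp
  then have "fg_cons x (u @ v) = x # u @ v"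
    using Cons.prems by (cases "u @ v") (auto simp: inv_letter_def)
  then show ?case using Cons by simp
qed simp

lemma fg_positive_reduced: "list_all snd w \<Longrightarrow> fg_reduced w"
proof (induction w)
  case (Cons x w)
  then show ?case by (cases w) (auto simp: fg_reduced_Cons inv_letter_def)
qed (simp add: fg_reduced_def)

text \<open>
  With \<open>a\<close>, \<open>b\<close>, \<open>z\<close> the squares of the generators, powers of \<open>a\<close> and \<open>b\<close> would commute; but positive
  words multiply by concatenation, without cancellation.
\<close>

theorem F2_times_Z_not_in_PL:
  assumes \<phi>: "\<phi> \<in> hom (free_group {0, 1 :: nat} \<times>\<times> integer_group) PL_circle"
    and inj: "inj_on \<phi> (carrier (free_group {0, 1 :: nat} \<times>\<times> integer_group))"
  shows False
proof -
  define F2 where "F2 = free_group {0, 1 :: nat}"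
  have grp: "group F2" unfolding F2_def by (rule group_free_group)
  have car: "carrier (F2 \<times>\<times> integer_group) = carrier F2 \<times> UNIV" by (simp add: DirProd_def integer_group_def)
  have one: "\<one>\<^bsub>F2\<^esub> = []" by (simp add: F2_def free_group_def)
  interpret F: group F2 by (rule grp)
  have mult: "\<phi> (u, i) \<circ> \<phi> (v, j) = \<phi> (u \<otimes>\<^bsub>F2\<^esub> v, i + j)" if "u \<in> carrier F2" "v \<in> carrier F2" for u v i j
    using hom_PL_mult[OF \<phi>, of "(u, i)" "(v, j)"] that car unfolding F2_def[symmetric] by simp
  have inj': "u = v \<and> i = j" if "\<phi> (u, i) = \<phi> (v, j)" "u \<in> carrier F2" "v \<in> carrier F2" for u v i j
    using inj_onD[OF inj that(1)] that car unfolding F2_def by simp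
  have phi1: "\<phi> ([], 0) = id"
    using hom_PL_one[OF DirProd_group[OF group_free_group group_integer_group] \<phi>]
    unfolding F2_def[symmetric] by (simp add: one)
  have nil: "[] \<in> carrier F2" using F.one_closed one by simp
  define \<psi> where "\<psi> = (\<lambda>w. \<phi> (w, 0::int))"
  have \<psi>: "\<psi> \<in> hom F2 PL_circle"
  proof (rule homI)
    show "\<psi> w \<in> carrier PL_circle" if "w \<in> carrier F2" for w
      using hom_PL_homeo[OF \<phi>, of "(w, 0)"] that car unfolding F2_def by (simp add: \<psi>_def PL_circle_def)
    show "\<psi> (u \<otimes>\<^bsub>F2\<^esub> v) = \<psi> u \<otimes>\<^bsub>PL_circle\<^esub> \<psi> v" if "u \<in> carrier F2" "v \<in> carrier F2" for u v
      using mult[OF that, of 0 0] by (simp add: \<psi>_def PL_circle_def)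
  qed
  have inj\<psi>: "inj_on \<psi> (carrier F2)" using inj' by (auto intro!: inj_onI simp: \<psi>_def)
  define G where "G = {f \<in> \<psi> ` carrier F2. \<exists>F. lifts F f}"
  have "rigid_PL_group G"
    unfolding G_def
    by (rule rigid_PL_group_of_embedding[OF grp _ \<psi> inj\<psi>]) (unfold F2_def, rule free_group_conj_rigid)
  then interpret rigid_PL_group G .
  have word: "w \<in> carrier F2" if "list_all snd w" "fst ` set w \<subseteq> {0, 1}" for w
    using that fg_positive_reduced by (simp add: F2_def free_group_def)
  have rep: "replicate k (i, True) \<in> carrier F2" if "i \<in> {0, 1}" for k i
    by (rule word) (use that in \<open>auto simp: list_all_iff\<close>)
  have rep_mult: "replicate k (i, True) \<otimes>\<^bsub>F2\<^esub> replicate l (j, True) = replicate k (i, True) @ replicate l (j, True)"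
    for k l and i j :: nat
  proof -
    have "u \<otimes>\<^bsub>F2\<^esub> v = foldr fg_cons u v" for u v by (simp add: F2_def free_group_def)
    then show ?thesis by (simp only:) (rule fg_positive_append, simp_all add: list_all_iff)
  qed
  define a where "a = \<psi> (replicate 2 (0, True))"
  define b where "b = \<psi> (replicate 2 (1, True))"
  have in_G: "\<psi> (replicate 2 (i, True)) \<in> G" if "i \<in> {0, 1}" for i
    unfolding G_def
  proof (rule square_in_orientation_preserving[OF \<psi>])
    show "replicate 1 (i, True) \<in> carrier F2" "replicate 2 (i, True) \<in> carrier F2" using rep that by blast+
    show "replicate 1 (i, True) \<otimes>\<^bsub>F2\<^esub> replicate 1 (i, True) = replicate 2 (i, True)"
      unfolding rep_mult by (simp add: numeral_2_eq_2)
  qed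
  have aG: "a \<in> G" and bG: "b \<in> G" unfolding a_def b_def using in_G by simp_all
  have pow: "\<psi> (replicate 2 (i, True)) ^^ N = \<psi> (replicate (2 * N) (i, True))" if "i \<in> {0, 1}" for i N
  proof (induction N)
    case 0
    then show ?case by (simp add: \<psi>_def phi1)
  next
    case (Suc N)
    have "\<psi> (replicate 2 (i, True)) \<circ> \<psi> (replicate (2 * N) (i, True)) =
        \<psi> (replicate 2 (i, True) \<otimes>\<^bsub>F2\<^esub> replicate (2 * N) (i, True))"
      using hom_PL_mult[OF \<psi> rep[OF that] rep[OF that]] by simp
    also have "\<dots> = \<psi> (replicate (2 * Suc N) (i, True))" unfolding rep_mult
      by (simp only: replicate_add[symmetric] mult_Suc_right)
    finally show ?case using Suc by simp
  qed
  define z where "z = \<phi> ([], 2)"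
  have "z = \<phi> ([], 1) \<circ> \<phi> ([], 1)" using mult[OF nil nil, of 1 1] F.l_one[OF nil] by (simp add: z_def one)
  moreover have "PL_homeo (\<phi> ([], 1))"
    using hom_PL_homeo[OF \<phi>, of "([], 1)"] nil car unfolding F2_def by simp
  ultimately obtain Z where Z: "lifts Z z" using PL_homeo_square_lifts by metis
  have comm: "z \<circ> g = g \<circ> z" if "g \<in> G" for g
  proof -
    obtain w where w: "w \<in> carrier F2" "g = \<phi> (w, 0)" using \<open>g \<in> G\<close> by (auto simp: G_def \<psi>_def)
    then show ?thesis
      using mult[OF nil w(1), of 2 0] mult[OF w(1) nil, of 0 2] F.l_one[OF w(1)] F.r_one[OF w(1)]
      by (simp add: z_def one)
  qed
  have zpow: "z ^^ N = \<phi> ([], 2 * int N)" for N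
  proof (induction N)
    case (Suc N)
    then show ?case using mult[OF nil nil, of 2 "2 * int N"] F.l_one[OF nil] by (simp add: z_def one)
  qed (simp add: phi1)
  have zinf: "z ^^ N \<noteq> id" if "N \<ge> 1" for N
  proof
    assume "z ^^ N = id"
    then have "\<phi> ([], 2 * int N) = \<phi> ([], 0)" by (simp add: zpow phi1)
    then show False using inj'[OF _ nil nil] that by fastforce
  qed
  obtain M N where MN: "M \<ge> 1" "N \<ge> 1" "(a ^^ M) \<circ> (b ^^ N) = (b ^^ N) \<circ> (a ^^ M)"
    using central_element_commute[OF aG bG Z comm zinf] by blast
  have "\<psi> (replicate (2 * M) (0, True) \<otimes>\<^bsub>F2\<^esub> replicate (2 * N) (1, True)) =
      \<psi> (replicate (2 * N) (1, True) \<otimes>\<^bsub>F2\<^esub> replicate (2 * M) (0, True))"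
    using MN(3) unfolding a_def b_def by (simp add: pow hom_PL_mult[OF \<psi>] rep)
  then have "replicate (2 * M) (0::nat, True) \<otimes>\<^bsub>F2\<^esub> replicate (2 * N) (1, True) =
      replicate (2 * N) (1, True) \<otimes>\<^bsub>F2\<^esub> replicate (2 * M) (0, True)"
    by (rule inj_onD[OF inj\<psi>]) (simp_all add: rep)
  then have "hd (replicate (2 * M) (0::nat, True) @ replicate (2 * N) (1, True)) =
      hd (replicate (2 * N) (1, True) @ replicate (2 * M) (0, True))"
    unfolding rep_mult by simp
  then show False using MN(1,2) by (simp add: hd_append)
qed

text \<open>
  Squares again provide lifts, so the even elements of the factor \<open>\<int>\<^sup>2\<close> form the action \<open>R\<close>, and the
  square of the generator of the other factor plays the role of \<open>t\<close>.
\<close>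

theorem Z2_free_product_Z_not_in_PL:
  assumes \<phi>: "\<phi> \<in> hom (free_product Z2 integer_group) PL_circle"
    and inj: "inj_on \<phi> (carrier (free_product Z2 integer_group))"
  shows False
proof -
  define P where "P = free_product Z2 integer_group"
  have grp: "group P" unfolding P_def
    by (intro group_free_product DirProd_group group_integer_group)
  note \<phi>' = \<phi>[folded P_def] and inj' = inj[folded P_def]
  define e :: "int \<Rightarrow> int \<Rightarrow> ((int \<times> int) + int) list" where
    "e = (\<lambda>m n. if m = 0 \<and> n = 0 then [] else [Inl (m, n)])"
  have e_in: "e m n \<in> carrier P" for m n
    by (auto simp: e_def P_def free_product_def fp_reduced_Cons)
  have e_mult: "e m n \<otimes>\<^bsub>P\<^esub> e m' n' = e (m + m') (n + n')" for m n m' n'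
    by (auto simp: e_def P_def free_product_def)
  define \<tau> :: "int \<Rightarrow> ((int \<times> int) + int) list" where "\<tau> = (\<lambda>k. [Inr k])"
  have \<tau>_in: "\<tau> k \<in> carrier P" if "k \<noteq> 0" for k
    using that by (simp add: \<tau>_def P_def free_product_def fp_reduced_Cons)
  have \<tau>_mult: "\<tau> 1 \<otimes>\<^bsub>P\<^esub> \<tau> 1 = \<tau> 2" by (simp add: \<tau>_def P_def free_product_def)
  have one: "\<one>\<^bsub>P\<^esub> = e 0 0" by (simp add: e_def P_def free_product_def)
  define G where "G = {f \<in> \<phi> ` carrier P. \<exists>F. lifts F f}"
  define R where "R = (\<lambda>m n. \<phi> (e (2 * m) (2 * n)))"
  have R_G: "R m n \<in> G" for m n
    unfolding R_def G_def
    by (rule square_in_orientation_preserving[OF \<phi>' e_in[of m n] _ e_in]) (simp add: e_mult)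
  have G: "rigid_PL_group G"
    unfolding G_def
    by (rule rigid_PL_group_of_embedding[OF grp _ \<phi>' inj']) (unfold P_def, rule free_product_conj_rigid)
  interpret rigid_PL_group G by (rule G)
  have phi1: "\<phi> (e 0 0) = id" using hom_PL_one[OF grp \<phi>'] one by simp
  interpret rigid_Z2 G R
  proof
    show "PL_homeo (R m n)" for m n using R_G PL by blast
    show "\<exists>F. lifts F (R m n)" for m n using R_G lift by blast
    show "R m n \<circ> R m' n' = R (m + m') (n + n')" for m n m' n'
      using hom_PL_mult[OF \<phi>' e_in e_in, of "2 * m" "2 * n" "2 * m'" "2 * n'"] by (simp add: R_def e_mult algebra_simps)
    show "R 0 0 = id" using phi1 by (simp add: R_def)
    show "R m n \<in> G" for m n by (rule R_G)
    show "m = 0 \<and> n = 0" if "R m n = id" for m n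
    proof -
      have "e (2 * m) (2 * n) = e 0 0"
        by (rule inj_onD[OF inj' _ e_in e_in]) (use that phi1 in \<open>simp add: R_def\<close>)
      then show ?thesis by (simp add: e_def split: if_splits)
    qed
  qed
  have "\<phi> (\<tau> 2) \<in> G"
    unfolding G_def by (rule square_in_orientation_preserving[OF \<phi>' \<tau>_in[of 1] _ \<tau>_in]) (simp_all add: \<tau>_mult)
  then obtain m n where mn: "m \<noteq> 0 \<or> n \<noteq> 0" "R m n \<circ> \<phi> (\<tau> 2) = \<phi> (\<tau> 2) \<circ> R m n"
    using commuting_pair by blast
  have "\<phi> (e (2 * m) (2 * n) \<otimes>\<^bsub>P\<^esub> \<tau> 2) = \<phi> (\<tau> 2 \<otimes>\<^bsub>P\<^esub> e (2 * m) (2 * n))"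
    using mn(2) by (simp add: R_def hom_PL_mult[OF \<phi>'] e_in \<tau>_in)
  then have "e (2 * m) (2 * n) \<otimes>\<^bsub>P\<^esub> \<tau> 2 = \<tau> 2 \<otimes>\<^bsub>P\<^esub> e (2 * m) (2 * n)"
    by (rule inj_onD[OF inj']) (simp_all add: e_in \<tau>_in group.is_monoid[OF grp] monoid.m_closed)
  then show False using mn(1) by (auto simp: e_def \<tau>_def P_def free_product_def split: if_splits)
qed

theorem theorem1p1:
  "\<not> (\<exists>\<phi> \<in> hom (free_group {0, 1 :: nat} \<times>\<times> integer_group) PL_circle.
         inj_on \<phi> (carrier (free_group {0, 1 :: nat} \<times>\<times> integer_group))) \<and>
   \<not> (\<exists>\<phi> \<in> hom (free_product (integer_group \<times>\<times> integer_group) integer_group) PL_circle.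
         inj_on \<phi> (carrier (free_product (integer_group \<times>\<times> integer_group) integer_group)))"
  using F2_times_Z_not_in_PL Z2_free_product_Z_not_in_PL by blast

end
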